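(* Let $\{\boldsymbol X_k\}$ be the random iterates generated by Algorithm SQP-ASTRO-DF (described in the context) applied to $\min_{\boldsymbol x} f(\boldsymbol x)=\mathbb E[F(\boldsymbol x,\xi)]$ subject to $\boldsymbol c(\boldsymbol x)=0$, under the standing assumptions of the context. Suppose that: (3) there is $\kappa_{uB}>0$ with $\|\mathsf B_k\|\le\kappa_{uB}$ for all $k$; (4) there is $\Lambda_{\max}>0$ such that, for all $k$ and $i=0,\dots,2d$, $\sup_{\boldsymbol x\in B(\boldsymbol X_k,\Delta_k)}|\ell_k^i(\boldsymbol x)|\le\Lambda_{\max}$; (5) there is a constant $\kappa_{uH}$ such that almost surely $\|\mathsf H_k\|\le\kappa_{uH}-1$ for all $k$; (6) for all $k$, $\mathsf A_k^{N}$ has orthonormal columns, and the singular values of $\mathsf A_k^{R}$ match those of $\mathsf A_k^\top$, in the sense that $\|\mathsf A_k^R \boldsymbol v\|=\|\mathsf A_k^\top\boldsymbol v\|$ for all $\boldsymbol v\in\mathbb R^p$; (7) writing $\boldsymbol s_k^{n}=\mathsf A_k^R\boldsymbol s_k^{nR}+\mathsf A_k^N\boldsymbol s_k^{nN}$, one has $\|\boldsymbol s_k^{nN}\|\le\kappa_{nsd}\|\boldsymbol s_k^{nR}\|$ for some constant $\kappa_{nsd}>0$, and $\boldsymbol s_k^{nR}=0$ (hence $\boldsymbol s_k^n=0$) whenever $\mathsf A_k^\top\boldsymbol c_k=0$; (8) there is $\kappa_{ncr}\in(0,1)$ such that for all $k$, $m_k^{n0}-m_k^{nn}\ge\kappa_{ncr}\frac{\|\mathsf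 A_k^\top\boldsymbol c_k\|}{\|\boldsymbol c_k\|}\min\left(a^n\Delta_k,\frac{\kappa_{A\min}\|\boldsymbol c_k\|}{1+\|\mathsf A_k^\top\mathsf A_k\|}\right)$ (right side read as $0$ if $\boldsymbol c_k=0$); (9) there is $\kappa_{tcr}\in(0,1)$ such that for all $k$, $\|\boldsymbol S_k^t\|\le a^t\Delta_k$ and $M_k^{t0}-M_k^{tt}\ge\kappa_{tcr}\|\boldsymbol G_k^N\|\min\left(a^t\Delta_k,\frac{\|\boldsymbol G_k^N\|}{\kappa_{uH}}\right)$; (10) there are $\kappa_{A\min},\kappa_{A\max}>0$ (the same $\kappa_{A\min}$ as in (8)) such that $\kappa_{A\min}\le\sigma_i(\mathsf A_k)\le\kappa_{A\max}$ for all $k$ and all singular values $\sigma_i(\mathsf A_k)$ of $\mathsf A_k$. Then (i) $\mathbb P\left(\|\boldsymbol c(\boldsymbol X_k)\|\to0\right)=1$; (ii) $\mathbb P\left(\|(\mathsf A_k^N)^\top\nabla f(\boldsymbol X_k)\|\to0\right)=1$.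
   Context: PROBLEM AND STANDING ASSUMPTIONS. $f:\mathbb R^d\to\mathbb R$, $f(\boldsymbol x)=\mathbb E_\xi[F(\boldsymbol x,\xi)]$, is accessible only through noisy evaluations $F(\boldsymbol x,\xi)$; $\boldsymbol c:\mathbb R^d\to\mathbb R^p$ ($p\le d$) and its Jacobian $\mathsf A:\mathbb R^d\to\mathbb R^{p\times d}$ are deterministic and available, and $\operatorname{rank}\mathsf A(\boldsymbol x)=p$ everywhere. Norms are Euclidean (spectral for matrices). Standing: (a) $f$ is continuously differentiable with $\kappa_{Lg}$-Lipschitz gradient and $f\ge f_{\min}$; there is $\kappa_{Lc}>0$ with $\|\boldsymbol c(\boldsymbol x+\boldsymbol s)-\boldsymbol c(\boldsymbol x)-\mathsf A(\boldsymbol x)\boldsymbol s\|\le\frac12\kappa_{Lc}\|\boldsymbol s\|^2$ for all $\boldsymbol x,\boldsymbol s$; and $\|\nabla f(\boldsymbol x)\|\le\kappa_{ug}$, $\|\boldsymbol c(\boldsymbol x)\|\le\kappa_{uc}$ for all $\boldsymbol x$. (b) There are $\sigma_f^2,b_f>0$ such that for all $\boldsymbol x$, all $\kappa>0$ and $n$ iid realizations $\xi_j$, $\mathbb P\big(|\sum_{j=1}^n(F(\boldsymbol x,\xi_j)-f(\boldsymbol x))|\ge n\kappa\big)\le2\exp\big(-\frac{n\kappa^2}{2(b_f\kappa+\sigma_f^2)}\big)$. SAMPLING. $\bar F(\boldsymbol x,n)=\frac1n\sum_{j=1}^nF(\boldsymbol x,\xi_j)$ with iid $\xi_j$ (fresh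 draws, independent of the history), $\hat\sigma(\boldsymbol x,n)=\big((n-1)^{-1}\sum_{j=1}^n(F(\boldsymbol x,\xi_j)-\bar F(\boldsymbol x,n))^2\big)^{1/2}$. At iteration $k$, with iterate $\boldsymbol X_k$ and trust-region radius $\Delta_k$, the points are $\boldsymbol X_k^0=\boldsymbol X_k$, $\boldsymbol X_k^j=\boldsymbol X_k+\Delta_k\boldsymbol e^j$, $\boldsymbol X_k^{d+j}=\boldsymbol X_k-\Delta_k\boldsymbol e^j$ ($j=1,\dots,d$, $\boldsymbol e^j$ the standard basis), and the candidate $\boldsymbol X_k^s$. For $i\in\{0,\dots,2d,s\}$, $N_k^i=\min\{n:\max\{\sigma_{\min},\hat\sigma(\boldsymbol X_k^i,n)\}/\sqrt n\le\kappa_d\Delta_k^2/\sqrt{\lambda_k}\}$, where $\sigma_{\min},\kappa_d>0$ are constants and $\lambda_k$ is a deterministic sequence of order $\log^{1+\epsilon}k$ for a small $\epsilon>0$. Put $\bar F_k^i=\bar F(\boldsymbol X_k^i,N_k^i)$. MODELS. $Q_k(\boldsymbol X_k+\boldsymbol s)=\bar F_k^0+\boldsymbol G_k^\top\boldsymbol s+\frac12\boldsymbol s^\top\mathsf H_k\boldsymbol s$, where $(\beta_0,\dots,\beta_{2d})$ are the coefficients, in the basis $1,s_1,\dots,s_d,\frac12s_1^2,\dots,\frac12s_d^2$ of functions of $\boldsymbol s=\boldsymbol x-\boldsymbol X_k$, of the unique polynomial in the span of this basis interpolating $\bar F_k^i$ at $\boldsymbol X_k^i$, $i=0,\dots,2d$;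 $\boldsymbol G_k=(\beta_1,\dots,\beta_d)$; and $\mathsf H_k=\operatorname{diag}(\beta_{d+1},\dots,\beta_{2d})-\sum_{i=1}^p[\boldsymbol y_k]_i\nabla^2c_i(\boldsymbol X_k)$ for chosen multipliers $\boldsymbol y_k\in\mathbb R^p$, approximated by any method making $\mathsf H_k$ uniformly bounded. The noiseless model is $q_k(\boldsymbol x)=f(\boldsymbol X_k)+g_k^\top(\boldsymbol x-\boldsymbol X_k)+\frac12(\boldsymbol x-\boldsymbol X_k)^\top\mathsf B_k(\boldsymbol x-\boldsymbol X_k)$, the analogous model built from the exact values $f(\boldsymbol X_k^i)$, with $\mathsf B_k$ an approximation of the Hessian of the Lagrangian. $\ell_k^i$, $i=0,\dots,2d$, are the Lagrange polynomials of the interpolation set $\{\boldsymbol X_k^i\}_{i=0}^{2d}$ (in the span of the basis above). STEPS. $\boldsymbol c_k=\boldsymbol c(\boldsymbol X_k)$, $\mathsf A_k=\mathsf A(\boldsymbol X_k)$; the columns of $\mathsf A_k^R\in\mathbb R^{d\times p}$ and $\mathsf A_k^N\in\mathbb R^{d\times(d-p)}$ are bases of the column space of $\mathsf A_k^\top$ and the null space of $\mathsf A_k$. Fix $a^n,a^t\in(0,1)$. Normal step: $\boldsymbol s_k^n$ approximately minimizes $m_k^n(\boldsymbol s)=\|\mathsf A_k\boldsymbol s+\boldsymbol c_k\|$ over $\|\boldsymbol s\|\le a^n\Delta_k$; $m_k^{n0}=m_k^n(0)$, $m_k^{nn}=m_k^n(\boldsymbol s_k^n)$. Tangent step: $\boldsymbol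 S_k^t=\mathsf A_k^N\boldsymbol S_k^{tN}$ approximately minimizes $M_k^t(\boldsymbol s)=(\boldsymbol G_k+\mathsf H_k\boldsymbol s_k^n)^\top\boldsymbol s+\frac12\boldsymbol s^\top\mathsf H_k\boldsymbol s$ over $\mathsf A_k\boldsymbol s=0$, $\|\boldsymbol s\|\le a^t\Delta_k$; $M_k^{t0}=M_k^t(0)$, $M_k^{tt}=M_k^t(\boldsymbol S_k^t)$, $\boldsymbol G_k^N=(\mathsf A_k^N)^\top(\boldsymbol G_k+\mathsf H_k\boldsymbol s_k^n)$. Composite step $\boldsymbol S_k=\boldsymbol s_k^n+\boldsymbol S_k^t$, $\boldsymbol X_k^s=\boldsymbol X_k+\boldsymbol S_k$. MERIT FUNCTION. With penalty $\varsigma_k$: $M_k(\boldsymbol x)=Q_k(\boldsymbol x)+\varsigma_k\|\boldsymbol c_k+\mathsf A_k(\boldsymbol x-\boldsymbol X_k)\|$, $M_k^0=M_k(\boldsymbol X_k)$, $M_k^s=M_k(\boldsymbol X_k^s)$; $\Phi_k^0=\bar F_k^0+\varsigma_k\|\boldsymbol c_k\|$, $\Phi_k^s=\bar F_k^s+\varsigma_k\|\boldsymbol c(\boldsymbol X_k^s)\|$; $Q_k^0=Q_k(\boldsymbol X_k)$, $Q_k^n=Q_k(\boldsymbol X_k+\boldsymbol s_k^n)$. ALGORITHM SQP-ASTRO-DF. Inputs: $\boldsymbol x_0$, $\Delta_0>0$, initial penalty $\varsigma_{-1}=\varsigma_{\min}>0$. Parameters: $\eta,\nu\in(0,1)$,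 $0<\gamma_{dec}<1\le\gamma_{inc}$, $\tau_1\ge1$, $\tau_2>0$ with $(\tau_1-1)\tau_2>0$, $\mu>0$, $\varsigma_{\max}^B>0$, $\Delta_{\max}>\Delta_0$. For $k=0,1,\dots$: (1) build $Q_k$; (2) compute $\boldsymbol s_k^n$, $\boldsymbol S_k^t$, $\boldsymbol X_k^s$; (3) set $\varsigma_k^C=\max\Big(\varsigma_k^B,\frac{-[(Q_k^0-Q_k^n)+(M_k^{t0}-M_k^{tt})]}{(1-\nu)(m_k^{n0}-m_k^{nn})}\Big)$ for some $\varsigma_k^B\in[0,\varsigma_{\max}^B]$ (with $\varsigma_k^C=\varsigma_k^B$ if $m_k^{n0}=m_k^{nn}$); (4) set $\varsigma_k=\max\{\varsigma_k^C,\tau_1\varsigma_{k-1},\varsigma_{k-1}+\tau_2\}$ if $\varsigma_{k-1}<\varsigma_k^C$, otherwise $\varsigma_k=\varsigma_{k-1}$; (5) compute $\bar F_k^s$, $\rho_k=(\Phi_k^0-\Phi_k^s)/(M_k^0-M_k^s)$ and $\pi_k=\|\boldsymbol c_k\|+\|(\mathsf A_k^N)^\top\boldsymbol G_k\|$; (6) if $\rho_k\ge\eta$ and $\pi_k\ge\mu\Delta_k$ (successful iteration), set $\boldsymbol X_{k+1}=\boldsymbol X_k^s$, $\Delta_{k+1}=\min\{\gamma_{inc}\Delta_k,\Delta_{\max}\}$; otherwise $\boldsymbol X_{k+1}=\boldsymbol X_k$, $\Delta_{k+1}=\gamma_{dec}\Delta_k$. *)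

theory Defs
  imports "HOL-Probability.Probability" "HOL-Library.Landau_Symbols"
begin

section \<open>Linear algebra\<close>

abbreviation spectral_norm :: "real^'n^'m \<Rightarrow> real" where
  "spectral_norm B \<equiv> onorm (\<lambda>v. B *v v)"

text \<open>For a wide matrix (at most as many rows as columns) these are its singular values; none of
  them is dropped and no spurious zero is added, since the Gram matrix used has the size of the
  shorter side.\<close>

definition singular_values :: "real^'d^'p \<Rightarrow> real set" where
  "singular_values B =
     {\<sigma>. 0 \<le> \<sigma> \<and> (\<exists>u. u \<noteq> 0 \<and> (B ** transpose B) *v u = \<sigma>\<^sup>2 *\<^sub>R u)}"

definition basis_family :: "'i set \<Rightarrow> ('i \<Rightarrow> real^'d) \<Rightarrow> (real^'d) set \<Rightarrow> bool" where
  "basis_family I V S \<longleftrightarrow> inj_on V I \<and> independent (V ` I) \<and> span (V ` I) = S"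


section \<open>Problem\<close>

definition nlp_problem ::
  "'x measure \<Rightarrow> (real^'d \<Rightarrow> 'x \<Rightarrow> real) \<Rightarrow> (real^'d \<Rightarrow> real) \<Rightarrow> (real^'d \<Rightarrow> real^'d)
   \<Rightarrow> (real^'d \<Rightarrow> real^'p) \<Rightarrow> (real^'d \<Rightarrow> real^'d^'p) \<Rightarrow> bool" where
  "nlp_problem \<Xi> F f gf c A \<longleftrightarrow>
     prob_space \<Xi> \<and>
     case_prod F \<in> borel_measurable (borel \<Otimes>\<^sub>M \<Xi>) \<and>
     (\<forall>x. integrable \<Xi> (F x) \<and> f x = (\<integral>\<xi>. F x \<xi> \<partial>\<Xi>)) \<and>
     (\<forall>x. GDERIV f x :> gf x) \<and>
     CARD('p) \<le> CARD('d) \<and>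
     (\<forall>x. (c has_derivative (\<lambda>s. A x *v s)) (at x)) \<and>
     (\<forall>x. rank (A x) = CARD('p))"

definition smooth_bounded ::
  "(real^'d \<Rightarrow> real) \<Rightarrow> (real^'d \<Rightarrow> real^'d) \<Rightarrow> (real^'d \<Rightarrow> real^'p) \<Rightarrow> (real^'d \<Rightarrow> real^'d^'p)
   \<Rightarrow> real \<Rightarrow> real \<Rightarrow> real \<Rightarrow> real \<Rightarrow> real \<Rightarrow> bool" where
  "smooth_bounded f gf c A \<kappa>Lg fmin \<kappa>Lc \<kappa>ug \<kappa>uc \<longleftrightarrow>
     continuous_on UNIV gf \<and> \<kappa>Lg-lipschitz_on UNIV gf \<and> (\<forall>x. fmin \<le> f x) \<and>
     0 < \<kappa>Lc \<and> (\<forall>x s. norm (c (x + s) - c x - A x *v s) \<le> 1/2 * \<kappa>Lc * (norm s)\<^sup>2) \<and>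
     (\<forall>x. norm (gf x) \<le> \<kappa>ug) \<and> (\<forall>x. norm (c x) \<le> \<kappa>uc)"

definition bernstein_noise ::
  "'x measure \<Rightarrow> (real^'d \<Rightarrow> 'x \<Rightarrow> real) \<Rightarrow> (real^'d \<Rightarrow> real) \<Rightarrow> real \<Rightarrow> real \<Rightarrow> bool" where
  "bernstein_noise \<Xi> F f \<sigma>f2 bf \<longleftrightarrow>
     0 < \<sigma>f2 \<and> 0 < bf \<and>
     (\<forall>x (n::nat) \<kappa>. 0 < \<kappa> \<longrightarrow>
        \<P>(\<xi> in (\<Pi>\<^sub>M j\<in>{..<n}. \<Xi>). \<bar>\<Sum>j<n. (F x (\<xi> j) - f x)\<bar> \<ge> real n * \<kappa>)
          \<le> 2 * exp (- (real n * \<kappa>\<^sup>2) / (2 * (bf * \<kappa> + \<sigma>f2))))"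


section \<open>Adaptive sampling\<close>

definition smean :: "nat \<Rightarrow> (nat \<Rightarrow> real) \<Rightarrow> real" where
  "smean n u = (\<Sum>j<n. u j) / real n"

definition ssd :: "nat \<Rightarrow> (nat \<Rightarrow> real) \<Rightarrow> real" where
  "ssd n u = sqrt ((\<Sum>j<n. (u j - smean n u)\<^sup>2) / (real n - 1))"

text \<open>The sample size is at least 2, because the sample standard deviation of one draw is
  undefined. On paths where no \<open>n\<close> satisfies the criterion the value is unspecified.\<close>

definition sample_size :: "real \<Rightarrow> real \<Rightarrow> real \<Rightarrow> real \<Rightarrow> (nat \<Rightarrow> real) \<Rightarrow> nat" where
  "sample_size sdmin \<kappa>d lamk \<Delta> u =
     (LEAST n. 2 \<le> n \<and> max sdmin (ssd n u) / sqrt (real n) \<le> \<kappa>d * \<Delta>\<^sup>2 / sqrt lamk)"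


section \<open>Interpolation\<close>

text \<open>\<open>Fwd j\<close> and \<open>Bwd j\<close> are the points with index \<open>j\<close> and \<open>d + j\<close>;
  \<open>Cand\<close> is the candidate, with index \<open>s\<close>.\<close>

datatype 'd design = Center | Fwd 'd | Bwd 'd

datatype 'd node = Design "'d design" | Cand

primrec offset :: "real \<Rightarrow> 'd design \<Rightarrow> real^'d" where
  "offset \<Delta> Center = 0"
| "offset \<Delta> (Fwd j) = \<Delta> *\<^sub>R axis j 1"
| "offset \<Delta> (Bwd j) = - (\<Delta> *\<^sub>R axis j 1)"

text \<open>Elements of the span of \<open>1, s\<^sub>j, s\<^sub>j\<^sup>2 / 2\<close>, as functions of
  the displacement \<open>s\<close> from the centre; a polynomial is given by its constant, linear and
  quadratic coefficients.\<close>

type_synonym 'd qcoeffs = "real \<times> (real^'d) \<times> (real^'d)"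

definition qpoly :: "'d qcoeffs \<Rightarrow> real^'d \<Rightarrow> real" where
  "qpoly \<beta> s = (case \<beta> of (a, b, h) \<Rightarrow> a + b \<bullet> s + (\<Sum>j\<in>UNIV. h $ j * (1/2 * (s $ j)\<^sup>2)))"

definition interp :: "real \<Rightarrow> ('d design \<Rightarrow> real) \<Rightarrow> 'd::finite qcoeffs" where
  "interp \<Delta> v = (THE \<beta>. \<forall>i. qpoly \<beta> (offset \<Delta> i) = v i)"

definition lagrange_poly :: "real^'d \<Rightarrow> real \<Rightarrow> 'd design \<Rightarrow> real^'d \<Rightarrow> real" where
  "lagrange_poly x\<^sub>0 \<Delta> i x = qpoly (interp \<Delta> (\<lambda>j. if j = i then 1 else 0)) (x - x\<^sub>0)"

definition diag_matrix :: "real^'d \<Rightarrow> real^'d^'d" where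
  "diag_matrix h = (\<chi> i j. if i = j then h $ i else 0)"

definition lagrangian_hess :: "'d qcoeffs \<Rightarrow> real^'p \<Rightarrow> ('p \<Rightarrow> real^'d^'d) \<Rightarrow> real^'d^'d" where
  "lagrangian_hess \<beta> y W = diag_matrix (snd (snd \<beta>)) - (\<Sum>i\<in>UNIV. (y $ i) *\<^sub>R W i)"


section \<open>One iteration\<close>

text \<open>The data of iteration \<open>k\<close>:
  \<open>Xk\<close>, \<open>rad\<close> are the iterate and the trust-region radius;
  \<open>pen_old\<close>, \<open>pen\<close> are the penalties with index \<open>k - 1\<close> and \<open>k\<close>;
  \<open>est\<close> holds the averages at the adaptive sample sizes;
  \<open>AR\<close>, \<open>AN\<close> are the range and null-space bases;
  \<open>ymul\<close> are the multipliers;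
  \<open>Wc\<close>, \<open>We\<close> are the approximations of the constraint Hessians used in the noisy model
  Hessian and in the noiseless one;
  \<open>sn\<close> is the normal step;
  \<open>StN\<close> holds the coordinates of the tangent step in the basis \<open>AN\<close>;
  \<open>penB\<close> is the base value of the trial penalty.

  The null-space basis has \<open>d - p\<close> columns, possibly none, so this number cannot be the
  cardinality of a type. Its columns, and vectors of this dimension, are indexed by naturals,
  and only indices below \<open>ncols\<close> are significant.\<close>

record ('d, 'p) iterate =
  Xk :: "real^'d"
  rad :: real
  pen_old :: real
  pen :: real
  est :: "'d node \<Rightarrow> real"
  AR :: "real^'p^'d"
  AN :: "nat \<Rightarrow> real^'d"
  ymul :: "real^'p"
  Wc :: "'p \<Rightarrow> real^'d^'d"
  We :: "'p \<Rightarrow> real^'d^'d"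
  sn :: "real^'d"
  StN :: "nat \<Rightarrow> real"
  penB :: real

definition ncols :: "('d::finite, 'p::finite) iterate \<Rightarrow> nat" where
  "ncols it = CARD('d) - CARD('p)"

definition ANmul :: "('d::finite, 'p::finite) iterate \<Rightarrow> (nat \<Rightarrow> real) \<Rightarrow> real^'d" where
  "ANmul it w = (\<Sum>j<ncols it. w j *\<^sub>R AN it j)"

definition ANtr :: "('d::finite, 'p::finite) iterate \<Rightarrow> real^'d \<Rightarrow> nat \<Rightarrow> real" where
  "ANtr it v = (\<lambda>j. AN it j \<bullet> v)"

definition normN :: "('d::finite, 'p::finite) iterate \<Rightarrow> (nat \<Rightarrow> real) \<Rightarrow> real" where
  "normN it w = L2_set w {..<ncols it}"

definition St :: "('d::finite, 'p::finite) iterate \<Rightarrow> real^'d" where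
  "St it = ANmul it (StN it)"

definition Xs :: "('d::finite, 'p::finite) iterate \<Rightarrow> real^'d" where
  "Xs it = Xk it + (sn it + St it)"

primrec node_pt :: "('d::finite, 'p::finite) iterate \<Rightarrow> 'd node \<Rightarrow> real^'d" where
  "node_pt it (Design i) = Xk it + offset (rad it) i"
| "node_pt it Cand = Xs it"

definition model_coeffs :: "('d::finite, 'p::finite) iterate \<Rightarrow> 'd qcoeffs" where
  "model_coeffs it = interp (rad it) (\<lambda>i. est it (Design i))"

definition Gk :: "('d::finite, 'p::finite) iterate \<Rightarrow> real^'d" where
  "Gk it = fst (snd (model_coeffs it))"

definition Hk :: "('d::finite, 'p::finite) iterate \<Rightarrow> real^'d^'d" where
  "Hk it = lagrangian_hess (model_coeffs it) (ymul it) (Wc it)"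

definition Bk :: "(real^'d \<Rightarrow> real) \<Rightarrow> ('d::finite, 'p::finite) iterate \<Rightarrow> real^'d^'d" where
  "Bk f it =
     lagrangian_hess (interp (rad it) (\<lambda>i. f (Xk it + offset (rad it) i))) (ymul it) (We it)"

definition Qk :: "('d::finite, 'p::finite) iterate \<Rightarrow> real^'d \<Rightarrow> real" where
  "Qk it x = est it (Design Center) + Gk it \<bullet> (x - Xk it)
             + 1/2 * ((x - Xk it) \<bullet> (Hk it *v (x - Xk it)))"

definition mn :: "(real^'d \<Rightarrow> real^'p) \<Rightarrow> (real^'d \<Rightarrow> real^'d^'p)
    \<Rightarrow> ('d::finite, 'p::finite) iterate \<Rightarrow> real^'d \<Rightarrow> real" where
  "mn c A it s = norm (A (Xk it) *v s + c (Xk it))"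

definition Mt :: "('d::finite, 'p::finite) iterate \<Rightarrow> real^'d \<Rightarrow> real" where
  "Mt it s = (Gk it + Hk it *v sn it) \<bullet> s + 1/2 * (s \<bullet> (Hk it *v s))"

definition GN :: "('d::finite, 'p::finite) iterate \<Rightarrow> nat \<Rightarrow> real" where
  "GN it = ANtr it (Gk it + Hk it *v sn it)"

definition merit_model :: "(real^'d \<Rightarrow> real^'p) \<Rightarrow> (real^'d \<Rightarrow> real^'d^'p)
    \<Rightarrow> ('d::finite, 'p::finite) iterate \<Rightarrow> real^'d \<Rightarrow> real" where
  "merit_model c A it x = Qk it x + pen it * norm (c (Xk it) + A (Xk it) *v (x - Xk it))"

definition merit_est :: "(real^'d \<Rightarrow> real^'p) \<Rightarrow> ('d::finite, 'p::finite) iterate \<Rightarrow> 'd node \<Rightarrow> real" where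
  "merit_est c it i = est it i + pen it * norm (c (node_pt it i))"

text \<open>If the predicted reduction vanishes, the ratio is \<open>0\<close> and the iteration is
  unsuccessful.\<close>

definition rho :: "(real^'d \<Rightarrow> real^'p) \<Rightarrow> (real^'d \<Rightarrow> real^'d^'p)
    \<Rightarrow> ('d::finite, 'p::finite) iterate \<Rightarrow> real" where
  "rho c A it =
     (merit_est c it (Design Center) - merit_est c it Cand)
     / (merit_model c A it (Xk it) - merit_model c A it (Xs it))"

definition crit :: "(real^'d \<Rightarrow> real^'p) \<Rightarrow> ('d::finite, 'p::finite) iterate \<Rightarrow> real" where
  "crit c it = norm (c (Xk it)) + normN it (ANtr it (Gk it))"

definition penC :: "real \<Rightarrow> (real^'d \<Rightarrow> real^'p) \<Rightarrow> (real^'d \<Rightarrow> real^'d^'p)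
    \<Rightarrow> ('d::finite, 'p::finite) iterate \<Rightarrow> real" where
  "penC \<nu> c A it =
     (if mn c A it 0 = mn c A it (sn it) then penB it
      else max (penB it)
        (- ((Qk it (Xk it) - Qk it (Xk it + sn it)) + (Mt it 0 - Mt it (St it)))
         / ((1 - \<nu>) * (mn c A it 0 - mn c A it (sn it)))))"


section \<open>The algorithm\<close>

record 'd sqp_params =
  p_x0 :: "real^'d"
  p_rad0 :: real
  p_radmax :: real
  p_penmin :: real
  p_penBmax :: real
  p_eta :: real
  p_nu :: real
  p_gdec :: real
  p_ginc :: real
  p_tau1 :: real
  p_tau2 :: real
  p_mu :: real
  p_an :: real
  p_at :: real
  p_sdmin :: real
  p_kapd :: real
  p_lam :: "nat \<Rightarrow> real"

definition valid_params :: "'d::finite sqp_params \<Rightarrow> bool" where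
  "valid_params P \<longleftrightarrow>
     0 < p_rad0 P \<and> p_rad0 P < p_radmax P \<and> 0 < p_penmin P \<and> 0 < p_penBmax P \<and>
     0 < p_eta P \<and> p_eta P < 1 \<and> 0 < p_nu P \<and> p_nu P < 1 \<and>
     0 < p_gdec P \<and> p_gdec P < 1 \<and> 1 \<le> p_ginc P \<and>
     1 \<le> p_tau1 P \<and> 0 < p_tau2 P \<and> 0 < (p_tau1 P - 1) * p_tau2 P \<and> 0 < p_mu P \<and>
     0 < p_an P \<and> p_an P < 1 \<and> 0 < p_at P \<and> p_at P < 1 \<and>
     0 < p_sdmin P \<and> 0 < p_kapd P \<and> (\<forall>k. 0 < p_lam P k) \<and>
     (\<exists>\<epsilon>>0. p_lam P \<in> \<Theta>(\<lambda>k. ln (real k) powr (1 + \<epsilon>)))"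

text \<open>The quality of the normal and tangent steps and of the Hessian approximations is not
  constrained here; only feasibility of the steps and symmetry of the approximations are.
  The argument \<open>\<zeta>\<close> supplies the draws: \<open>\<zeta> i j\<close> is the \<open>j\<close>-th draw
  for point \<open>i\<close>.\<close>

definition sqp_iteration ::
  "(real^'d \<Rightarrow> 'x \<Rightarrow> real) \<Rightarrow> (real^'d \<Rightarrow> real^'p) \<Rightarrow> (real^'d \<Rightarrow> real^'d^'p) \<Rightarrow> 'd sqp_params
   \<Rightarrow> nat \<Rightarrow> ('d node \<Rightarrow> nat \<Rightarrow> 'x) \<Rightarrow> ('d::finite, 'p::finite) iterate \<Rightarrow> bool" where
  "sqp_iteration F c A P k \<zeta> it \<longleftrightarrow>
     (\<forall>i. est it i =
        (let u = (\<lambda>j. F (node_pt it i) (\<zeta> i j))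
         in smean (sample_size (p_sdmin P) (p_kapd P) (p_lam P k) (rad it) u) u)) \<and>
     (\<forall>i. transpose (Wc it i) = Wc it i \<and> transpose (We it i) = We it i) \<and>
     basis_family UNIV (\<lambda>i. column i (AR it)) (range (\<lambda>u. transpose (A (Xk it)) *v u)) \<and>
     basis_family {..<ncols it} (AN it) {s. A (Xk it) *v s = 0} \<and>
     norm (sn it) \<le> p_an P * rad it \<and>
     norm (St it) \<le> p_at P * rad it \<and>
     0 \<le> penB it \<and> penB it \<le> p_penBmax P \<and>
     pen it =
       (if pen_old it < penC (p_nu P) c A it
        then max (penC (p_nu P) c A it) (max (p_tau1 P * pen_old it) (pen_old it + p_tau2 P))
        else pen_old it)"

definition successful :: "(real^'d \<Rightarrow> real^'p) \<Rightarrow> (real^'d \<Rightarrow> real^'d^'p) \<Rightarrow> 'd sqp_params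
    \<Rightarrow> ('d::finite, 'p::finite) iterate \<Rightarrow> bool" where
  "successful c A P it \<longleftrightarrow> rho c A it \<ge> p_eta P \<and> crit c it \<ge> p_mu P * rad it"

definition sqp_path ::
  "(real^'d \<Rightarrow> 'x \<Rightarrow> real) \<Rightarrow> (real^'d \<Rightarrow> real^'p) \<Rightarrow> (real^'d \<Rightarrow> real^'d^'p) \<Rightarrow> 'd sqp_params
   \<Rightarrow> (nat \<Rightarrow> 'd node \<Rightarrow> nat \<Rightarrow> 'x) \<Rightarrow> (nat \<Rightarrow> ('d::finite, 'p::finite) iterate) \<Rightarrow> bool" where
  "sqp_path F c A P \<zeta> R \<longleftrightarrow>
     Xk (R 0) = p_x0 P \<and> rad (R 0) = p_rad0 P \<and> pen_old (R 0) = p_penmin P \<and>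
     (\<forall>k. sqp_iteration F c A P k (\<zeta> k) (R k)) \<and>
     (\<forall>k. pen_old (R (Suc k)) = pen (R k)) \<and>
     (\<forall>k. if successful c A P (R k)
          then Xk (R (Suc k)) = Xs (R k) \<and> rad (R (Suc k)) = min (p_ginc P * rad (R k)) (p_radmax P)
          else Xk (R (Suc k)) = Xk (R k) \<and> rad (R (Suc k)) = p_gdec P * rad (R k))"

definition fresh_draws :: "'w measure \<Rightarrow> 'x measure \<Rightarrow> 'w measure \<Rightarrow> (nat \<Rightarrow> 'w \<Rightarrow> 'x) \<Rightarrow> bool" where
  "fresh_draws M \<Xi> \<F> Z \<longleftrightarrow>
     prob_space.indep_vars M (\<lambda>_. \<Xi>) Z UNIV \<and>
     (\<forall>j. distr M \<Xi> (Z j) = \<Xi>) \<and>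
     prob_space.indep_set M (sets \<F>)
       (sets (vimage_algebra (space M) (\<lambda>\<omega> j. Z j \<omega>) (\<Pi>\<^sub>M j\<in>UNIV. \<Xi>)))"

text \<open>\<open>\<F> k\<close> is the history at the start of iteration \<open>k\<close>, and \<open>\<F>s k\<close>
  the history just before the candidate of iteration \<open>k\<close> is sampled. The user's choices
  may be random, but they must not anticipate the draws.\<close>

definition sqp_astro_df ::
  "'w measure \<Rightarrow> 'x measure \<Rightarrow> (real^'d \<Rightarrow> 'x \<Rightarrow> real) \<Rightarrow> (real^'d \<Rightarrow> real^'p)
   \<Rightarrow> (real^'d \<Rightarrow> real^'d^'p) \<Rightarrow> 'd sqp_params \<Rightarrow> (nat \<Rightarrow> 'w measure) \<Rightarrow> (nat \<Rightarrow> 'w measure)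
   \<Rightarrow> (nat \<Rightarrow> 'd node \<Rightarrow> nat \<Rightarrow> 'w \<Rightarrow> 'x) \<Rightarrow> (nat \<Rightarrow> 'w \<Rightarrow> ('d::finite, 'p::finite) iterate) \<Rightarrow> bool"
  where
  "sqp_astro_df M \<Xi> F c A P \<F> \<F>s \<xi> R \<longleftrightarrow>
     prob_space M \<and> valid_params P \<and>
     (\<forall>\<omega>\<in>space M. sqp_path F c A P (\<lambda>k i j. \<xi> k i j \<omega>) (\<lambda>k. R k \<omega>)) \<and>
     (\<forall>k. subalgebra M (\<F> k) \<and> subalgebra M (\<F>s k) \<and>
          subalgebra (\<F>s k) (\<F> k) \<and> subalgebra (\<F> (Suc k)) (\<F>s k)) \<and>
     (\<forall>k i j. \<xi> k (Design i) j \<in> measurable (\<F>s k) \<Xi>) \<and>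
     (\<forall>k j. \<xi> k Cand j \<in> measurable (\<F> (Suc k)) \<Xi>) \<and>
     (\<forall>k i. fresh_draws M \<Xi> (\<F> k) (\<xi> k (Design i))) \<and>
     (\<forall>k. fresh_draws M \<Xi> (\<F>s k) (\<xi> k Cand)) \<and>
     (\<forall>k. (\<lambda>\<omega>. Xk (R k \<omega>)) \<in> borel_measurable (\<F> k) \<and>
          (\<lambda>\<omega>. rad (R k \<omega>)) \<in> borel_measurable (\<F> k) \<and>
          (\<lambda>\<omega>. pen_old (R k \<omega>)) \<in> borel_measurable (\<F> k)) \<and>
     (\<forall>k. (\<lambda>\<omega>. AR (R k \<omega>)) \<in> borel_measurable (\<F>s k) \<and>
          (\<forall>j. (\<lambda>\<omega>. AN (R k \<omega>) j) \<in> borel_measurable (\<F>s k)) \<and>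
          (\<lambda>\<omega>. ymul (R k \<omega>)) \<in> borel_measurable (\<F>s k) \<and>
          (\<forall>i. (\<lambda>\<omega>. Wc (R k \<omega>) i) \<in> borel_measurable (\<F>s k)) \<and>
          (\<lambda>\<omega>. sn (R k \<omega>)) \<in> borel_measurable (\<F>s k) \<and>
          (\<forall>j. (\<lambda>\<omega>. StN (R k \<omega>) j) \<in> borel_measurable (\<F>s k)) \<and>
          (\<lambda>\<omega>. penB (R k \<omega>)) \<in> borel_measurable (\<F>s k) \<and>
          (\<forall>i. (\<lambda>\<omega>. We (R k \<omega>) i) \<in> borel_measurable M))"

end

(*
  Sampling. Because N is at least a multiple of lambda / Delta^4, a deviation of the estimate by
  e * Delta^2 forces a deviation of n * e * Delta^2 of a partial sum of n noise terms for some n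
  beyond this bound. The Bernstein tail, made uniform over dyadic blocks of n by Ottaviani's
  inequality, bounds the probability of that event by 6 exp(-C lambda), uniformly in the point and
  in the radius; by independence of the history this holds at the random points too. As
  lambda_k grows like log^(1+eps) k, Borel-Cantelli gives estimates with error o(Delta_k^2).

  Optimisation, on a path with such estimates. The penalty is eventually constant. The predicted
  reduction is at least of order min(1, pi) * min(Delta, pi) with pi the criticality measure, and
  it differs from the achieved one by O(Delta^2), so an iteration with pi bounded below and Delta
  small succeeds. Adding a multiple of Delta^2 to the merit function yields a potential that drops
  by a multiple of Delta^2 in every iteration; hence Delta -> 0. The noiseless criticality measure
  therefore comes arbitrarily close to 0, and being Lipschitz along the iterates, with travelled
  distance paid for by the decrease of the merit function, it tends to 0.
*)
theory Submission
  imports Defs "HOL-Real_Asymp.Real_Asymp"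
begin

text \<open>Four obstacles shape the proof. The sample size is a stopping rule that looks at the
  very draws it averages, so a tail bound at a fixed size says nothing about the realized estimate;
  it has to hold for all admissible sizes at once. Errors O(Delta^2) already give gradient errors
  O(Delta) and success at small radii. The potential argument needs more: two estimation errors must
  be beaten by a decrease s * Delta^2 whose constant s is dictated by the problem, so the tolerance
  has to be free, hence o(Delta^2). The penalty stabilizes because the possible increase of the
  model along the normal step and the reduction of the linearized violation are both governed by
  min(Delta, |c|): the first is at most, the second at least, a multiple of it. The null-space bases
  are chosen anew in each iteration, without any continuity. Only the norm of the coordinates is
  comparable between iterations, as the distance of the gradient from the row space of the
  Jacobian.\<close>

section \<open>The sampling error\<close>

text \<open>Split by the first index \<open>j\<close> at which the partial sum reaches
  \<open>2 * t\<close>. This event involves only terms before \<open>j\<close>, so it is independent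
  of the block from \<open>j\<close> on, which stays below \<open>t\<close> with probability at
  least \<open>1 - q\<close>; when it does, the full sum still exceeds \<open>t\<close>.\<close>

lemma (in prob_space) ottaviani:
  fixes X :: "nat \<Rightarrow> 'a \<Rightarrow> real"
  assumes indep: "indep_vars (\<lambda>_. borel) X UNIV"
    and q: "q < 1"
    and tail: "\<And>j. j \<le> m \<Longrightarrow> prob {\<omega> \<in> space M. t \<le> \<bar>\<Sum>i=j..<m. X i \<omega>\<bar>} \<le> q"
  shows "(1 - q) * prob {\<omega> \<in> space M. \<exists>j\<le>m. 2 * t \<le> \<bar>\<Sum>i<j. X i \<omega>\<bar>}
         \<le> prob {\<omega> \<in> space M. t \<le> \<bar>\<Sum>i<m. X i \<omega>\<bar>}"
proof -
  have [measurable]: "X i \<in> borel_measurable M" for i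
    using indep unfolding indep_vars_def by auto
  define S where "S j \<omega> = (\<Sum>i<j. X i \<omega>)" for j \<omega>
  have [measurable]: "S j \<in> borel_measurable M" for j
    unfolding S_def by measurable
  define E where "E j = {\<omega> \<in> space M. 2 * t \<le> \<bar>S j \<omega>\<bar> \<and> (\<forall>i<j. \<bar>S i \<omega>\<bar> < 2 * t)}" for j
  define B where "B j = {\<omega> \<in> space M. \<bar>\<Sum>i=j..<m. X i \<omega>\<bar> < t}" for j
  have [measurable]: "E j \<in> sets M" "B j \<in> sets M" for j
    unfolding E_def B_def by measurable
  \<comment> \<open>The two events are preimages of events about the restrictions of the family to
    the disjoint index sets \<open>{..<j}\<close> and \<open>{j..<m}\<close>, which are
    independent.\<close>
  have EB: "prob (E j \<inter> B j) = prob (E j) * prob (B j)" for j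
  proof -
    let ?P = "\<lambda>I. PiM I (\<lambda>_::nat. borel::real measure)"
    define Ea where "Ea = {f \<in> space (?P {..<j}). 2 * t \<le> \<bar>\<Sum>i<j. f i\<bar> \<and> (\<forall>i<j. \<bar>\<Sum>l<i. f l\<bar> < 2 * t)}"
    define Eb where "Eb = {f \<in> space (?P {j..<m}). \<bar>\<Sum>i=j..<m. f i\<bar> < t}"
    have 1: "(\<lambda>f. \<Sum>l<i. f l) \<in> borel_measurable (?P {..<j})" if "i \<le> j" for i
      using that by (intro borel_measurable_sum measurable_component_singleton) auto
    have 2: "(\<lambda>f. \<Sum>l=j..<m. f l) \<in> borel_measurable (?P {j..<m})"
      by (intro borel_measurable_sum measurable_component_singleton) auto
    have 3: "{f \<in> space (?P {..<j}). \<forall>i<j. \<bar>\<Sum>l<i. f l\<bar> < 2 * t} \<in> sets (?P {..<j})"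
    proof -
      have "{f \<in> space (?P {..<j}). \<forall>i\<in>{..<j}. \<bar>\<Sum>l<i. f l\<bar> < 2 * t} \<in> sets (?P {..<j})"
      proof (rule sets.sets_Collect_finite_All)
        fix i assume "i \<in> {..<j}"
        then have [measurable]: "(\<lambda>f. \<Sum>l<i. f l) \<in> borel_measurable (?P {..<j})" using 1 by auto
        show "{f \<in> space (?P {..<j}). \<bar>\<Sum>l<i. f l\<bar> < 2 * t} \<in> sets (?P {..<j})" by measurable
      qed auto
      then show ?thesis by (simp add: Ball_def)
    qed
    have 4: "{f \<in> space (?P {..<j}). 2 * t \<le> \<bar>\<Sum>l<j. f l\<bar>} \<in> sets (?P {..<j})"
    proof -
      have [measurable]: "(\<lambda>f. \<Sum>l<j. f l) \<in> borel_measurable (?P {..<j})" using 1 by auto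
      show ?thesis by measurable
    qed
    have Ea: "Ea \<in> sets (?P {..<j})"
      unfolding Ea_def by (intro sets.sets_Collect_conj 3 4)
    have Eb: "Eb \<in> sets (?P {j..<m})"
      unfolding Eb_def using 2 by measurable
    have iv: "indep_var (?P {..<j}) (\<lambda>\<omega>. restrict (\<lambda>i. X i \<omega>) {..<j})
                        (?P {j..<m}) (\<lambda>\<omega>. restrict (\<lambda>i. X i \<omega>) {j..<m})"
      by (rule indep_var_restrict[OF indep]) auto
    have a: "(\<lambda>\<omega>. restrict (\<lambda>i. X i \<omega>) {..<j}) -` Ea \<inter> space M = E j"
      by (auto simp: Ea_def E_def S_def space_PiM)
    have b: "(\<lambda>\<omega>. restrict (\<lambda>i. X i \<omega>) {j..<m}) -` Eb \<inter> space M = B j"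
      by (auto simp: Eb_def B_def space_PiM)
    have "E j \<inter> B j = (\<lambda>\<omega>. (restrict (\<lambda>i. X i \<omega>) {..<j}, restrict (\<lambda>i. X i \<omega>) {j..<m})) -` (Ea \<times> Eb) \<inter> space M"
      unfolding a[symmetric] b[symmetric] by auto
    with indep_varD[OF iv Ea Eb] show ?thesis unfolding a b by simp
  qed
  have Bge: "1 - q \<le> prob (B j)" if "j \<le> m" for j
  proof -
    have "space M - {\<omega> \<in> space M. t \<le> \<bar>\<Sum>i=j..<m. X i \<omega>\<bar>} = B j" by (auto simp: B_def)
    then have "prob (B j) = 1 - prob {\<omega> \<in> space M. t \<le> \<bar>\<Sum>i=j..<m. X i \<omega>\<bar>}"
      by (subst prob_compl[symmetric]) auto
    with tail[OF that] show ?thesis by linarith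
  qed
  have disj: "disjoint_family_on E {..m}"
    unfolding disjoint_family_on_def
  proof (intro ballI impI equals0I)
    fix i j :: nat and \<omega> assume "i \<noteq> j" "\<omega> \<in> E i \<inter> E j"
    then have "2 * t \<le> \<bar>S i \<omega>\<bar>" "2 * t \<le> \<bar>S j \<omega>\<bar>" "\<forall>l<i. \<bar>S l \<omega>\<bar> < 2 * t" "\<forall>l<j. \<bar>S l \<omega>\<bar> < 2 * t"
      by (auto simp: E_def)
    with \<open>i \<noteq> j\<close> show False by (metis linorder_neqE_nat not_le)
  qed
  have ex: "{\<omega> \<in> space M. \<exists>j\<le>m. 2 * t \<le> \<bar>S j \<omega>\<bar>} = (\<Union>j\<in>{..m}. E j)" (is "?L = ?R")
  proof safe
    fix \<omega> j assume w: "\<omega> \<in> space M" "j \<le> m" "2 * t \<le> \<bar>S j \<omega>\<bar>"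
    define l where "l = (LEAST j. 2 * t \<le> \<bar>S j \<omega>\<bar>)"
    have "2 * t \<le> \<bar>S l \<omega>\<bar>" "l \<le> j" using w(3) unfolding l_def by (auto intro: LeastI Least_le)
    moreover have "\<bar>S i \<omega>\<bar> < 2 * t" if "i < l" for i
      using not_less_Least[of i "\<lambda>j. 2 * t \<le> \<bar>S j \<omega>\<bar>"] that unfolding l_def by auto
    ultimately show "\<omega> \<in> (\<Union>j\<in>{..m}. E j)" using w by (auto simp: E_def intro!: bexI[of _ l])
  qed (auto simp: E_def)
  have sub: "(\<Union>j\<in>{..m}. E j \<inter> B j) \<subseteq> {\<omega> \<in> space M. t \<le> \<bar>S m \<omega>\<bar>}"
  proof safe
    fix \<omega> j assume j: "j \<le> m" "\<omega> \<in> E j" "\<omega> \<in> B j"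
    have "S m \<omega> = S j \<omega> + (\<Sum>i=j..<m. X i \<omega>)"
      unfolding S_def lessThan_atLeast0 using sum.atLeastLessThan_concat[of 0 j m "\<lambda>i. X i \<omega>"] j(1) by simp
    then show "t \<le> \<bar>S m \<omega>\<bar>" using j by (auto simp: E_def B_def)
  qed (auto simp: E_def)
  have "(1 - q) * prob (\<Union>j\<in>{..m}. E j) = (\<Sum>j\<le>m. (1 - q) * prob (E j))"
    by (subst finite_measure_finite_Union[OF _ _ disj]) (auto simp: sum_distrib_left)
  also have "\<dots> \<le> (\<Sum>j\<le>m. prob (E j \<inter> B j))"
  proof (rule sum_mono)
    fix j assume "j \<in> {..m}"
    then show "(1 - q) * prob (E j) \<le> prob (E j \<inter> B j)"
      unfolding EB using Bge[of j] by (simp add: mult.commute mult_right_mono)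
  qed
  also have "\<dots> = prob (\<Union>j\<in>{..m}. E j \<inter> B j)"
    by (rule finite_measure_finite_Union[symmetric]) (use disj in \<open>auto simp: disjoint_family_on_def\<close>)
  also have "\<dots> \<le> prob {\<omega> \<in> space M. t \<le> \<bar>S m \<omega>\<bar>}"
    by (rule finite_measure_mono[OF sub]) measurable
  finally show ?thesis unfolding ex[symmetric] unfolding S_def by (simp add: S_def)
qed

section \<open>Bernstein tails, uniformly in the sample size\<close>

locale noisy_oracle =
  fixes \<Xi> :: "'x measure" and F :: "real^'d \<Rightarrow> 'x \<Rightarrow> real" and f :: "real^'d \<Rightarrow> real"
    and \<sigma>f2 bf :: real
  assumes prob: "prob_space \<Xi>"
    and F_measurable [measurable]: "case_prod F \<in> borel_measurable (borel \<Otimes>\<^sub>M \<Xi>)"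
    and f_measurable [measurable]: "f \<in> borel_measurable borel"
    and noise: "bernstein_noise \<Xi> F f \<sigma>f2 bf"
begin

abbreviation \<Omega> :: "(nat \<Rightarrow> 'x) measure" where
  "\<Omega> \<equiv> \<Pi>\<^sub>M j\<in>UNIV. \<Xi>"

lemma prob_\<Omega>: "prob_space \<Omega>"
  by (intro prob_space_PiM prob)

lemma \<sigma>f2_pos: "0 < \<sigma>f2" and bf_pos: "0 < bf"
  using noise unfolding bernstein_noise_def by auto

lemma noise_bound:
  "0 < \<kappa> \<Longrightarrow> \<P>(\<xi> in (\<Pi>\<^sub>M j\<in>{..<n}. \<Xi>). \<bar>\<Sum>j<n. (F x (\<xi> j) - f x)\<bar> \<ge> real n * \<kappa>)
     \<le> 2 * exp (- (real n * \<kappa>\<^sup>2) / (2 * (bf * \<kappa> + \<sigma>f2)))"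
  using noise unfolding bernstein_noise_def by blast

lemma F_x_measurable [measurable]: "F x \<in> borel_measurable \<Xi>"
proof -
  have "(\<lambda>\<xi>. case_prod F (x, \<xi>)) \<in> borel_measurable \<Xi>"
    by measurable
  then show ?thesis by simp
qed

lemma indep_noise: "prob_space.indep_vars \<Omega> (\<lambda>_. borel) (\<lambda>j u. F x (u j) - f x) UNIV"
proof -
  interpret prob_space \<Omega> by (rule prob_\<Omega>)
  have d: "distr \<Omega> \<Xi> (\<lambda>u. u i) = \<Xi>" for i :: nat
    by (rule distr_PiM_component) (auto intro: prob)
  have "indep_vars (\<lambda>_. \<Xi>) (\<lambda>i u. u i) (UNIV::nat set)"
    by (subst indep_vars_iff_distr_eq_PiM) (auto simp: d restrict_def)
  then show ?thesis
    by (rule indep_vars_compose2) measurable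
qed

text \<open>The denominator carries \<open>m\<close> instead of the block length
  \<open>m - j\<close>: weaker, but uniform in \<open>j\<close>, as \<open>ottaviani\<close>
  requires. The draws are shifted by \<open>j\<close> because the noise hypothesis speaks of initial
  segments only.\<close>

lemma noise_tail:
  assumes "0 < t"
  shows "\<P>(u in \<Omega>. t \<le> \<bar>\<Sum>i=j..<m. (F x (u i) - f x)\<bar>)
         \<le> 2 * exp (- t\<^sup>2 / (2 * (bf * t + real m * \<sigma>f2)))"
proof (cases "j < m")
  case False
  then show ?thesis using assms by simp
next
  case True
  define n where "n = m - j"
  have n: "0 < n" "n \<le> m" using True by (auto simp: n_def)
  define \<kappa> where "\<kappa> = t / real n"
  have \<kappa>: "0 < \<kappa>" "real n * \<kappa> = t" using assms n by (auto simp: \<kappa>_def)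
  let ?P = "\<Pi>\<^sub>M j\<in>{..<n}. \<Xi>"
  let ?s = "\<lambda>u. \<lambda>i\<in>{..<n}. u (j + i)"
  have D: "distr \<Omega> ?P ?s = ?P"
    using distr_PiM_reindex[of UNIV "\<lambda>_. \<Xi>" "\<lambda>i. j + i" "{..<n}"] prob by auto
  have [measurable]: "?s \<in> measurable \<Omega> ?P" by measurable
  have [measurable]: "(\<lambda>\<xi>. \<Sum>i<n. (F x (\<xi> i) - f x)) \<in> borel_measurable ?P"
    by (intro borel_measurable_sum borel_measurable_diff measurable_compose[OF _ F_x_measurable]
          measurable_component_singleton) auto
  have eq: "(\<Sum>i=j..<m. (F x (u i) - f x)) = (\<Sum>i<n. (F x (u (j + i)) - f x))" for u
    by (simp add: sum.atLeastLessThan_shift_0[of _ j m] n_def lessThan_atLeast0)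
  have "\<P>(u in \<Omega>. t \<le> \<bar>\<Sum>i=j..<m. (F x (u i) - f x)\<bar>)
      = measure \<Omega> (?s -` {\<xi> \<in> space ?P. t \<le> \<bar>\<Sum>i<n. (F x (\<xi> i) - f x)\<bar>} \<inter> space \<Omega>)"
    unfolding eq by (rule arg_cong[where f="measure \<Omega>"]) (auto simp: space_PiM)
  also have "\<dots> = \<P>(\<xi> in distr \<Omega> ?P ?s. t \<le> \<bar>\<Sum>i<n. (F x (\<xi> i) - f x)\<bar>)"
    by (subst measure_distr) auto
  also have "\<dots> \<le> 2 * exp (- (real n * \<kappa>\<^sup>2) / (2 * (bf * \<kappa> + \<sigma>f2)))"
    unfolding D using noise_bound[OF \<kappa>(1), of n x] unfolding \<kappa>(2) .
  also have "(real n * \<kappa>\<^sup>2) / (2 * (bf * \<kappa> + \<sigma>f2)) = t\<^sup>2 / (2 * (bf * t + real n * \<sigma>f2))"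
  proof -
    have "bf * t + real n * \<sigma>f2 = real n * (bf * \<kappa> + \<sigma>f2)"
      by (simp add: \<kappa>(2)[symmetric] algebra_simps)
    moreover have "t\<^sup>2 = real n * (real n * \<kappa>\<^sup>2)"
      by (simp add: \<kappa>(2)[symmetric] power2_eq_square)
    ultimately show ?thesis using n(1) by (simp add: mult.assoc mult.left_commute)
  qed
  then have "2 * exp (- (real n * \<kappa>\<^sup>2) / (2 * (bf * \<kappa> + \<sigma>f2))) = 2 * exp (- (t\<^sup>2 / (2 * (bf * t + real n * \<sigma>f2))))"
    by simp
  also have "\<dots> \<le> 2 * exp (- (t\<^sup>2 / (2 * (bf * t + real m * \<sigma>f2))))"
  proof -
    have "t\<^sup>2 / (2 * (bf * t + real m * \<sigma>f2)) \<le> t\<^sup>2 / (2 * (bf * t + real n * \<sigma>f2))"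
      using n assms \<sigma>f2_pos bf_pos
      by (intro divide_left_mono mult_left_mono add_left_mono mult_right_mono mult_pos_pos add_pos_nonneg) auto
    then show ?thesis by simp
  qed
  finally show ?thesis by simp
qed

lemma noise_maximal:
  assumes t: "0 < t" and q: "2 * exp (- t\<^sup>2 / (2 * (bf * t + real m * \<sigma>f2))) \<le> q" "q \<le> 1/2"
  shows "\<P>(u in \<Omega>. \<exists>j\<le>m. 2 * t \<le> \<bar>\<Sum>i<j. (F x (u i) - f x)\<bar>) \<le> 2 * q"
proof -
  interpret prob_space \<Omega> by (rule prob_\<Omega>)
  let ?p = "\<P>(u in \<Omega>. \<exists>j\<le>m. 2 * t \<le> \<bar>\<Sum>i<j. (F x (u i) - f x)\<bar>)"
  have tail: "\<P>(u in \<Omega>. t \<le> \<bar>\<Sum>i=j..<m. (F x (u i) - f x)\<bar>) \<le> q" for j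
    using noise_tail[OF t, where x=x and j=j and m=m] q by linarith
  have "(1 - q) * ?p \<le> \<P>(u in \<Omega>. t \<le> \<bar>\<Sum>i<m. (F x (u i) - f x)\<bar>)"
    by (rule ottaviani[OF indep_noise[of x]]) (use tail q in auto)
  also have "\<dots> \<le> q"
    using tail[of 0] by (simp add: lessThan_atLeast0)
  finally have "(1 - q) * ?p \<le> q" .
  moreover have "(1/2) * ?p \<le> (1 - q) * ?p"
    using q(2) by (intro mult_right_mono) auto
  ultimately show ?thesis by linarith
qed

text \<open>The blocks \<open>2\<^sup>i n\<^sub>0 \<le> n \<le> 2\<^sup>i\<^sup>+\<^sup>1 n\<^sub>0\<close> are treated with the maximal
  inequality: a union bound over single sample sizes would lose a factor \<open>1 / \<kappa>\<^sup>2\<close>, which is not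
  affordable because the accuracy \<open>\<kappa>\<close> may shrink geometrically.\<close>

lemma noise_uniform:
  assumes n0: "1 \<le> n0" and \<kappa>: "0 < \<kappa>" "\<kappa> \<le> K"
    and r: "exp (- (real n0 * \<kappa>\<^sup>2) / (16 * (bf * K + \<sigma>f2))) \<le> r" "r \<le> 1/4"
  shows "\<P>(u in \<Omega>. \<exists>n\<ge>n0. real n * \<kappa> \<le> \<bar>\<Sum>i<n. (F x (u i) - f x)\<bar>) \<le> 6 * r"
proof -
  interpret prob_space \<Omega> by (rule prob_\<Omega>)
  \<comment> \<open>With \<open>m = 2^(i+1) * n0\<close>, every \<open>n\<close> of block
    \<open>i\<close> is at least \<open>m / 2\<close>, so a deviation of \<open>n * \<kappa>\<close>
    is at least \<open>2 * t\<close> for \<open>t = m * \<kappa> / 4\<close>.\<close>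
  define A where "A i = {u \<in> space \<Omega>. \<exists>j\<le>2^(i+1) * n0. 2 * (real (2^(i+1) * n0) * \<kappa> / 4) \<le> \<bar>\<Sum>l<j. (F x (u l) - f x)\<bar>}" for i :: nat
  have [measurable]: "A i \<in> sets \<Omega>" for i unfolding A_def by measurable
  have rpos: "0 < r" by (rule less_le_trans[OF exp_gt_zero r(1)])
  have A: "measure \<Omega> (A i) \<le> 2 * (2 * r ^ (i+1))" for i
  proof -
    define m where "m = 2^(i+1) * n0"
    define t where "t = real m * \<kappa> / 4"
    have m: "0 < real m" using n0 by (simp add: m_def)
    have t: "0 < t" using m \<kappa> by (simp add: t_def)
    have "2^i * ((real n0 * \<kappa>\<^sup>2) / (16 * (bf * K + \<sigma>f2))) = real m * \<kappa>\<^sup>2 / (32 * (bf * K + \<sigma>f2))"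
    proof -
      have "2^i * ((real n0 * \<kappa>\<^sup>2) / (16 * D)) = real m * \<kappa>\<^sup>2 / (32 * D)" for D :: real
        by (simp add: m_def)
      then show ?thesis .
    qed
    also have "\<dots> \<le> real m * \<kappa>\<^sup>2 / (32 * (bf * (\<kappa> / 4) + \<sigma>f2))"
      using \<kappa> bf_pos \<sigma>f2_pos m
      by (intro divide_left_mono mult_left_mono add_right_mono mult_pos_pos add_pos_pos) auto
    also have "\<dots> = t\<^sup>2 / (2 * (bf * t + real m * \<sigma>f2))"
    proof -
      have "t\<^sup>2 = real m * (real m * \<kappa>\<^sup>2 / 16)" by (simp add: t_def power2_eq_square)
      moreover have "2 * (bf * t + real m * \<sigma>f2) = real m * (2 * (bf * (\<kappa> / 4) + \<sigma>f2))"
        by (simp add: t_def algebra_simps)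
      ultimately have "t\<^sup>2 / (2 * (bf * t + real m * \<sigma>f2)) = (real m * \<kappa>\<^sup>2 / 16) / (2 * (bf * (\<kappa> / 4) + \<sigma>f2))"
        using m by (simp only: mult_divide_mult_cancel_left)
      then show ?thesis by simp
    qed
    finally have "exp (- t\<^sup>2 / (2 * (bf * t + real m * \<sigma>f2))) \<le> exp (2^i * (- (real n0 * \<kappa>\<^sup>2) / (16 * (bf * K + \<sigma>f2))))"
      by simp
    also have "\<dots> = exp (- (real n0 * \<kappa>\<^sup>2) / (16 * (bf * K + \<sigma>f2))) ^ (2^i)"
      by (subst exp_of_nat_mult[symmetric]) simp
    also have "\<dots> \<le> r ^ (2^i)"
      by (rule power_mono[OF r(1)]) simp
    \<comment> \<open>Each doubling of the block squares the bound; keeping only a geometric rate is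
      enough for summation over the blocks.\<close>
    also have "\<dots> \<le> r ^ (i+1)"
      using rpos r(2) by (intro power_decreasing) (auto simp: Suc_le_eq)
    finally have 1: "2 * exp (- t\<^sup>2 / (2 * (bf * t + real m * \<sigma>f2))) \<le> 2 * r ^ (i+1)" by simp
    have "r ^ (i+1) \<le> r ^ 1" using rpos r(2) by (intro power_decreasing) auto
    then have 2: "2 * r ^ (i+1) \<le> 1/2" using r(2) by simp
    from noise_maximal[OF t 1 2, where x=x] show ?thesis
      unfolding A_def t_def m_def by simp
  qed
  have geo: "(\<lambda>i. 2 * (2 * r ^ (i+1))) sums (4 * r * (1 / (1 - r)))"
  proof -
    have "(\<lambda>i. 4 * r * r ^ i) sums (4 * r * (1 / (1 - r)))"
      using rpos r(2) by (intro sums_mult geometric_sums) auto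
    then show ?thesis by (simp add: mult_ac)
  qed
  have sA: "summable (\<lambda>i. measure \<Omega> (A i))"
    by (rule summable_comparison_test'[OF sums_summable[OF geo], of 0]) (use A in auto)
  have "{u \<in> space \<Omega>. \<exists>n\<ge>n0. real n * \<kappa> \<le> \<bar>\<Sum>i<n. (F x (u i) - f x)\<bar>} \<subseteq> (\<Union>i. A i)"
  proof safe
    fix u n assume u: "u \<in> space \<Omega>" and n: "n0 \<le> n" "real n * \<kappa> \<le> \<bar>\<Sum>i<n. (F x (u i) - f x)\<bar>"
    define i where "i = (LEAST i. n \<le> 2^(i+1) * n0)"
    have "n < 2 ^ n" by simp
    also have "2 ^ n \<le> 2^(n+1) * n0" using n0 by simp
    finally have "n \<le> 2^(n+1) * n0" by simp
    then have i1: "n \<le> 2^(i+1) * n0" unfolding i_def by (rule LeastI)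
    have i2: "2^i * n0 \<le> n"
    proof (cases i)
      case 0 then show ?thesis using n by simp
    next
      case (Suc l)
      then have "\<not> n \<le> 2^(l+1) * n0"
        using not_less_Least[of l "\<lambda>i. n \<le> 2^(i+1) * n0"] unfolding i_def by simp
      then show ?thesis using Suc by simp
    qed
    have "real (2^i * n0) * \<kappa> \<le> real n * \<kappa>" using i2 \<kappa> by (intro mult_right_mono) (auto simp del: of_nat_mult of_nat_power)
    then have "2 * (real (2^(i+1) * n0) * \<kappa> / 4) \<le> \<bar>\<Sum>i<n. (F x (u i) - f x)\<bar>"
      using n(2) by (simp add: mult_ac)
    then have "u \<in> A i" unfolding A_def using u i1 by blast
    then show "u \<in> (\<Union>i. A i)" by blast
  qed
  then have "\<P>(u in \<Omega>. \<exists>n\<ge>n0. real n * \<kappa> \<le> \<bar>\<Sum>i<n. (F x (u i) - f x)\<bar>) \<le> measure \<Omega> (\<Union>i. A i)"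
    by (rule finite_measure_mono) measurable
  also have "\<dots> \<le> (\<Sum>i. measure \<Omega> (A i))"
    by (rule finite_measure_subadditive_countably) (use sA in auto)
  also have "\<dots> \<le> 4 * r * (1 / (1 - r))"
    using suminf_le[OF A sA sums_summable[OF geo]] sums_unique[OF geo] by simp
  also have "\<dots> \<le> 6 * r"
  proof -
    have "1 / (1 - r) \<le> 3/2" using r(2) by (simp add: field_simps)
    then have "4 * r * (1 / (1 - r)) \<le> 4 * r * (3/2)" using rpos by (intro mult_left_mono) auto
    then show ?thesis by simp
  qed
  finally show ?thesis .
qed

end

section \<open>Termination of the sampling rule\<close>

lemma ssd_le:
  assumes n: "2 \<le> n" and u: "\<And>j. j < n \<Longrightarrow> \<bar>u j - a\<bar> \<le> t * sqrt (real n - 1)" and t: "0 \<le> t"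
  shows "ssd n u \<le> t * sqrt (real n)"
proof -
  let ?m = "smean n u"
  have m: "(\<Sum>j<n. u j) = real n * ?m" using n by (simp add: smean_def)
  \<comment> \<open>Squared deviations are smallest about the sample mean, so any centre
    \<open>a\<close> gives an upper bound.\<close>
  have "(\<Sum>j<n. (u j - a)\<^sup>2) = (\<Sum>j<n. (u j - ?m)\<^sup>2 + 2 * (?m - a) * u j - ?m\<^sup>2 + a\<^sup>2)"
    by (intro sum.cong) (auto simp: power2_eq_square algebra_simps)
  also have "\<dots> = (\<Sum>j<n. (u j - ?m)\<^sup>2) + 2 * (?m - a) * (\<Sum>j<n. u j) - real n * ?m\<^sup>2 + real n * a\<^sup>2"
    by (simp add: sum.distrib sum_subtractf sum_distrib_left)
  also have "\<dots> = (\<Sum>j<n. (u j - ?m)\<^sup>2) + real n * (?m - a)\<^sup>2"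
    unfolding m by (simp add: power2_eq_square algebra_simps)
  finally have "(\<Sum>j<n. (u j - ?m)\<^sup>2) \<le> (\<Sum>j<n. (u j - a)\<^sup>2)" by simp
  also have "\<dots> \<le> (\<Sum>j<n. t\<^sup>2 * (real n - 1))"
  proof (rule sum_mono)
    fix j assume "j \<in> {..<n}"
    then have "\<bar>u j - a\<bar>\<^sup>2 \<le> (t * sqrt (real n - 1))\<^sup>2" using u by (intro power_mono) auto
    then show "(u j - a)\<^sup>2 \<le> t\<^sup>2 * (real n - 1)" using n by (simp add: power_mult_distrib)
  qed
  finally have "(\<Sum>j<n. (u j - ?m)\<^sup>2) / (real n - 1) \<le> t\<^sup>2 * real n"
    using n by (simp add: field_simps)
  then have "ssd n u \<le> sqrt (t\<^sup>2 * real n)" unfolding ssd_def by (rule real_sqrt_le_mono)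
  then show ?thesis using t by (simp add: real_sqrt_mult)
qed

context noisy_oracle
begin

lemma ssd_measurable [measurable]: "(\<lambda>u. ssd n (\<lambda>j. F x (u j))) \<in> borel_measurable \<Omega>"
  unfolding ssd_def smean_def by measurable

text \<open>\<open>LEAST\<close> has no meaning on paths where the rule never fires, so these must
  form a null set. For large \<open>n\<close>, not stopping at \<open>n\<close> forces one of the
  first \<open>n\<close> draws to deviate by \<open>t * sqrt (n - 1)\<close>. The union bound
  \<open>p n\<close> over these draws tends to 0, as its exponent grows like
  \<open>sqrt n\<close>.\<close>

lemma sampling_stops:
  assumes t: "0 < t"
  shows "\<P>(u in \<Omega>. \<forall>n\<ge>2. \<not> max s (ssd n (\<lambda>j. F x (u j))) / sqrt (real n) \<le> t) = 0"
    (is "?p = 0")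
proof -
  interpret prob_space \<Omega> by (rule prob_\<Omega>)
  define \<kappa> where "\<kappa> n = t * sqrt (real n - 1)" for n :: nat
  define p where "p n = real n * (2 * exp (- (\<kappa> n)\<^sup>2 / (2 * (bf * \<kappa> n + \<sigma>f2))))" for n
  have lim: "p \<longlonglongrightarrow> 0"
    unfolding p_def \<kappa>_def using t bf_pos \<sigma>f2_pos by real_asymp
  have ev1: "\<forall>\<^sub>F n in sequentially. s / sqrt (real n) \<le> t"
  proof -
    have "(\<lambda>n. s / sqrt (real n)) \<longlonglongrightarrow> 0" by real_asymp
    then have "\<forall>\<^sub>F n in sequentially. s / sqrt (real n) < t" using t by (rule order_tendstoD)
    then show ?thesis by eventually_elim simp
  qed
  have "\<forall>\<^sub>F n in sequentially. ?p \<le> p n"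
    using ev1 eventually_ge_at_top[of 2]
  proof eventually_elim
    case (elim n)
    have \<kappa>pos: "0 < \<kappa> n" using elim t by (simp add: \<kappa>_def)
    let ?B = "\<lambda>j. {u \<in> space \<Omega>. \<kappa> n \<le> \<bar>\<Sum>i=j..<Suc j. (F x (u i) - f x)\<bar>}"
    have Bj: "measure \<Omega> (?B j) \<le> 2 * exp (- (\<kappa> n)\<^sup>2 / (2 * (bf * \<kappa> n + \<sigma>f2)))" for j
    proof -
      let ?P = "\<Pi>\<^sub>M j\<in>{..<1::nat}. \<Xi>"
      let ?s = "\<lambda>u. \<lambda>i\<in>{..<1::nat}. u (j + i)"
      have D: "distr \<Omega> ?P ?s = ?P"
        using distr_PiM_reindex[of UNIV "\<lambda>_. \<Xi>" "\<lambda>i. j + i" "{..<1::nat}"] prob by auto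
      have [measurable]: "?s \<in> measurable \<Omega> ?P" by measurable
      have [measurable]: "(\<lambda>\<xi>. \<Sum>i<1::nat. (F x (\<xi> i) - f x)) \<in> borel_measurable ?P"
        by (intro borel_measurable_sum borel_measurable_diff measurable_compose[OF _ F_x_measurable]
          measurable_component_singleton) auto
      have "measure \<Omega> (?B j)
        = measure \<Omega> (?s -` {\<xi> \<in> space ?P. \<kappa> n \<le> \<bar>\<Sum>i<1::nat. (F x (\<xi> i) - f x)\<bar>} \<inter> space \<Omega>)"
        by (rule arg_cong[where f="measure \<Omega>"]) (auto simp: space_PiM)
      also have "\<dots> = \<P>(\<xi> in distr \<Omega> ?P ?s. real 1 * \<kappa> n \<le> \<bar>\<Sum>i<1::nat. (F x (\<xi> i) - f x)\<bar>)"
        by (subst measure_distr) auto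
      also have "\<dots> \<le> 2 * exp (- (real 1 * (\<kappa> n)\<^sup>2) / (2 * (bf * \<kappa> n + \<sigma>f2)))"
        unfolding D using noise_bound[OF \<kappa>pos, of 1 x] .
      finally show ?thesis by simp
    qed
    have "{u \<in> space \<Omega>. \<forall>n\<ge>2. \<not> max s (ssd n (\<lambda>j. F x (u j))) / sqrt (real n) \<le> t} \<subseteq> (\<Union>j\<in>{..<n}. ?B j)"
    proof safe
      fix u assume u: "u \<in> space \<Omega>" and ns: "\<forall>n\<ge>2. \<not> max s (ssd n (\<lambda>j. F x (u j))) / sqrt (real n) \<le> t"
      show "u \<in> (\<Union>j\<in>{..<n}. ?B j)"
      proof (rule ccontr)
        assume "u \<notin> (\<Union>j\<in>{..<n}. ?B j)"
        then have "\<bar>F x (u j) - f x\<bar> \<le> t * sqrt (real n - 1)" if "j < n" for j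
          using that u by (force simp: \<kappa>_def)
        then have "ssd n (\<lambda>j. F x (u j)) \<le> t * sqrt (real n)"
          using elim t by (intro ssd_le[where a="f x"]) auto
        moreover have "s \<le> t * sqrt (real n)" using elim by (simp add: field_simps)
        ultimately have "max s (ssd n (\<lambda>j. F x (u j))) / sqrt (real n) \<le> t"
          using elim by (simp add: field_simps)
        with ns elim show False by auto
      qed
    qed
    then have "?p \<le> measure \<Omega> (\<Union>j\<in>{..<n}. ?B j)"
      by (rule finite_measure_mono) measurable
    also have "\<dots> \<le> (\<Sum>j<n. measure \<Omega> (?B j))"
      by (rule finite_measure_subadditive_finite) auto
    also have "\<dots> \<le> (\<Sum>j<n. 2 * exp (- (\<kappa> n)\<^sup>2 / (2 * (bf * \<kappa> n + \<sigma>f2))))"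
      by (rule sum_mono) (rule Bj)
    finally show ?case by (simp add: p_def)
  qed
  then have "?p \<le> 0" by (rule tendsto_lowerbound[OF lim]) simp
  then show ?thesis by (simp add: measure_le_0_iff)
qed

end

section \<open>From fixed points to the random points of the algorithm\<close>

context noisy_oracle
begin

text \<open>By independence the joint law of \<open>Y\<close> and the draws is a product measure;
  integrating the bound on the sections over the law of \<open>Y\<close> replaces a fixed point by a
  random one.\<close>

lemma fresh_draws_prob_le:
  assumes "prob_space M" "subalgebra M G" "fresh_draws M \<Xi> G Z"
    and Y: "Y \<in> measurable G N" and B: "B \<in> sets (N \<Otimes>\<^sub>M \<Omega>)"
    and le: "\<And>y. y \<in> space N \<Longrightarrow> measure \<Omega> (Pair y -` B) \<le> \<delta>"
  shows "\<P>(\<omega> in M. (Y \<omega>, \<lambda>j. Z j \<omega>) \<in> B) \<le> \<delta>"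
proof -
  interpret prob_space M by fact
  interpret P: prob_space \<Omega> by (rule prob_\<Omega>)
  have iv: "indep_vars (\<lambda>_. \<Xi>) Z UNIV" and d: "distr M \<Xi> (Z j) = \<Xi>"
    and ind: "indep_set (sets G) (sets (vimage_algebra (space M) (\<lambda>\<omega> j. Z j \<omega>) \<Omega>))" for j
    using assms(3) unfolding fresh_draws_def by auto
  have Zj: "Z j \<in> measurable M \<Xi>" for j
    using iv unfolding indep_vars_def by auto
  define Zs where "Zs \<omega> = (\<lambda>j. Z j \<omega>)" for \<omega>
  have Zs [measurable]: "Zs \<in> measurable M \<Omega>"
    unfolding Zs_def by (rule measurable_abs_UNIV) (rule Zj)
  have YM [measurable]: "Y \<in> measurable M N"
    using Y assms(2) by (rule measurable_from_subalg[rotated])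
  have dZ: "distr M \<Omega> Zs = \<Omega>"
    using iv unfolding Zs_def[abs_def]
    by (subst (asm) indep_vars_iff_distr_eq_PiM) (auto simp: Zj d restrict_def)
  interpret D: prob_space "distr M N Y" by (rule prob_space_distr) (rule YM)
  have J: "distr M N Y \<Otimes>\<^sub>M \<Omega> = distr M (N \<Otimes>\<^sub>M \<Omega>) (\<lambda>\<omega>. (Y \<omega>, Zs \<omega>))"
  proof (rule pair_measure_eqI)
    show "sigma_finite_measure (distr M N Y)" "sigma_finite_measure \<Omega>" by unfold_locales
    show "sets (distr M N Y \<Otimes>\<^sub>M \<Omega>) = sets (distr M (N \<Otimes>\<^sub>M \<Omega>) (\<lambda>\<omega>. (Y \<omega>, Zs \<omega>)))"
      unfolding sets_distr by (rule sets_pair_measure_cong) auto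
    fix A C assume "A \<in> sets (distr M N Y)" and C: "C \<in> sets \<Omega>"
    then have A: "A \<in> sets N" by simp
    have spG: "space G = space M" using assms(2) by (simp add: subalgebra_def)
    have "Y -` A \<inter> space M \<in> sets G"
      using measurable_sets[OF Y A] spG by simp
    moreover have "Zs -` C \<inter> space M \<in> sets (vimage_algebra (space M) (\<lambda>\<omega> j. Z j \<omega>) \<Omega>)"
      unfolding Zs_def[abs_def] using C by (rule in_vimage_algebra)
    ultimately have "prob ((Y -` A \<inter> space M) \<inter> (Zs -` C \<inter> space M)) = prob (Y -` A \<inter> space M) * prob (Zs -` C \<inter> space M)"
      by (rule indep_setD[OF ind])
    moreover have "(Y -` A \<inter> space M) \<inter> (Zs -` C \<inter> space M) = (\<lambda>\<omega>. (Y \<omega>, Zs \<omega>)) -` (A \<times> C) \<inter> space M"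
      by auto
    moreover have "emeasure \<Omega> C = emeasure M (Zs -` C \<inter> space M)"
      using C by (subst dZ[symmetric]) (simp add: emeasure_distr)
    ultimately show "emeasure (distr M N Y) A * emeasure \<Omega> C = emeasure (distr M (N \<Otimes>\<^sub>M \<Omega>) (\<lambda>\<omega>. (Y \<omega>, Zs \<omega>))) (A \<times> C)"
      using A C by (simp add: emeasure_distr emeasure_eq_measure ennreal_mult)
  qed
  have \<delta>: "0 \<le> \<delta>"
  proof -
    obtain \<omega> where "\<omega> \<in> space M" using not_empty by blast
    then have "Y \<omega> \<in> space N" using YM by (rule measurable_space[rotated])
    from le[OF this] show ?thesis by (rule order_trans[OF measure_nonneg])
  qed
  have B': "B \<in> sets (distr M N Y \<Otimes>\<^sub>M \<Omega>)" using B by simp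
  have "emeasure M {\<omega> \<in> space M. (Y \<omega>, \<lambda>j. Z j \<omega>) \<in> B} = emeasure (distr M (N \<Otimes>\<^sub>M \<Omega>) (\<lambda>\<omega>. (Y \<omega>, Zs \<omega>))) B"
    using B by (subst emeasure_distr)
      (auto simp: Zs_def[symmetric] intro!: arg_cong[where f="emeasure M"] measurable_Pair YM Zs)
  also have "\<dots> = (\<integral>\<^sup>+ y. emeasure \<Omega> (Pair y -` B) \<partial>distr M N Y)"
    unfolding J[symmetric] by (rule P.emeasure_pair_measure_alt[OF B'])
  also have "\<dots> \<le> (\<integral>\<^sup>+ y. ennreal \<delta> \<partial>distr M N Y)"
    by (rule nn_integral_mono) (auto simp: P.emeasure_eq_measure intro!: ennreal_leI le)
  also have "\<dots> = ennreal \<delta>"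
    using D.emeasure_space_1 by simp
  finally show ?thesis
    using \<delta> by (simp add: emeasure_eq_measure)
qed

end

text \<open>The floor \<open>s\<close> on the standard deviation alone forces the realized size to
  satisfy the lower bound in \<open>dev\<close>. Since \<open>dev\<close> covers all such sizes, it
  may be used at the data-dependent one; \<open>m\<close> only witnesses that the rule
  fires.\<close>

lemma smean_sample_size_close:
  assumes pos: "0 < s" "0 < \<kappa>d" "0 < l" "0 < \<Delta>"
    and stop: "2 \<le> m" "max s (ssd m u) / sqrt (real m) \<le> \<kappa>d * \<Delta>\<^sup>2 / sqrt l"
    and dev: "\<And>n. s\<^sup>2 * l \<le> \<kappa>d\<^sup>2 * \<Delta>^4 * real n \<Longrightarrow> \<bar>\<Sum>j<n. (u j - a)\<bar> < real n * e"
  shows "\<bar>smean (sample_size s \<kappa>d l \<Delta> u) u - a\<bar> < e"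
proof -
  define n where "n = sample_size s \<kappa>d l \<Delta> u"
  have n: "2 \<le> n" "max s (ssd n u) / sqrt (real n) \<le> \<kappa>d * \<Delta>\<^sup>2 / sqrt l"
    using LeastI[of "\<lambda>n. 2 \<le> n \<and> max s (ssd n u) / sqrt (real n) \<le> \<kappa>d * \<Delta>\<^sup>2 / sqrt l" m] stop
    unfolding n_def sample_size_def by auto
  have "s / sqrt (real n) \<le> \<kappa>d * \<Delta>\<^sup>2 / sqrt l"
    by (rule order_trans[OF divide_right_mono n(2)]) auto
  then have "s * sqrt l \<le> \<kappa>d * \<Delta>\<^sup>2 * sqrt (real n)"
    using n(1) pos by (simp add: field_simps)
  then have "(s * sqrt l)\<^sup>2 \<le> (\<kappa>d * \<Delta>\<^sup>2 * sqrt (real n))\<^sup>2"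
    using pos by (intro power_mono) auto
  then have "s\<^sup>2 * l \<le> \<kappa>d\<^sup>2 * \<Delta>^4 * real n"
    using pos by (simp add: power_mult_distrib flip: power_mult)
  from dev[OF this] have "\<bar>\<Sum>j<n. (u j - a)\<bar> / real n < e"
    using n(1) by (simp add: field_simps)
  moreover have "smean n u - a = (\<Sum>j<n. (u j - a)) / real n"
    using n(1) by (simp add: smean_def sum_subtractf field_simps)
  ultimately show ?thesis unfolding n_def by simp
qed

text \<open>\<open>C\<close> shrinks with the tolerance and may be tiny. A plain logarithm would
  give only a small power of \<open>k\<close>; the additional \<open>e\<close> lets the exponent
  eventually exceed \<open>2 * ln k\<close> whatever \<open>C\<close> is.\<close>

lemma summable_exp_neg_log_powr:
  assumes C: "0 < C" and e: "0 < e" and l: "l \<in> \<Theta>(\<lambda>k. ln (real k) powr (1 + e))" "\<And>k. 0 < l k"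
  shows "summable (\<lambda>k. exp (- (C * l k)))"
proof -
  from l(1) have "l \<in> \<Omega>(\<lambda>k. ln (real k) powr (1 + e))" by auto
  then obtain c where c: "0 < c" "\<forall>\<^sub>F k in sequentially. norm (l k) \<ge> c * norm (ln (real k) powr (1 + e))"
    by (elim landau_omega.bigE)
  have "\<forall>\<^sub>F k in sequentially. 2 * ln (real k) \<le> C * (c * ln (real k) powr (1 + e))"
    using C c(1) e by real_asymp
  then have "\<forall>\<^sub>F k in sequentially. norm (exp (- (C * l k))) \<le> real k powr - 2"
    using c(2) eventually_ge_at_top[of 1]
  proof eventually_elim
    case (elim k)
    have "2 * ln (real k) \<le> C * l k"
      using elim l(2)[of k] C by (smt (verit) mult_left_mono norm_of_real real_norm_def powr_ge_zero)
    then have "exp (- (C * l k)) \<le> exp (- 2 * ln (real k))" by simp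
    then show ?case using elim by (simp add: powr_def)
  qed
  moreover have "summable (\<lambda>k. real k powr - 2)"
    by (subst summable_real_powr_iff) simp
  ultimately show ?thesis by (rule summable_comparison_test_ev)
qed

context noisy_oracle
begin

lemma F_joint_measurable:
  assumes "g \<in> measurable N borel" "h \<in> measurable N \<Xi>"
  shows "(\<lambda>p. F (g p) (h p)) \<in> borel_measurable N"
proof -
  have "(\<lambda>p. (g p, h p)) \<in> measurable N (borel \<Otimes>\<^sub>M \<Xi>)" using assms by measurable
  from measurable_compose[OF this F_measurable] show ?thesis by simp
qed

text \<open>A superset of the failure event, written without \<open>LEAST\<close>: either the rule
  never fires, or some admissible size has a large deviation. It lives on the product of points,
  radii and draws, so that independence can be applied to it, and countable operations give its
  measurability.\<close>

definition inaccurate :: "real \<Rightarrow> real \<Rightarrow> real \<Rightarrow> real \<Rightarrow> real \<Rightarrow> (((real^'d) \<times> real) \<times> (nat \<Rightarrow> 'x)) set" where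
  "inaccurate s \<kappa>d D e l = {p \<in> space ((borel \<Otimes>\<^sub>M borel) \<Otimes>\<^sub>M \<Omega>).
     0 < snd (fst p) \<and> snd (fst p) \<le> D \<and>
     ((\<forall>n\<ge>2. \<not> max s (ssd n (\<lambda>j. F (fst (fst p)) (snd p j))) / sqrt (real n) \<le> \<kappa>d * (snd (fst p))\<^sup>2 / sqrt l) \<or>
      (\<exists>n. s\<^sup>2 * l \<le> \<kappa>d\<^sup>2 * (snd (fst p))^4 * real n \<and>
           real n * (e * (snd (fst p))\<^sup>2) \<le> \<bar>\<Sum>j<n. (F (fst (fst p)) (snd p j) - f (fst (fst p)))\<bar>))}"

lemma inaccurate_sets: "inaccurate s \<kappa>d D e l \<in> sets ((borel \<Otimes>\<^sub>M borel) \<Otimes>\<^sub>M \<Omega>)"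
proof -
  let ?N = "(borel \<Otimes>\<^sub>M borel) \<Otimes>\<^sub>M \<Omega> :: (((real^'d) \<times> real) \<times> (nat \<Rightarrow> 'x)) measure"
  have [measurable]: "(\<lambda>p. F (fst (fst p)) (snd p j)) \<in> borel_measurable ?N" for j
    by (rule F_joint_measurable) measurable
  have [measurable]: "(\<lambda>p. f (fst (fst p))) \<in> borel_measurable ?N"
    by measurable
  have [measurable]: "(\<lambda>p. ssd n (\<lambda>j. F (fst (fst p)) (snd p j))) \<in> borel_measurable ?N" for n
    unfolding ssd_def smean_def by measurable
  have [measurable]: "(\<lambda>p. \<Sum>j<n. (F (fst (fst p)) (snd p j) - f (fst (fst p)))) \<in> borel_measurable ?N" for n
    by measurable
  have [measurable]: "(\<lambda>p. snd (fst p)) \<in> borel_measurable ?N"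
    by measurable
  show ?thesis
    unfolding inaccurate_def by measurable
qed

text \<open>At least \<open>s^2 * l / (\<kappa>d^2 * \<Delta>^4)\<close> draws meet the accuracy
  \<open>e * \<Delta>^2\<close>, so the radius cancels from the product of the size with the squared
  accuracy. The bound \<open>D\<close> enters only through the linear term of the Bernstein
  denominator.\<close>

lemma inaccurate_prob_le:
  assumes pos: "0 < s" "0 < \<kappa>d" "0 < l" "0 < e" "0 < D"
    and r: "exp (- (s\<^sup>2 * e\<^sup>2 / (\<kappa>d\<^sup>2 * (16 * (bf * (e * D\<^sup>2) + \<sigma>f2))) * l)) \<le> r" "r \<le> 1/4"
  shows "measure \<Omega> (Pair y -` inaccurate s \<kappa>d D e l) \<le> 6 * r"
proof (cases y)
  case (Pair x \<Delta>)
  interpret prob_space \<Omega> by (rule prob_\<Omega>)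
  have rpos: "0 < r" by (rule less_le_trans[OF exp_gt_zero r(1)])
  show ?thesis
  proof (cases "0 < \<Delta> \<and> \<Delta> \<le> D")
    case False
    then have "Pair y -` inaccurate s \<kappa>d D e l = {}" by (auto simp: inaccurate_def Pair)
    then show ?thesis using rpos by simp
  next
    case True
    let ?N = "{u \<in> space \<Omega>. \<forall>n\<ge>2. \<not> max s (ssd n (\<lambda>j. F x (u j))) / sqrt (real n) \<le> \<kappa>d * \<Delta>\<^sup>2 / sqrt l}"
    define n0 where "n0 = nat \<lceil>s\<^sup>2 * l / (\<kappa>d\<^sup>2 * \<Delta>^4)\<rceil>"
    have frac: "0 < s\<^sup>2 * l / (\<kappa>d\<^sup>2 * \<Delta>^4)" using pos True by simp
    then have n0: "1 \<le> n0" unfolding n0_def by linarith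
    have n0ge: "s\<^sup>2 * l / (\<kappa>d\<^sup>2 * \<Delta>^4) \<le> real n0" unfolding n0_def by linarith
    let ?L = "{u \<in> space \<Omega>. \<exists>n\<ge>n0. real n * (e * \<Delta>\<^sup>2) \<le> \<bar>\<Sum>i<n. (F x (u i) - f x)\<bar>}"
    have [measurable]: "?N \<in> sets \<Omega>" "?L \<in> sets \<Omega>" by measurable
    have "Pair y -` inaccurate s \<kappa>d D e l \<subseteq> ?N \<union> ?L"
    proof
      fix u assume u: "u \<in> Pair y -` inaccurate s \<kappa>d D e l"
      then have us: "u \<in> space \<Omega>" by (auto simp: inaccurate_def Pair space_pair_measure)
      show "u \<in> ?N \<union> ?L"
      proof (cases "u \<in> ?N")
        case False
        with u us obtain n where n: "s\<^sup>2 * l \<le> \<kappa>d\<^sup>2 * \<Delta>^4 * real n"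
          "real n * (e * \<Delta>\<^sup>2) \<le> \<bar>\<Sum>j<n. (F x (u j) - f x)\<bar>"
          by (auto simp: inaccurate_def Pair)
        have "s\<^sup>2 * l / (\<kappa>d\<^sup>2 * \<Delta>^4) \<le> real n"
          using n(1) pos True by (simp add: field_simps)
        then have "n0 \<le> n" unfolding n0_def by linarith
        with n us show ?thesis by auto
      qed simp
    qed
    then have "measure \<Omega> (Pair y -` inaccurate s \<kappa>d D e l) \<le> measure \<Omega> (?N \<union> ?L)"
      by (rule finite_measure_mono) measurable
    also have "\<dots> \<le> measure \<Omega> ?N + measure \<Omega> ?L"
      by (rule measure_Un_le) measurable
    also have "measure \<Omega> ?N = 0"
      using sampling_stops[of "\<kappa>d * \<Delta>\<^sup>2 / sqrt l" s x] pos True by simp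
    also have "measure \<Omega> ?L \<le> 6 * r"
    proof (rule noise_uniform[OF n0])
      show "0 < e * \<Delta>\<^sup>2" "e * \<Delta>\<^sup>2 \<le> e * D\<^sup>2"
        using pos True by (auto intro!: mult_left_mono power_mono)
      have "s\<^sup>2 * e\<^sup>2 / \<kappa>d\<^sup>2 * l = (s\<^sup>2 * l / (\<kappa>d\<^sup>2 * \<Delta>^4)) * (e * \<Delta>\<^sup>2)\<^sup>2"
        using pos True by (simp add: power_mult_distrib flip: power_mult)
      also have "\<dots> \<le> real n0 * (e * \<Delta>\<^sup>2)\<^sup>2"
        by (rule mult_right_mono[OF n0ge]) simp
      finally have "s\<^sup>2 * e\<^sup>2 / \<kappa>d\<^sup>2 * l / (16 * (bf * (e * D\<^sup>2) + \<sigma>f2)) \<le> real n0 * (e * \<Delta>\<^sup>2)\<^sup>2 / (16 * (bf * (e * D\<^sup>2) + \<sigma>f2))"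
        using pos bf_pos \<sigma>f2_pos by (intro divide_right_mono) auto
      then have "exp (- (real n0 * (e * \<Delta>\<^sup>2)\<^sup>2) / (16 * (bf * (e * D\<^sup>2) + \<sigma>f2)))
        \<le> exp (- (s\<^sup>2 * e\<^sup>2 / (\<kappa>d\<^sup>2 * (16 * (bf * (e * D\<^sup>2) + \<sigma>f2))) * l))"
        by simp
      with r(1) show "exp (- (real n0 * (e * \<Delta>\<^sup>2)\<^sup>2) / (16 * (bf * (e * D\<^sup>2) + \<sigma>f2))) \<le> r" by linarith
    qed (rule r(2))
    finally show ?thesis by simp
  qed
qed

lemma estimates_accurate:
  assumes M: "prob_space M" "\<And>k. subalgebra M (G k)" "\<And>k. fresh_draws M \<Xi> (G k) (Z k)"
    and x: "\<And>k. x k \<in> borel_measurable (G k)" and \<Delta>: "\<And>k. \<Delta> k \<in> borel_measurable (G k)"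
    and \<Delta>_bounds: "\<And>k \<omega>. \<omega> \<in> space M \<Longrightarrow> 0 < \<Delta> k \<omega> \<and> \<Delta> k \<omega> \<le> D"
    and pos: "0 < s" "0 < \<kappa>d" "\<And>k. 0 < l k" "0 < \<epsilon>"
    and l: "l \<in> \<Theta>(\<lambda>k. ln (real k) powr (1 + \<epsilon>))"
  shows "AE \<omega> in M. \<forall>e>0. \<forall>\<^sub>F k in sequentially.
     (let u = (\<lambda>j. F (x k \<omega>) (Z k j \<omega>))
      in \<bar>smean (sample_size s \<kappa>d (l k) (\<Delta> k \<omega>) u) u - f (x k \<omega>)\<bar> < e * (\<Delta> k \<omega>)\<^sup>2)"
proof -
  interpret prob_space M by fact
  let ?est = "\<lambda>k \<omega>. let u = (\<lambda>j. F (x k \<omega>) (Z k j \<omega>)) in smean (sample_size s \<kappa>d (l k) (\<Delta> k \<omega>) u) u"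
  have D: "0 < D"
    using not_empty \<Delta>_bounds[of _ 0] by force
  have Z: "(\<lambda>\<omega> j. Z k j \<omega>) \<in> measurable M \<Omega>" for k
    using M(3)[of k] unfolding fresh_draws_def indep_vars_def by (intro measurable_abs_UNIV) auto
  have single: "AE \<omega> in M. \<forall>\<^sub>F k in sequentially. \<bar>?est k \<omega> - f (x k \<omega>)\<bar> < e * (\<Delta> k \<omega>)\<^sup>2" if e: "0 < e" for e
  proof -
    define C where "C = s\<^sup>2 * e\<^sup>2 / (\<kappa>d\<^sup>2 * (16 * (bf * (e * D\<^sup>2) + \<sigma>f2)))"
    have C: "0 < C" unfolding C_def using pos e D bf_pos \<sigma>f2_pos
      by (intro divide_pos_pos mult_pos_pos add_pos_pos) auto
    define A where "A k = {\<omega> \<in> space M. ((x k \<omega>, \<Delta> k \<omega>), \<lambda>j. Z k j \<omega>) \<in> inaccurate s \<kappa>d D e (l k)}" for k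
    have Y: "(\<lambda>\<omega>. (x k \<omega>, \<Delta> k \<omega>)) \<in> measurable (G k) (borel \<Otimes>\<^sub>M borel)" for k
      using x \<Delta> by measurable
    have A [measurable]: "A k \<in> sets M" for k
    proof -
      have "(\<lambda>\<omega>. ((x k \<omega>, \<Delta> k \<omega>), \<lambda>j. Z k j \<omega>)) \<in> measurable M ((borel \<Otimes>\<^sub>M borel) \<Otimes>\<^sub>M \<Omega>)"
        by (rule measurable_Pair[OF measurable_from_subalg[OF M(2) Y] Z])
      from measurable_sets[OF this inaccurate_sets] show ?thesis
        unfolding A_def by (simp add: vimage_def Int_def conj_commute)
    qed
    have sm: "summable (\<lambda>k. exp (- (C * l k)))"
      by (rule summable_exp_neg_log_powr[OF C pos(4) l pos(3)])
    then have "(\<lambda>k. exp (- (C * l k))) \<longlonglongrightarrow> 0" by (rule summable_LIMSEQ_zero)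
    \<comment> \<open>The value \<open>1/4\<close> is the side condition under which the dyadic
      blocks were summed.\<close>
    then have "\<forall>\<^sub>F k in sequentially. exp (- (C * l k)) < 1/4" by (rule order_tendstoD) simp
    then have "\<forall>\<^sub>F k in sequentially. norm (measure M (A k)) \<le> 6 * exp (- (C * l k))"
    proof eventually_elim
      case (elim k)
      have "measure M (A k) \<le> 6 * exp (- (C * l k))"
        unfolding A_def
        by (rule fresh_draws_prob_le[OF M Y inaccurate_sets],
            rule inaccurate_prob_le[OF pos(1,2) pos(3) e D]) (use elim in \<open>auto simp: C_def\<close>)
      then show ?case by simp
    qed
    then have "summable (\<lambda>k. measure M (A k))"
      by (rule summable_comparison_test_ev) (rule summable_mult[OF sm])
    then have "AE \<omega> in M. \<forall>\<^sub>F k in sequentially. \<omega> \<in> space M - A k"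
      by (intro borel_cantelli_AE1 A) (auto simp: emeasure_eq_measure)
    then show ?thesis
    proof eventually_elim
      case (elim \<omega>)
      then show ?case
      proof eventually_elim
        case (elim k)
        then have w: "\<omega> \<in> space M" and nb: "((x k \<omega>, \<Delta> k \<omega>), \<lambda>j. Z k j \<omega>) \<notin> inaccurate s \<kappa>d D e (l k)"
          by (auto simp: A_def)
        have Zw: "(\<lambda>j. Z k j \<omega>) \<in> space \<Omega>" using measurable_space[OF Z w] .
        let ?u = "\<lambda>j. F (x k \<omega>) (Z k j \<omega>)"
        from nb Zw \<Delta>_bounds[OF w, of k] obtain m where
          m: "2 \<le> m" "max s (ssd m ?u) / sqrt (real m) \<le> \<kappa>d * (\<Delta> k \<omega>)\<^sup>2 / sqrt (l k)"
          by (auto simp: inaccurate_def space_pair_measure)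
        have dev: "\<bar>\<Sum>j<n. (?u j - f (x k \<omega>))\<bar> < real n * (e * (\<Delta> k \<omega>)\<^sup>2)"
          if "s\<^sup>2 * l k \<le> \<kappa>d\<^sup>2 * (\<Delta> k \<omega>)^4 * real n" for n
          using nb Zw \<Delta>_bounds[OF w, of k] that
          by (auto simp: inaccurate_def space_pair_measure not_le not_less[symmetric])
        show ?case unfolding Let_def
          by (rule smean_sample_size_close[OF pos(1,2) pos(3) _ m dev]) (use \<Delta>_bounds[OF w] in auto)
      qed
    qed
  qed
  \<comment> \<open>Null sets may be united only countably often, so the tolerance runs through
    \<open>1 / (m + 1)\<close>.\<close>
  have "AE \<omega> in M. \<forall>m::nat. \<forall>\<^sub>F k in sequentially. \<bar>?est k \<omega> - f (x k \<omega>)\<bar> < (1 / real (Suc m)) * (\<Delta> k \<omega>)\<^sup>2"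
    unfolding AE_all_countable by (intro allI single) simp
  then show ?thesis
  proof eventually_elim
    case (elim \<omega>)
    show ?case
    proof (intro allI impI)
      fix e :: real assume "0 < e"
      then obtain m where m: "1 / real (Suc m) < e" using nat_approx_posE by blast
      from elim have "\<forall>\<^sub>F k in sequentially. \<bar>?est k \<omega> - f (x k \<omega>)\<bar> < (1 / real (Suc m)) * (\<Delta> k \<omega>)\<^sup>2" by blast
      then show "\<forall>\<^sub>F k in sequentially. (let u = (\<lambda>j. F (x k \<omega>) (Z k j \<omega>))
          in \<bar>smean (sample_size s \<kappa>d (l k) (\<Delta> k \<omega>) u) u - f (x k \<omega>)\<bar> < e * (\<Delta> k \<omega>)\<^sup>2)"
      proof eventually_elim
        case (elim k)
        have "(1 / real (Suc m)) * (\<Delta> k \<omega>)\<^sup>2 \<le> e * (\<Delta> k \<omega>)\<^sup>2"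
          using m by (intro mult_right_mono) auto
        with elim show ?case by (simp only: Let_def)
      qed
    qed
  qed
qed

end

section \<open>Linear algebra\<close>

declare transpose_matrix_vector [simp del]

lemma inner_transpose_mult:
  fixes B :: "real^'d::finite^'p::finite"
  shows "(transpose B *v u) \<bullet> y = u \<bullet> (B *v y)"
  by (simp add: dot_lmul_matrix transpose_matrix_vector)

text \<open>Variational characterization of the smallest singular value: a minimizer of
  \<open>norm (transpose B *v u)\<close> on the unit sphere is an eigenvector of the Gram matrix, so
  the minimum \<open>m\<close> itself belongs to \<open>singular_values B\<close>.\<close>

lemma norm_transpose_mult_ge:
  fixes B :: "real^'d::finite^'p::finite"
  assumes "\<forall>\<sigma>\<in>singular_values B. \<kappa> \<le> \<sigma>"
  shows "\<kappa> * norm u \<le> norm (transpose B *v u)"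
proof -
  let ?h = "\<lambda>u. norm (transpose B *v u)"
  have ne: "sphere (0::real^'p) 1 \<noteq> {}" by simp
  have "continuous_on (sphere 0 1) ?h"
    by (intro continuous_on_norm linear_continuous_on matrix_vector_mul_bounded_linear)
  from continuous_attains_inf[OF compact_sphere ne this]
  obtain u0 where u0: "norm u0 = 1" and min: "\<And>y. norm y = 1 \<Longrightarrow> ?h u0 \<le> ?h y"
    by auto
  define m where "m = ?h u0"
  have hm: "m * norm y \<le> ?h y" for y
  proof (cases "y = 0")
    case False
    have "?h ((1 / norm y) *\<^sub>R y) = ?h y / norm y"
      by (simp add: matrix_vector_mult_scaleR)
    moreover have "m \<le> ?h ((1 / norm y) *\<^sub>R y)" unfolding m_def using False by (intro min) simp
    ultimately have "m \<le> ?h y / norm y" by simp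
    then show ?thesis using False by (simp add: pos_le_divide_eq)
  qed simp
  define q where "q y = (transpose B *v y) \<bullet> (transpose B *v y) - m\<^sup>2 * (y \<bullet> y)" for y
  have q0: "0 \<le> q y" for y
  proof -
    have "(m * norm y)\<^sup>2 \<le> (?h y)\<^sup>2" using hm[of y] by (intro power_mono) (auto simp: m_def)
    then show ?thesis by (simp add: q_def power_mult_distrib dot_square_norm)
  qed
  \<comment> \<open>Half the gradient of \<open>q\<close> at \<open>u0\<close>. As \<open>q\<close>
    is nonnegative and vanishes at \<open>u0\<close>, it must be 0.\<close>
  define w where "w = (B ** transpose B) *v u0 - m\<^sup>2 *\<^sub>R u0"
  have qu0: "q u0 = 0" using u0 by (simp add: q_def m_def dot_square_norm)
  have exp: "q (u0 + t *\<^sub>R w) = 2 * t * (w \<bullet> w) + t\<^sup>2 * q w" for t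
  proof -
    have sq: "(a + t *\<^sub>R b) \<bullet> (a + t *\<^sub>R b) = a \<bullet> a + 2 * t * (a \<bullet> b) + t\<^sup>2 * (b \<bullet> b)" for a b :: "'c::real_inner"
      by (simp add: inner_add_left inner_add_right inner_commute[of b a] power2_eq_square distrib_left)
    have "w \<bullet> w = (B *v (transpose B *v u0)) \<bullet> w - m\<^sup>2 * (u0 \<bullet> w)"
      unfolding matrix_vector_mul_assoc by (subst (1) w_def) (simp only: inner_diff_left inner_scaleR_left)
    also have "(B *v (transpose B *v u0)) \<bullet> w = (transpose B *v u0) \<bullet> (transpose B *v w)"
      using inner_transpose_mult[of B w "transpose B *v u0"] by (simp add: inner_commute)
    finally have ww: "w \<bullet> w = (transpose B *v u0) \<bullet> (transpose B *v w) - m\<^sup>2 * (u0 \<bullet> w)" .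
    have "q (u0 + t *\<^sub>R w) = q u0 + 2 * t * ((transpose B *v u0) \<bullet> (transpose B *v w) - m\<^sup>2 * (u0 \<bullet> w)) + t\<^sup>2 * q w"
      unfolding q_def matrix_vector_right_distrib matrix_vector_mult_scaleR sq
      by (simp add: algebra_simps)
    then show ?thesis using qu0 ww by simp
  qed
  have "w = 0"
  proof (rule ccontr)
    assume "w \<noteq> 0"
    then have a: "0 < w \<bullet> w" by simp
    \<comment> \<open>Adding 1 makes the curvature bound positive even if \<open>q w = 0\<close>;
      the step \<open>- (w \<bullet> w) / b\<close> minimizes the resulting parabola.\<close>
    define b where "b = q w + 1"
    have b: "0 < b" "q w \<le> b" using q0[of w] by (auto simp: b_def)
    have "0 \<le> 2 * (- (w \<bullet> w) / b) * (w \<bullet> w) + (- (w \<bullet> w) / b)\<^sup>2 * q w"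
      using q0[of "u0 + (- (w \<bullet> w) / b) *\<^sub>R w"] unfolding exp .
    also have "\<dots> \<le> 2 * (- (w \<bullet> w) / b) * (w \<bullet> w) + (- (w \<bullet> w) / b)\<^sup>2 * b"
      using b(2) by (intro add_left_mono mult_left_mono) auto
    also have "\<dots> = - ((w \<bullet> w)\<^sup>2 / b)"
      using b by (simp add: power2_eq_square field_simps)
    finally have "(w \<bullet> w)\<^sup>2 / b \<le> 0" by simp
    moreover have "0 < (w \<bullet> w)\<^sup>2 / b" using a b by (intro divide_pos_pos) auto
    ultimately show False by linarith
  qed
  then have "m \<in> singular_values B"
    unfolding singular_values_def using u0 by (auto simp: w_def m_def intro!: exI[of _ u0])
  then have "\<kappa> \<le> m" using assms by blast
  then have "\<kappa> * norm u \<le> m * norm u" by (intro mult_right_mono) auto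
  with hm[of u] show ?thesis by linarith
qed

text \<open>Cauchy-Schwarz applied to \<open>w \<bullet> w = u \<bullet> (B *v w)\<close>, where
  \<open>norm u\<close> is at most \<open>norm w / \<kappa>\<close>. This bounds the component of
  the normal step in the row space.\<close>

lemma norm_mult_ge_on_range_transpose:
  fixes B :: "real^'d::finite^'p::finite"
  assumes \<kappa>: "0 < \<kappa>" "\<And>u. \<kappa> * norm u \<le> norm (transpose B *v u)"
    and w: "w = transpose B *v u"
  shows "\<kappa> * norm w \<le> norm (B *v w)"
proof (cases "w = 0")
  case False
  then have u: "0 < norm u" using w by auto
  have "norm w * norm w = u \<bullet> (B *v w)"
    by (metis inner_transpose_mult w power2_eq_square power2_norm_eq_inner)
  also have "\<dots> \<le> norm u * norm (B *v w)" by (rule norm_cauchy_schwarz)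
  finally have 1: "norm w * norm w \<le> norm u * norm (B *v w)" .
  have "\<kappa> * norm u * norm w \<le> norm w * norm w"
    using \<kappa>(2)[of u] w by (intro mult_right_mono) auto
  with 1 have "norm u * (\<kappa> * norm w) \<le> norm u * norm (B *v w)" by (simp add: mult_ac)
  then show ?thesis using u by simp
qed simp

lemma norm_transpose_mult_le:
  fixes B :: "real^'d::finite^'p::finite"
  assumes "\<And>s. norm (B *v s) \<le> C * norm s"
  shows "norm (transpose B *v u) \<le> C * norm u"
proof (cases "transpose B *v u = 0")
  case True
  have "0 \<le> C * norm (axis undefined 1 :: real^'d)" by (rule order_trans[OF norm_ge_zero assms])
  then have "0 \<le> C" by simp
  with True show ?thesis by simp
next
  case False
  define z where "z = transpose B *v u"
  have "norm z * norm z = u \<bullet> (B *v z)"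
    by (metis inner_transpose_mult z_def power2_eq_square power2_norm_eq_inner)
  also have "\<dots> \<le> norm u * norm (B *v z)" by (rule norm_cauchy_schwarz)
  also have "\<dots> \<le> norm u * (C * norm z)" by (intro mult_left_mono assms) auto
  finally have "norm z * norm z \<le> (C * norm u) * norm z" by (simp add: mult_ac)
  moreover have "0 < norm z" using False by (simp add: z_def)
  ultimately show ?thesis by (simp add: z_def)
qed

lemma spectral_norm_gram_le:
  fixes B :: "real^'d::finite^'p::finite"
  assumes C: "\<And>s. norm (B *v s) \<le> C * norm s"
  shows "spectral_norm (transpose B ** B) \<le> C * C"
proof (rule onorm_bound)
  have "0 \<le> C * norm (axis undefined 1 :: real^'d)" by (rule order_trans[OF norm_ge_zero C])
  then have C0: "0 \<le> C" by simp
  then show "0 \<le> C * C" by simp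
  fix v :: "real^'d"
  have "norm ((transpose B ** B) *v v) = norm (transpose B *v (B *v v))"
    by (simp only: matrix_vector_mul_assoc)
  also have "\<dots> \<le> C * norm (B *v v)" by (rule norm_transpose_mult_le[OF C])
  also have "\<dots> \<le> C * (C * norm v)" by (rule mult_left_mono[OF C C0])
  finally show "norm ((transpose B ** B) *v v) \<le> C * C * norm v" by simp
qed

text \<open>The part of \<open>z\<close> orthogonal to the range of the transpose lies in the kernel
  of \<open>B\<close>, hence is orthogonal to \<open>z\<close> and therefore to itself.\<close>

lemma in_range_transpose:
  fixes B :: "real^'d::finite^'p::finite"
  assumes "\<And>s. B *v s = 0 \<Longrightarrow> z \<bullet> s = 0"
  obtains u where "z = transpose B *v u"
proof -
  let ?S = "range (\<lambda>u. transpose B *v u)"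
  have sub: "subspace ?S" using matrix_vector_mul_linear[of "transpose B"] by (rule linear_subspace_image) simp
  obtain y o' where y: "y \<in> span ?S" and o': "\<And>w. w \<in> span ?S \<Longrightarrow> orthogonal o' w" and z: "z = y + o'"
    using orthogonal_subspace_decomp_exists[of ?S z] by blast
  have yS: "y \<in> ?S" using y sub by (simp add: span_eq_iff[THEN iffD2])
  have "B *v o' = 0"
  proof -
    have "(transpose B *v (B *v o')) \<bullet> o' = 0"
      using o'[of "transpose B *v (B *v o')"] by (auto simp: orthogonal_def inner_commute intro: span_base)
    then have "(B *v o') \<bullet> (B *v o') = 0" by (simp only: inner_transpose_mult)
    then show ?thesis by simp
  qed
  then have "z \<bullet> o' = 0" by (rule assms)
  moreover have "y \<bullet> o' = 0" using o'[OF y] by (simp add: orthogonal_def inner_commute)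
  ultimately have "o' = 0" by (simp add: z inner_add_left)
  with z yS show ?thesis using that by auto
qed

lemma norm_orthonormal_sum:
  fixes b :: "nat \<Rightarrow> real^'d::finite"
  assumes "\<And>i j. i < n \<Longrightarrow> j < n \<Longrightarrow> b i \<bullet> b j = (if i = j then 1 else 0)"
  shows "norm (\<Sum>j<n. w j *\<^sub>R b j) = L2_set w {..<n}"
proof -
  have "(\<Sum>j<n. w j *\<^sub>R b j) \<bullet> (\<Sum>j<n. w j *\<^sub>R b j) = (\<Sum>i<n. \<Sum>j<n. w i * w j * (b i \<bullet> b j))"
    by (simp add: inner_sum_left inner_sum_right mult_ac inner_commute)
  also have "\<dots> = (\<Sum>i<n. \<Sum>j<n. if i = j then w i * w j else 0)"
    by (intro sum.cong refl) (simp add: assms)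
  also have "\<dots> = (\<Sum>i<n. (w i)\<^sup>2)" by (simp add: power2_eq_square)
  finally show ?thesis by (simp add: norm_eq_sqrt_inner L2_set_def)
qed

text \<open>Bessel's inequality; \<open>T\<close> is the orthogonal projection of
  \<open>v\<close>.\<close>

lemma L2_set_inner_orthonormal_le:
  fixes b :: "nat \<Rightarrow> real^'d::finite"
  assumes b: "\<And>i j. i < n \<Longrightarrow> j < n \<Longrightarrow> b i \<bullet> b j = (if i = j then 1 else 0)"
  shows "L2_set (\<lambda>j. b j \<bullet> v) {..<n} \<le> norm v"
proof -
  define T where "T = (\<Sum>j<n. (b j \<bullet> v) *\<^sub>R b j)"
  have T: "norm T = L2_set (\<lambda>j. b j \<bullet> v) {..<n}" unfolding T_def by (rule norm_orthonormal_sum[OF b])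
  have "norm T * norm T = T \<bullet> v"
  proof -
    have "(norm T)\<^sup>2 = (\<Sum>j<n. (b j \<bullet> v)\<^sup>2)" unfolding T by (simp add: L2_set_def sum_nonneg)
    then show ?thesis by (simp add: T_def inner_sum_left power2_eq_square)
  qed
  also have "\<dots> \<le> norm T * norm v" by (rule norm_cauchy_schwarz)
  finally have "norm T \<le> norm v" by (cases "norm T = 0") auto
  then show ?thesis by (simp add: T)
qed

text \<open>The coordinates of \<open>v\<close> in an orthonormal basis of the null space of \<open>B\<close> have norm
  \<open>dist v (range B\<^sup>T)\<close>; in this form their dependence on \<open>B\<close> is easy to estimate.\<close>

lemma null_space_coords_eq_dist:
  fixes b :: "nat \<Rightarrow> real^'d::finite" and B :: "real^'d^'p::finite"
  assumes b: "\<And>i j. i < n \<Longrightarrow> j < n \<Longrightarrow> b i \<bullet> b j = (if i = j then 1 else 0)"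
    and sp: "span (b ` {..<n}) = {s. B *v s = 0}"
  shows "L2_set (\<lambda>j. b j \<bullet> v) {..<n} \<le> norm (v - transpose B *v u)"
    and "\<exists>u. L2_set (\<lambda>j. b j \<bullet> v) {..<n} = norm (v - transpose B *v u)"
proof -
  have Bb: "B *v b j = 0" if "j < n" for j
    using sp span_base[of "b j" "b ` {..<n}"] that by auto
  have eq: "b j \<bullet> (v - transpose B *v u) = b j \<bullet> v" if "j < n" for j u
    using Bb[OF that] inner_transpose_mult[of B u "b j"]
    by (simp add: inner_diff_right inner_commute)
  have "L2_set (\<lambda>j. b j \<bullet> v) {..<n} = L2_set (\<lambda>j. b j \<bullet> (v - transpose B *v u)) {..<n}"
    by (rule L2_set_cong) (simp_all add: eq)
  also have "\<dots> \<le> norm (v - transpose B *v u)" by (rule L2_set_inner_orthonormal_le[OF b])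
  finally show "L2_set (\<lambda>j. b j \<bullet> v) {..<n} \<le> norm (v - transpose B *v u)" .
  define T where "T = (\<Sum>j<n. (b j \<bullet> v) *\<^sub>R b j)"
  have T: "norm T = L2_set (\<lambda>j. b j \<bullet> v) {..<n}" unfolding T_def by (rule norm_orthonormal_sum[OF b])
  have ob: "(v - T) \<bullet> b i = 0" if "i < n" for i
  proof -
    have "T \<bullet> b i = (\<Sum>j<n. if j = i then b j \<bullet> v else 0)"
      unfolding T_def inner_sum_left by (intro sum.cong refl) (simp add: b that)
    also have "\<dots> = b i \<bullet> v" using that by simp
    finally have "T \<bullet> b i = v \<bullet> b i" by (simp only: inner_commute)
    then show ?thesis by (simp only: inner_diff_left diff_self)
  qed
  have "(v - T) \<bullet> s = 0" if "B *v s = 0" for s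
  proof -
    have "s \<in> span (b ` {..<n})" using sp that by auto
    then show ?thesis
    proof (induct rule: span_induct_alt)
      case base then show ?case by simp
    next
      case (step c x y) then show ?case using ob by (auto simp: inner_add_right)
    qed
  qed
  then obtain u where "v - T = transpose B *v u" by (rule in_range_transpose[where B=B])
  then have "T = v - transpose B *v u" by (simp add: algebra_simps)
  with T show "\<exists>u. L2_set (\<lambda>j. b j \<bullet> v) {..<n} = norm (v - transpose B *v u)" by metis
qed

text \<open>The bases \<open>b1\<close> and \<open>b2\<close> need not be close to each other, even
  for close matrices. In the distance form, the optimal \<open>u\<close> for \<open>B1\<close>
  serves as a competitor for \<open>B2\<close>.\<close>

lemma null_space_coords_diff_le:
  fixes b1 b2 :: "nat \<Rightarrow> real^'d::finite" and B1 B2 :: "real^'d^'p::finite"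
  assumes b1: "\<And>i j. i < n \<Longrightarrow> j < n \<Longrightarrow> b1 i \<bullet> b1 j = (if i = j then 1 else 0)"
    and sp1: "span (b1 ` {..<n}) = {s. B1 *v s = 0}"
    and b2: "\<And>i j. i < n \<Longrightarrow> j < n \<Longrightarrow> b2 i \<bullet> b2 j = (if i = j then 1 else 0)"
    and sp2: "span (b2 ` {..<n}) = {s. B2 *v s = 0}"
    and \<kappa>: "0 < \<kappa>" "\<And>u. \<kappa> * norm u \<le> norm (transpose B1 *v u)"
    and d: "\<And>s. norm ((B1 - B2) *v s) \<le> \<delta> * norm s" and \<delta>: "0 \<le> \<delta>"
  shows "L2_set (\<lambda>j. b2 j \<bullet> v2) {..<n} - L2_set (\<lambda>j. b1 j \<bullet> v1) {..<n} \<le> norm (v2 - v1) + \<delta> * (2 * norm v1 / \<kappa>)"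
proof -
  obtain u where u: "L2_set (\<lambda>j. b1 j \<bullet> v1) {..<n} = norm (v1 - transpose B1 *v u)"
    using null_space_coords_eq_dist(2)[OF b1 sp1] by blast
  \<comment> \<open>The optimal residual is at most \<open>norm v1\<close>, by the competitor 0;
    this bounds \<open>u\<close> through \<open>\<kappa>\<close>.\<close>
  have "norm (transpose B1 *v u) \<le> norm (v1 - transpose B1 *v u) + norm v1"
    by (metis norm_minus_commute norm_triangle_sub add.commute)
  also have "\<dots> \<le> 2 * norm v1"
    using u null_space_coords_eq_dist(1)[OF b1 sp1, of v1 0] by simp
  finally have "\<kappa> * norm u \<le> 2 * norm v1" using \<kappa>(2)[of u] by linarith
  then have nu: "norm u \<le> 2 * norm v1 / \<kappa>" using \<kappa>(1) by (simp add: field_simps)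
  have "L2_set (\<lambda>j. b2 j \<bullet> v2) {..<n} \<le> norm (v2 - transpose B2 *v u)"
    by (rule null_space_coords_eq_dist(1)[OF b2 sp2])
  also have "v2 - transpose B2 *v u = (v1 - transpose B1 *v u) + ((v2 - v1) + transpose (B1 - B2) *v u)"
  proof -
    have "transpose (B1 - B2) = transpose B1 - transpose B2" by (simp add: transpose_def vec_eq_iff)
    then have "transpose (B1 - B2) *v u = transpose B1 *v u - transpose B2 *v u"
      by (simp only: matrix_vector_mult_diff_rdistrib)
    then show ?thesis by (simp)
  qed
  also have "norm \<dots> \<le> norm (v1 - transpose B1 *v u) + (norm (v2 - v1) + norm (transpose (B1 - B2) *v u))"
    by (meson add_left_mono norm_triangle_ineq order_trans)
  also have "norm (transpose (B1 - B2) *v u) \<le> \<delta> * norm u" by (rule norm_transpose_mult_le[OF d])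
  also have "\<delta> * norm u \<le> \<delta> * (2 * norm v1 / \<kappa>)" by (rule mult_left_mono[OF nu \<delta>])
  finally show ?thesis by (simp add: u)
qed

section \<open>Smoothness, interpolation and real sequences\<close>

text \<open>Mean value theorem for \<open>h\<close>, the restriction of \<open>f\<close> to the
  segment minus its linear part. It yields \<open>L\<close> instead of the sharp
  \<open>L / 2\<close>, which affects later constants only.\<close>

lemma gderiv_taylor:
  fixes f :: "real^'d::finite \<Rightarrow> real"
  assumes gd: "\<And>x. GDERIV f x :> gf x" and lip: "L-lipschitz_on UNIV gf"
  shows "\<bar>f (x + s) - f x - gf x \<bullet> s\<bar> \<le> L * (norm s)\<^sup>2"
proof -
  define h where "h t = f (x + t *\<^sub>R s) - t * (gf x \<bullet> s)" for t
  have d: "(h has_real_derivative (gf (x + t *\<^sub>R s) - gf x) \<bullet> s) (at t)" for t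
  proof -
    have "(f has_derivative (\<lambda>h. h \<bullet> gf (x + t *\<^sub>R s))) (at (x + t *\<^sub>R s))"
      using gd unfolding gderiv_def by blast
    moreover have "((\<lambda>t. x + t *\<^sub>R s) has_derivative (\<lambda>h. h *\<^sub>R s)) (at t)"
      by (auto intro!: derivative_eq_intros)
    ultimately have "((\<lambda>t. f (x + t *\<^sub>R s)) has_derivative (\<lambda>h. (h *\<^sub>R s) \<bullet> gf (x + t *\<^sub>R s))) (at t)"
      by (rule has_derivative_compose[rotated])
    then have "((\<lambda>t. f (x + t *\<^sub>R s)) has_real_derivative (s \<bullet> gf (x + t *\<^sub>R s))) (at t)"
      by (simp add: has_field_derivative_def mult_commute_abs)
    then show ?thesis
      unfolding h_def by (auto intro!: derivative_eq_intros simp: inner_diff_left inner_commute[of s])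
  qed
  have "\<exists>z>0. z < 1 \<and> h 1 - h 0 = (1 - 0) * ((gf (x + z *\<^sub>R s) - gf x) \<bullet> s)"
    by (rule MVT2) (auto intro: d)
  then obtain z where z: "0 < z" "z < 1" "h 1 - h 0 = (gf (x + z *\<^sub>R s) - gf x) \<bullet> s" by auto
  have L: "0 \<le> L" using lip by (rule lipschitz_on_nonneg)
  have "\<bar>h 1 - h 0\<bar> \<le> norm (gf (x + z *\<^sub>R s) - gf x) * norm s"
    unfolding z(3) by (rule Cauchy_Schwarz_ineq2)
  also have "norm (gf (x + z *\<^sub>R s) - gf x) \<le> L * norm s"
  proof -
    have "norm (gf (x + z *\<^sub>R s) - gf x) \<le> L * norm (z *\<^sub>R s)"
      using lipschitz_onD[OF lip, of "x + z *\<^sub>R s" x] by (simp add: dist_norm)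
    also have "\<dots> \<le> L * norm s" using z L by (intro mult_left_mono) (auto simp: mult_left_le_one_le)
    finally show ?thesis .
  qed
  finally show ?thesis by (simp add: h_def power2_eq_square mult_right_mono mult.assoc)
qed

lemma norm_scale_ball:
  fixes B :: "real^'d::finite^'p::finite"
  assumes "0 < r" "\<And>s. norm s = r \<Longrightarrow> norm (B *v s) \<le> C * r"
  shows "norm (B *v s) \<le> C * norm s"
proof (cases "s = 0")
  case False
  have "norm (B *v ((r / norm s) *\<^sub>R s)) \<le> C * r" using assms(1) False by (intro assms(2)) simp
  then have "(r / norm s) * norm (B *v s) \<le> C * r" using assms(1) by (simp add: matrix_vector_mult_scaleR)
  then have "r * norm (B *v s) \<le> r * (C * norm s)" using False by (simp add: field_simps)
  then show ?thesis using assms(1) by simp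
qed simp

text \<open>On unit vectors, \<open>A x *v s\<close> is a difference of two bounded values of
  \<open>c\<close> up to a bounded remainder; homogeneity does the rest.\<close>

lemma jacobian_bounded:
  fixes c :: "real^'d::finite \<Rightarrow> real^'p::finite"
  assumes q: "\<And>x s. norm (c (x + s) - c x - A x *v s) \<le> 1/2 * L * (norm s)\<^sup>2"
    and b: "\<And>x. norm (c x) \<le> u"
  shows "norm (A x *v s) \<le> (2 * u + L) * norm s"
proof (rule norm_scale_ball)
  fix s :: "real^'d" assume s: "norm s = 1"
  have "norm (A x *v s) = norm ((c (x + s) - c x) - (c (x + s) - c x - A x *v s))" by simp
  also have "\<dots> \<le> norm (c (x + s) - c x) + norm (c (x + s) - c x - A x *v s)" by (rule norm_triangle_ineq4)
  also have "norm (c (x + s) - c x) \<le> norm (c (x + s)) + norm (c x)" by (rule norm_triangle_ineq4)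
  finally have "norm (A x *v s) \<le> norm (c (x + s)) + norm (c x) + norm (c (x + s) - c x - A x *v s)" by simp
  moreover have "0 \<le> L" using order_trans[OF norm_ge_zero q[of x s]] s by simp
  ultimately show "norm (A x *v s) \<le> (2 * u + L) * 1" using b[of "x + s"] b[of x] q[of x s] s by simp
qed simp

text \<open>The Lipschitz property of \<open>A\<close> is recovered from the remainder bound for
  \<open>c\<close> alone. Three expansions, two from \<open>x\<close> and one from \<open>y\<close>,
  cancel all values of \<open>c\<close>. With \<open>s\<close> of the same length as
  \<open>h\<close> the remainders add up to \<open>(4 + 1 + 1) / 2 = 3\<close> times
  \<open>L * norm h * norm h\<close>.\<close>

lemma jacobian_lipschitz:
  fixes c :: "real^'d::finite \<Rightarrow> real^'p::finite"
  assumes q: "\<And>x s. norm (c (x + s) - c x - A x *v s) \<le> 1/2 * L * (norm s)\<^sup>2"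
  shows "norm ((A y - A x) *v s) \<le> (3 * L * norm (y - x)) * norm s"
proof (cases "y = x")
  case False
  define h where "h = y - x"
  have h: "0 < norm h" using False by (simp add: h_def)
  have L: "0 \<le> L"
  proof -
    have "0 \<le> 1/2 * L * (norm h)\<^sup>2" by (rule order_trans[OF norm_ge_zero q])
    then show ?thesis using h by (simp add: zero_le_mult_iff)
  qed
  show ?thesis unfolding h_def[symmetric]
  proof (rule norm_scale_ball[OF h])
    fix s :: "real^'d" assume s: "norm s = norm h"
    let ?a = "c (y + s) - c y - A y *v s" and ?b = "c (x + (h + s)) - c x - A x *v (h + s)"
      and ?e = "c (x + h) - c x - A x *v h"
    have "(A y - A x) *v s = ?b - ?e - ?a"
    proof -
      have xh: "x + h = y" by (simp add: h_def)
      have "x + (h + s) = y + s" by (simp only: xh add.assoc[symmetric])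
      note eq = this xh
      show ?thesis unfolding eq by (simp add: matrix_vector_right_distrib matrix_vector_mult_diff_rdistrib)
    qed
    then have "norm ((A y - A x) *v s) = norm (?b - ?e - ?a)" by (rule arg_cong)
    also have "\<dots> \<le> norm ?b + norm ?e + norm ?a"
      using norm_triangle_ineq4[of "?b - ?e" ?a] norm_triangle_ineq4[of ?b ?e] by linarith
    also have "\<dots> \<le> 1/2 * L * (norm (h + s))\<^sup>2 + 1/2 * L * (norm h)\<^sup>2 + 1/2 * L * (norm s)\<^sup>2"
      by (intro add_mono q)
    also have "\<dots> \<le> 1/2 * L * (2 * norm h)\<^sup>2 + 1/2 * L * (norm h)\<^sup>2 + 1/2 * L * (norm s)\<^sup>2"
      using L norm_triangle_ineq[of h s] s by (intro add_mono mult_left_mono power_mono) auto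
    also have "\<dots> = 3 * L * norm h * norm h" by (simp add: s power2_eq_square)
    finally show "norm ((A y - A x) *v s) \<le> 3 * L * norm h * norm h" .
  qed
qed simp

lemma qpoly_offset:
  "qpoly (a, b, h) (offset \<Delta> Center) = a"
  "qpoly (a, b, h) (offset \<Delta> (Fwd j)) = a + \<Delta> * b $ j + 1/2 * \<Delta>\<^sup>2 * h $ j"
  "qpoly (a, b, h) (offset \<Delta> (Bwd j)) = a - \<Delta> * b $ j + 1/2 * \<Delta>\<^sup>2 * h $ j"
proof -
  have s: "(\<Sum>i\<in>UNIV. h $ i * (1/2 * ((t *\<^sub>R axis j 1 :: real^'a) $ i)\<^sup>2)) = 1/2 * t\<^sup>2 * h $ j" for t :: real
  proof -
    have "(\<Sum>i\<in>UNIV. h $ i * (1/2 * ((t *\<^sub>R axis j 1 :: real^'a) $ i)\<^sup>2))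
      = (\<Sum>i\<in>UNIV. if i = j then 1/2 * t\<^sup>2 * h $ j else 0)"
      by (intro sum.cong refl) (auto simp: axis_def)
    then show ?thesis by simp
  qed
  show "qpoly (a, b, h) (offset \<Delta> Center) = a" by (simp add: qpoly_def)
  show "qpoly (a, b, h) (offset \<Delta> (Fwd j)) = a + \<Delta> * b $ j + 1/2 * \<Delta>\<^sup>2 * h $ j"
    unfolding qpoly_def offset.simps prod.case s by (simp add: inner_axis)
  have m: "- (\<Delta> *\<^sub>R axis j 1) = (- \<Delta>) *\<^sub>R (axis j 1 :: real^'a)" by simp
  show "qpoly (a, b, h) (offset \<Delta> (Bwd j)) = a - \<Delta> * b $ j + 1/2 * \<Delta>\<^sup>2 * h $ j"
    unfolding qpoly_def offset.simps prod.case m s by (simp add: inner_axis)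
qed

text \<open>On the symmetric design the linear coefficients see only the odd part of the data, which
  makes them central differences. The full solution \<open>\<beta>\<close> is needed because
  \<open>interp\<close> is a \<open>THE\<close>, so existence and uniqueness must both be
  shown.\<close>

lemma interp_linear_coeff:
  fixes v :: "'d::finite design \<Rightarrow> real"
  assumes "\<Delta> \<noteq> 0"
  shows "fst (snd (interp \<Delta> v)) $ j = (v (Fwd j) - v (Bwd j)) / (2 * \<Delta>)"
proof -
  define \<beta> :: "'d qcoeffs" where "\<beta> = (v Center, (\<chi> j. (v (Fwd j) - v (Bwd j)) / (2 * \<Delta>)),
     (\<chi> j. (v (Fwd j) + v (Bwd j) - 2 * v Center) / \<Delta>\<^sup>2))"
  have "interp \<Delta> v = \<beta>"
    unfolding interp_def
  proof (rule the_equality)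
    show "\<forall>i. qpoly \<beta> (offset \<Delta> i) = v i"
    proof
      fix i show "qpoly \<beta> (offset \<Delta> i) = v i"
        unfolding \<beta>_def using assms by (cases i) (simp_all add: qpoly_offset field_simps power2_eq_square del: offset.simps)
    qed
    fix \<gamma> :: "'d qcoeffs" assume \<gamma>: "\<forall>i. qpoly \<gamma> (offset \<Delta> i) = v i"
    obtain a b h where g: "\<gamma> = (a, b, h)" by (cases \<gamma>)
    have C: "v Center = a" and P: "v (Fwd j) = a + \<Delta> * b $ j + 1/2 * \<Delta>\<^sup>2 * h $ j"
      and B: "v (Bwd j) = a - \<Delta> * b $ j + 1/2 * \<Delta>\<^sup>2 * h $ j" for j
      using \<gamma> unfolding g by (metis qpoly_offset)+
    show "\<gamma> = \<beta>"
      unfolding g \<beta>_def C P B using assms by (simp add: vec_eq_iff)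
  qed
  then show ?thesis by (simp add: \<beta>_def)
qed

text \<open>Once above \<open>B\<close> no further jump can occur. If \<open>B\<close> is never
  exceeded, the sequence is monotone and bounded, so its increments eventually drop below the
  minimal jump \<open>\<tau>\<close>.\<close>

lemma eventually_constant_of_bounded_jumps:
  fixes p :: "nat \<Rightarrow> real"
  assumes \<tau>: "0 < \<tau>" and step: "\<And>k. K \<le> k \<Longrightarrow> p (Suc k) = p k \<or> (p k \<le> B \<and> p k + \<tau> \<le> p (Suc k))"
  obtains q N where "K \<le> N" "\<And>k. N \<le> k \<Longrightarrow> p k = q"
proof -
  have mono: "p k \<le> p (Suc k)" if "K \<le> k" for k using step[OF that] \<tau> by auto
  have mono': "p i \<le> p j" if "K \<le> i" "i \<le> j" for i j
    using that(2)
  proof (induction rule: dec_induct)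
    case (step n)
    then show ?case using mono[of n] that(1) by linarith
  qed simp
  have "\<exists>N\<ge>K. \<forall>k\<ge>N. p (Suc k) = p k"
  proof (cases "\<exists>n\<ge>K. B < p n")
    case True
    then obtain n where n: "K \<le> n" "B < p n" by blast
    have "p (Suc k) = p k" if "n \<le> k" for k
      using step[of k] mono'[OF n(1) that] n that by auto
    with n show ?thesis by blast
  next
    case False
    define r where "r k = p (K + k)" for k
    have "incseq r" unfolding r_def by (rule incseq_SucI) (use mono in auto)
    moreover have "\<forall>i. r i \<le> B" using False unfolding r_def by (auto simp: not_less)
    ultimately obtain L where "r \<longlonglongrightarrow> L" using incseq_convergent by blast
    then have "(\<lambda>k. r (Suc k) - r k) \<longlonglongrightarrow> L - L" by (intro tendsto_diff LIMSEQ_Suc)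
    then have "\<forall>\<^sub>F k in sequentially. r (Suc k) - r k < \<tau>" using \<tau> by (intro order_tendstoD) simp_all
    then obtain N where N: "\<And>k. N \<le> k \<Longrightarrow> r (Suc k) - r k < \<tau>" unfolding eventually_sequentially by blast
    have "p (Suc k) = p k" if "K + N \<le> k" for k
    proof -
      have "K + (k - K) = k" "N \<le> k - K" "K \<le> k" using that by auto
      then show ?thesis using step[of k] N[of "k - K"] by (auto simp: r_def)
    qed
    then show ?thesis by (intro exI[of _ "K + N"]) auto
  qed
  then obtain N where N: "K \<le> N" "\<And>k. N \<le> k \<Longrightarrow> p (Suc k) = p k" by blast
  have "p k = p N" if "N \<le> k" for k
    using that by (induction rule: dec_induct) (auto simp: N)
  with N(1) show ?thesis using that by blast
qed

text \<open>The classical way from \<open>liminf\<close> to \<open>lim\<close>: on a stretch where \<open>\<theta>\<close> stays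
  above \<open>\<epsilon>\<close> its total variation is controlled by the decrease of the convergent sequence
  \<open>\<phi>\<close>.\<close>

lemma tendsto_0_of_controlled_variation:
  fixes \<theta> \<phi> :: "nat \<Rightarrow> real"
  assumes nonneg: "\<And>k. 0 \<le> \<theta> k" and \<phi>: "convergent \<phi>"
    and small: "\<And>\<epsilon>. 0 < \<epsilon> \<Longrightarrow> \<exists>\<^sub>F k in sequentially. \<theta> k < \<epsilon>"
    and var: "\<And>\<epsilon>. 0 < \<epsilon> \<Longrightarrow> \<exists>C\<ge>0. \<forall>\<^sub>F k in sequentially.
       \<epsilon> \<le> \<theta> k \<longrightarrow> \<bar>\<theta> (Suc k) - \<theta> k\<bar> \<le> C * (\<phi> k - \<phi> (Suc k))"
  shows "\<theta> \<longlonglongrightarrow> 0"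
proof (rule LIMSEQ_I)
  fix r :: real assume r: "0 < r"
  define \<epsilon> where "\<epsilon> = r / 2"
  have \<epsilon>: "0 < \<epsilon>" using r by (simp add: \<epsilon>_def)
  obtain C where C: "0 \<le> C" "\<forall>\<^sub>F k in sequentially.
       \<epsilon> \<le> \<theta> k \<longrightarrow> \<bar>\<theta> (Suc k) - \<theta> k\<bar> \<le> C * (\<phi> k - \<phi> (Suc k))" using var[OF \<epsilon>] by blast
  then obtain K1 where K1: "\<And>k. K1 \<le> k \<Longrightarrow> \<epsilon> \<le> \<theta> k \<Longrightarrow> \<bar>\<theta> (Suc k) - \<theta> k\<bar> \<le> C * (\<phi> k - \<phi> (Suc k))"
    unfolding eventually_sequentially by blast
  have "Cauchy \<phi>" using \<phi> by (rule convergent_Cauchy)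
  moreover have "0 < \<epsilon> / (C + 1)" using \<epsilon> C(1) by simp
  ultimately obtain K2 where K2: "\<And>m n. K2 \<le> m \<Longrightarrow> K2 \<le> n \<Longrightarrow> norm (\<phi> m - \<phi> n) < \<epsilon> / (C + 1)"
    unfolding Cauchy_iff by blast
  have "\<theta> m < r" if m: "max K1 K2 \<le> m" for m
  proof (rule ccontr)
    assume "\<not> \<theta> m < r"
    then have mr: "2 * \<epsilon> \<le> \<theta> m" by (simp add: \<epsilon>_def)
    obtain k where k: "m \<le> k" "\<theta> k < \<epsilon>" using small[OF \<epsilon>] unfolding frequently_sequentially by blast
    \<comment> \<open>First return below \<open>\<epsilon>\<close> after \<open>m\<close>. Before it
      the variation bound applies at every index and telescopes to at most
      \<open>\<epsilon>\<close>, while \<open>\<theta>\<close> has to fall from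
      \<open>2 * \<epsilon>\<close> to below \<open>\<epsilon>\<close>.\<close>
    define l where "l = (LEAST k. m \<le> k \<and> \<theta> k < \<epsilon>)"
    have l: "m \<le> l \<and> \<theta> l < \<epsilon>" unfolding l_def by (rule LeastI[of _ k]) (use k in simp)
    have between: "\<epsilon> \<le> \<theta> j" if "m \<le> j" "j < l" for j
      using not_less_Least[of j "\<lambda>k. m \<le> k \<and> \<theta> k < \<epsilon>"] that unfolding l_def by auto
    have "\<theta> m - \<theta> j \<le> C * (\<phi> m - \<phi> j)" if "m \<le> j" "j \<le> l" for j
      using that
    proof (induction rule: dec_induct)
      case (step j)
      have "\<bar>\<theta> (Suc j) - \<theta> j\<bar> \<le> C * (\<phi> j - \<phi> (Suc j))"
        using step m by (intro K1 between) auto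
      with step show ?case by (simp add: algebra_simps abs_le_iff)
    qed simp
    from this[of l] l have "\<theta> m - \<theta> l \<le> C * (\<phi> m - \<phi> l)" by simp
    also have "\<dots> \<le> C * (\<epsilon> / (C + 1))"
      using K2[of m l] m l C(1) by (intro mult_left_mono) auto
    also have "\<dots> \<le> \<epsilon>" using C(1) \<epsilon> by (simp add: field_simps)
    finally show False using l mr by linarith
  qed
  then show "\<exists>no. \<forall>n\<ge>no. norm (\<theta> n - 0) < r" using nonneg by (auto intro!: exI[of _ "max K1 K2"])
qed

lemma square_summable_of_potential_decrease:
  fixes \<psi> \<Delta> :: "nat \<Rightarrow> real"
  assumes b: "0 < b" and dec: "\<And>k. K \<le> k \<Longrightarrow> \<psi> (Suc k) \<le> \<psi> k - b * (\<Delta> k)\<^sup>2" and lb: "\<And>k. m \<le> \<psi> k"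
  shows "\<Delta> \<longlonglongrightarrow> 0" "convergent \<psi>"
proof -
  define r where "r k = \<psi> (K + k)" for k
  have rd: "r (Suc k) \<le> r k - b * (\<Delta> (K + k))\<^sup>2" for k using dec[of "K + k"] by (simp add: r_def)
  have "r (Suc k) \<le> r k" for k
    using rd[of k] mult_nonneg_nonneg[OF less_imp_le[OF b] zero_le_power2[of "\<Delta> (K + k)"]] by linarith
  then have "decseq r" by (rule decseq_SucI)
  moreover have "\<forall>i. m \<le> r i" using lb by (simp add: r_def)
  ultimately obtain L where L: "r \<longlonglongrightarrow> L" using decseq_convergent by blast
  then show "convergent \<psi>"
    unfolding convergent_def by (intro exI[of _ L] LIMSEQ_offset[of \<psi> K]) (simp add: r_def[abs_def] add.commute)
  have "(\<lambda>k. (r k - r (Suc k)) / b) \<longlonglongrightarrow> (L - L) / b" by (intro tendsto_intros LIMSEQ_Suc L) (use b in simp)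
  then have "(\<lambda>k. (r k - r (Suc k)) / b) \<longlonglongrightarrow> 0" by simp
  then have "(\<lambda>k. (\<Delta> (K + k))\<^sup>2) \<longlonglongrightarrow> 0"
    by (rule tendsto_sandwich[rotated 3, where f="\<lambda>_. 0"])
       (use rd b in \<open>auto simp: field_simps intro!: always_eventually\<close>)
  then have "(\<lambda>k. sqrt ((\<Delta> (K + k))\<^sup>2)) \<longlonglongrightarrow> sqrt 0" by (rule tendsto_real_sqrt)
  then have "(\<lambda>k. \<Delta> (k + K)) \<longlonglongrightarrow> 0" by (simp add: tendsto_rabs_zero_iff add.commute)
  then show "\<Delta> \<longlonglongrightarrow> 0" by (rule LIMSEQ_offset)
qed

section \<open>Convergence along a path\<close>

text \<open>Kept apart from the path analysis below because the sampling argument uses it on every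
  path, before any almost sure property is known.\<close>

lemma rad_bounds:
  assumes params: "valid_params P" and path: "sqp_path F c A P \<zeta> R"
  shows "0 < rad (R k) \<and> rad (R k) \<le> p_radmax P"
proof (induction k)
  case 0
  then show ?case using params path by (simp add: valid_params_def sqp_path_def)
next
  case (Suc k)
  note par = params[unfolded valid_params_def]
  have step: "rad (R (Suc k)) = (if successful c A P (R k) then min (p_ginc P * rad (R k)) (p_radmax P) else p_gdec P * rad (R k))"
    using path unfolding sqp_path_def by presburger
  have "p_gdec P * rad (R k) \<le> 1 * rad (R k)" using Suc par by (intro mult_right_mono) auto
  then have "p_gdec P * rad (R k) \<le> p_radmax P" using Suc by linarith
  then show ?case using Suc par unfolding step by simp
qed

text \<open>One sample path, studied deterministically; the randomness survives only in
  \<open>accurate\<close>. The arbitrary tolerance \<open>e\<close> there matters in the proof that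
  the radius vanishes; elsewhere \<open>e = 1\<close> suffices.\<close>

locale sqp_run =
  fixes F :: "real^'d::finite \<Rightarrow> 'x \<Rightarrow> real" and f :: "real^'d \<Rightarrow> real" and gf :: "real^'d \<Rightarrow> real^'d"
    and c :: "real^'d \<Rightarrow> real^'p::finite" and A :: "real^'d \<Rightarrow> real^'d^'p"
    and P :: "'d sqp_params" and \<zeta> :: "nat \<Rightarrow> 'd node \<Rightarrow> nat \<Rightarrow> 'x" and R :: "nat \<Rightarrow> ('d, 'p) iterate"
    and \<kappa>Lg fmin \<kappa>Lc \<kappa>ug \<kappa>uc \<kappa>uH \<kappa>nsd \<kappa>ncr \<kappa>tcr \<kappa>Amin :: real
  assumes gderiv: "\<And>x. GDERIV f x :> gf x"
    and smooth: "smooth_bounded f gf c A \<kappa>Lg fmin \<kappa>Lc \<kappa>ug \<kappa>uc"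
    and params: "valid_params P"
    and path: "sqp_path F c A P \<zeta> R"
    and Hk_bound: "\<And>k. spectral_norm (Hk (R k)) \<le> \<kappa>uH - 1"
    and AN_orthonormal: "\<And>k i j. i < ncols (R k) \<Longrightarrow> j < ncols (R k) \<Longrightarrow>
         AN (R k) i \<bullet> AN (R k) j = (if i = j then 1 else 0)"
    and AR_norm: "\<And>k v. norm (AR (R k) *v v) = norm (transpose (A (Xk (R k))) *v v)"
    and nsd: "0 < \<kappa>nsd"
    and sn_split: "\<And>k. \<exists>snR snN. sn (R k) = AR (R k) *v snR + ANmul (R k) snN \<and>
         normN (R k) snN \<le> \<kappa>nsd * norm snR"
    and ncr: "0 < \<kappa>ncr"
    and normal_decrease: "\<And>k. mn c A (R k) 0 - mn c A (R k) (sn (R k)) \<ge>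
           \<kappa>ncr * (norm (transpose (A (Xk (R k))) *v c (Xk (R k))) / norm (c (Xk (R k)))) *
             min (p_an P * rad (R k))
                 (\<kappa>Amin * norm (c (Xk (R k))) / (1 + spectral_norm (transpose (A (Xk (R k))) ** A (Xk (R k)))))"
    and tcr: "0 < \<kappa>tcr"
    and tangent_decrease: "\<And>k. Mt (R k) 0 - Mt (R k) (St (R k)) \<ge>
           \<kappa>tcr * normN (R k) (GN (R k)) * min (p_at P * rad (R k)) (normN (R k) (GN (R k)) / \<kappa>uH)"
    and Amin: "0 < \<kappa>Amin"
    and singular: "\<And>k. \<forall>\<sigma>\<in>singular_values (A (Xk (R k))). \<kappa>Amin \<le> \<sigma>"
    and accurate: "\<And>e. 0 < e \<Longrightarrow> \<forall>\<^sub>F k in sequentially. \<forall>i. \<bar>est (R k) i - f (node_pt (R k) i)\<bar> \<le> e * (rad (R k))\<^sup>2"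
begin

lemmas par = params[unfolded valid_params_def]

lemma gf_lipschitz: "\<kappa>Lg-lipschitz_on UNIV gf" and f_ge: "fmin \<le> f x" and \<kappa>Lc_pos: "0 < \<kappa>Lc"
  and c_quadratic: "norm (c (x + s) - c x - A x *v s) \<le> 1/2 * \<kappa>Lc * (norm s)\<^sup>2"
  and gf_le: "norm (gf x) \<le> \<kappa>ug" and c_le: "norm (c x) \<le> \<kappa>uc"
  using smooth unfolding smooth_bounded_def by auto

lemma \<kappa>Lg_nonneg: "0 \<le> \<kappa>Lg"
  by (rule lipschitz_on_nonneg[OF gf_lipschitz])

lemma \<kappa>ug_nonneg: "0 \<le> \<kappa>ug" and \<kappa>uc_nonneg: "0 \<le> \<kappa>uc"
  using order_trans[OF norm_ge_zero gf_le] order_trans[OF norm_ge_zero c_le] by auto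

lemma iteration: "sqp_iteration F c A P k (\<zeta> k) (R k)"
  and pen_old_Suc: "pen_old (R (Suc k)) = pen (R k)"
  and start: "pen_old (R 0) = p_penmin P"
  and success_step: "successful c A P (R k) \<Longrightarrow> Xk (R (Suc k)) = Xs (R k)"
    "successful c A P (R k) \<Longrightarrow> rad (R (Suc k)) = min (p_ginc P * rad (R k)) (p_radmax P)"
  and failure_step: "\<not> successful c A P (R k) \<Longrightarrow> Xk (R (Suc k)) = Xk (R k)"
    "\<not> successful c A P (R k) \<Longrightarrow> rad (R (Suc k)) = p_gdec P * rad (R k)"
  using path unfolding sqp_path_def by auto

lemmas iter = iteration[unfolded sqp_iteration_def]

lemma rad_pos: "0 < rad (R k)" and rad_le: "rad (R k) \<le> p_radmax P"
  using rad_bounds[OF params path] by auto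

lemma radmax_pos: "0 < p_radmax P"
  using rad_pos[of 0] rad_le[of 0] by linarith

lemma AN_span: "span (AN (R k) ` {..<ncols (R k)}) = {s. A (Xk (R k)) *v s = 0}"
  using iter[of k] unfolding basis_family_def by blast

lemma A_ANmul: "A (Xk (R k)) *v ANmul (R k) w = 0"
proof -
  have "ANmul (R k) w \<in> span (AN (R k) ` {..<ncols (R k)})"
    unfolding ANmul_def by (intro span_sum span_scale span_base) auto
  then show ?thesis using AN_span by auto
qed

lemma A_St: "A (Xk (R k)) *v St (R k) = 0"
  unfolding St_def by (rule A_ANmul)

lemma norm_ANmul: "norm (ANmul (R k) w) = normN (R k) w"
  unfolding ANmul_def normN_def by (rule norm_orthonormal_sum) (rule AN_orthonormal)

lemma normN_ANtr_le: "normN (R k) (ANtr (R k) v) \<le> norm v"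
  unfolding normN_def ANtr_def by (rule L2_set_inner_orthonormal_le) (rule AN_orthonormal)

lemma normN_ANtr_diff: "normN (R k) (ANtr (R k) v) - normN (R k) (ANtr (R k) w) \<le> norm (v - w)"
proof -
  have "normN (R k) (ANtr (R k) v) = L2_set (\<lambda>j. ANtr (R k) w j + ANtr (R k) (v - w) j) {..<ncols (R k)}"
    unfolding normN_def ANtr_def by (simp add: inner_diff_right)
  also have "\<dots> \<le> normN (R k) (ANtr (R k) w) + normN (R k) (ANtr (R k) (v - w))"
    unfolding normN_def by (rule L2_set_triangle_ineq)
  finally show ?thesis using normN_ANtr_le[of k "v - w"] by linarith
qed

lemma normN_nonneg: "0 \<le> normN (R k) w"
  unfolding normN_def by simp

lemma norm_AT_ge: "\<kappa>Amin * norm u \<le> norm (transpose (A (Xk (R k))) *v u)"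
  by (rule norm_transpose_mult_ge[OF singular])

lemma norm_A_le: "norm (A x *v s) \<le> (2 * \<kappa>uc + \<kappa>Lc) * norm s"
  by (rule jacobian_bounded[OF c_quadratic c_le])

text \<open>Spectral norms are nonnegative, so the \<open>- 1\<close> in the bound on
  \<open>Hk\<close> keeps \<open>\<kappa>uH\<close> away from 0 and quotients by it
  harmless.\<close>

lemma \<kappa>uH_ge: "1 \<le> \<kappa>uH"
  using onorm_pos_le[OF matrix_vector_mul_bounded_linear[of "Hk (R 0)"]] Hk_bound[of 0] by linarith

lemma norm_Hk_le: "norm (Hk (R k) *v v) \<le> \<kappa>uH * norm v"
proof -
  have "norm (Hk (R k) *v v) \<le> spectral_norm (Hk (R k)) * norm v"
    by (rule onorm[OF matrix_vector_mul_bounded_linear])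
  also have "\<dots> \<le> \<kappa>uH * norm v" using Hk_bound[of k] by (intro mult_right_mono) auto
  finally show ?thesis .
qed

lemma quad_Hk_le: "\<bar>v \<bullet> (Hk (R k) *v v)\<bar> \<le> \<kappa>uH * (norm v)\<^sup>2"
proof -
  have "\<bar>v \<bullet> (Hk (R k) *v v)\<bar> \<le> norm v * norm (Hk (R k) *v v)" by (rule Cauchy_Schwarz_ineq2)
  also have "\<dots> \<le> norm v * (\<kappa>uH * norm v)" by (intro mult_left_mono norm_Hk_le) auto
  finally show ?thesis by (simp add: power2_eq_square mult_ac)
qed

text \<open>Symmetry merges the two cross terms between normal and tangent step in
  \<open>pred_eq\<close>.\<close>

lemma Hk_sym: "(Hk (R k) *v u) \<bullet> v = u \<bullet> (Hk (R k) *v v)"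
proof -
  have W: "Wc (R k) i $ a $ b = Wc (R k) i $ b $ a" for i a b
  proof -
    have "transpose (Wc (R k) i) = Wc (R k) i" using iter[of k] by blast
    from arg_cong[OF this, of "\<lambda>M. M $ a $ b"] show ?thesis by (simp add: transpose_def)
  qed
  have "transpose (Hk (R k)) = Hk (R k)"
    unfolding Hk_def lagrangian_hess_def vec_eq_iff
    using W by (auto simp: transpose_def diag_matrix_def sum_component intro!: sum.cong)
  then show ?thesis using inner_transpose_mult[of "Hk (R k)" u v] by simp
qed

section \<open>Reductions by the normal step, the tangent step and the merit model\<close>

definition theta :: "nat \<Rightarrow> real" where "theta k = norm (c (Xk (R k)))"
definition normal_red :: "nat \<Rightarrow> real" where "normal_red k = mn c A (R k) 0 - mn c A (R k) (sn (R k))"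
definition tangent_red :: "nat \<Rightarrow> real" where "tangent_red k = Mt (R k) 0 - Mt (R k) (St (R k))"
definition model_red :: "nat \<Rightarrow> real" where "model_red k = Qk (R k) (Xk (R k)) - Qk (R k) (Xk (R k) + sn (R k))"
definition pred :: "nat \<Rightarrow> real" where
  "pred k = merit_model c A (R k) (Xk (R k)) - merit_model c A (R k) (Xs (R k))"
text \<open>Accuracy at tolerance 1. Bounds stated under it have constants independent of
  \<open>k\<close>, and it holds for all large \<open>k\<close>.\<close>

definition good :: "nat \<Rightarrow> bool" where
  "good k \<longleftrightarrow> (\<forall>i. \<bar>est (R k) i - f (node_pt (R k) i)\<bar> \<le> (rad (R k))\<^sup>2)"

lemma eventually_good: "\<forall>\<^sub>F k in sequentially. good k"
  using accurate[of 1] unfolding good_def by simp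

lemma theta_nonneg: "0 \<le> theta k" by (simp add: theta_def)

text \<open>\<open>Mt\<close> is the quadratic model re-expanded at the end of the normal step, so
  the two model reductions add up; the tangent step lies in the kernel of the Jacobian, so the
  linearized violation sees the normal step only.\<close>

lemma pred_eq: "pred k = model_red k + tangent_red k + pen (R k) * normal_red k"
proof -
  let ?H = "Hk (R k)" and ?n = "sn (R k)" and ?t = "St (R k)"
  have "(?n + ?t) \<bullet> (?H *v (?n + ?t)) = ?n \<bullet> (?H *v ?n) + 2 * ((?H *v ?n) \<bullet> ?t) + ?t \<bullet> (?H *v ?t)"
    using Hk_sym[of k ?n ?t]
    by (simp add: matrix_vector_right_distrib inner_add_left inner_add_right inner_commute[of ?t "?H *v ?n"])
  then show ?thesis
    unfolding pred_def model_red_def tangent_red_def normal_red_def merit_model_def Xs_def Qk_def Mt_def mn_def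
    by (simp add: A_St matrix_vector_right_distrib inner_add_left inner_add_right algebra_simps)
qed

text \<open>The smallest singular value bounds the ratio in the Cauchy condition from below, and the
  bounded Jacobian keeps its denominator bounded.\<close>

lemma normal_red_ge: "\<exists>\<kappa>n>0. \<forall>k. \<kappa>n * min (rad (R k)) (theta k) \<le> normal_red k"
proof -
  define CA where "CA = 2 * \<kappa>uc + \<kappa>Lc"
  define \<kappa>1 where "\<kappa>1 = min (p_an P) (\<kappa>Amin / (1 + CA * CA))"
  have \<kappa>1: "0 < \<kappa>1" unfolding \<kappa>1_def using par Amin by (auto intro!: divide_pos_pos add_pos_nonneg)
  define \<kappa>n where "\<kappa>n = \<kappa>ncr * \<kappa>Amin * \<kappa>1"
  have "\<kappa>n * min (rad (R k)) (theta k) \<le> normal_red k" for k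
  proof -
    let ?B = "A (Xk (R k))" and ?m = "min (rad (R k)) (theta k)"
    let ?r = "norm (transpose ?B *v c (Xk (R k))) / norm (c (Xk (R k)))"
    let ?s = "spectral_norm (transpose ?B ** ?B)"
    have s: "0 \<le> ?s" "?s \<le> CA * CA"
      unfolding CA_def by (rule onorm_pos_le[OF matrix_vector_mul_bounded_linear], rule spectral_norm_gram_le[OF norm_A_le])
    have m0: "0 \<le> ?m" using rad_pos[of k] theta_nonneg[of k] by simp
    show ?thesis
    proof (cases "theta k = 0")
      \<comment> \<open>Division by 0 gives 0, so for \<open>c = 0\<close> the Cauchy condition
        reads as nonnegativity.\<close>
      case True
      then show ?thesis
        using normal_decrease[of k] rad_pos[of k] by (simp add: normal_red_def theta_def)
    next
      case False
      then have th: "0 < norm (c (Xk (R k)))" by (simp add: theta_def)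
      have r: "\<kappa>Amin \<le> ?r" using norm_AT_ge[of "c (Xk (R k))" k] th by (simp add: pos_le_divide_eq)
      have "\<kappa>1 * ?m \<le> p_an P * rad (R k)"
        using par m0 \<kappa>1 rad_pos[of k] by (intro mult_mono) (auto simp: \<kappa>1_def)
      moreover have "\<kappa>1 * ?m \<le> \<kappa>Amin * norm (c (Xk (R k))) / (1 + ?s)"
      proof -
        have "\<kappa>1 * ?m \<le> (\<kappa>Amin / (1 + CA * CA)) * theta k"
          using m0 Amin by (intro mult_mono) (auto simp: \<kappa>1_def theta_def intro!: divide_nonneg_nonneg)
        also have "\<dots> = \<kappa>Amin * theta k / (1 + CA * CA)" by simp
        also have "\<dots> \<le> \<kappa>Amin * theta k / (1 + ?s)"
          using s Amin theta_nonneg[of k] by (intro divide_left_mono mult_pos_pos) (auto intro: add_pos_nonneg)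
        finally show ?thesis by (simp add: theta_def)
      qed
      ultimately have m: "\<kappa>1 * ?m \<le> min (p_an P * rad (R k)) (\<kappa>Amin * norm (c (Xk (R k))) / (1 + ?s))" by simp
      have "\<kappa>n * ?m = \<kappa>ncr * \<kappa>Amin * (\<kappa>1 * ?m)" by (simp add: \<kappa>n_def)
      also have "\<dots> \<le> \<kappa>ncr * ?r * min (p_an P * rad (R k)) (\<kappa>Amin * norm (c (Xk (R k))) / (1 + ?s))"
        using ncr Amin m0 \<kappa>1 r by (intro mult_mono m mult_left_mono) auto
      also have "\<dots> \<le> normal_red k" unfolding normal_red_def by (rule normal_decrease)
      finally show ?thesis .
    qed
  qed
  moreover have "0 < \<kappa>n" using ncr Amin \<kappa>1 by (simp add: \<kappa>n_def)
  ultimately show ?thesis by blast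
qed

lemma normal_red_nonneg: "0 \<le> normal_red k"
proof -
  obtain \<kappa>n where "0 < \<kappa>n" "\<kappa>n * min (rad (R k)) (theta k) \<le> normal_red k" using normal_red_ge by blast
  moreover have "0 \<le> \<kappa>n * min (rad (R k)) (theta k)"
    using calculation(1) rad_pos[of k] theta_nonneg[of k] by simp
  ultimately show ?thesis by linarith
qed

text \<open>Since the normal step does not increase the linearized violation, its image under the
  Jacobian has norm at most \<open>2 * theta k\<close>. The Jacobian is bounded below on the row
  space, which bounds the component there; \<open>AR_norm\<close> turns this into a bound on
  \<open>snR\<close>, and the null-space component is controlled by \<open>snR\<close>.\<close>

lemma sn_le: "\<exists>Cs>0. \<forall>k. norm (sn (R k)) \<le> Cs * theta k"
proof -
  define Cs where "Cs = 2 / \<kappa>Amin + \<kappa>nsd * (2 / (\<kappa>Amin * \<kappa>Amin))"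
  have "norm (sn (R k)) \<le> Cs * theta k" for k
  proof -
    let ?B = "A (Xk (R k))"
    obtain snR snN where sp: "sn (R k) = AR (R k) *v snR + ANmul (R k) snN"
      and N: "normN (R k) snN \<le> \<kappa>nsd * norm snR" using sn_split by blast
    have "norm (?B *v sn (R k)) \<le> norm (?B *v sn (R k) + c (Xk (R k))) + norm (c (Xk (R k)))"
      using norm_triangle_ineq4[of "?B *v sn (R k) + c (Xk (R k))" "c (Xk (R k))"] by simp
    also have "\<dots> \<le> 2 * theta k"
      using normal_red_nonneg[of k] by (simp add: normal_red_def mn_def theta_def)
    finally have 1: "norm (?B *v (AR (R k) *v snR)) \<le> 2 * theta k"
      by (simp add: sp matrix_vector_right_distrib A_ANmul)
    have "AR (R k) *v snR \<in> range (\<lambda>u. transpose ?B *v u)"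
    proof -
      have "AR (R k) *v snR \<in> span (range (\<lambda>i. column i (AR (R k))))"
        unfolding matrix_mult_sum vector_scalar_mult_def[symmetric] scalar_mult_eq_scaleR
        by (intro span_sum span_scale span_base) auto
      then show ?thesis using iter[of k] unfolding basis_family_def by blast
    qed
    then obtain u where u: "AR (R k) *v snR = transpose ?B *v u" by blast
    have "\<kappa>Amin * norm (AR (R k) *v snR) \<le> 2 * theta k"
      using norm_mult_ge_on_range_transpose[OF Amin norm_AT_ge u] 1 by linarith
    then have R1: "norm (AR (R k) *v snR) \<le> 2 / \<kappa>Amin * theta k"
      using Amin by (simp add: field_simps)
    have "\<kappa>Amin * norm snR \<le> norm (AR (R k) *v snR)" unfolding AR_norm by (rule norm_AT_ge)
    with R1 have "\<kappa>Amin * norm snR \<le> 2 / \<kappa>Amin * theta k" by linarith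
    then have R2: "norm snR \<le> 2 / (\<kappa>Amin * \<kappa>Amin) * theta k"
      using Amin by (simp add: field_simps)
    have "norm (sn (R k)) \<le> norm (AR (R k) *v snR) + normN (R k) snN"
      unfolding sp norm_ANmul[symmetric] by (rule norm_triangle_ineq)
    also have "\<dots> \<le> 2 / \<kappa>Amin * theta k + \<kappa>nsd * (2 / (\<kappa>Amin * \<kappa>Amin) * theta k)"
      using N R1 mult_left_mono[OF R2, of \<kappa>nsd] nsd by linarith
    finally show ?thesis by (simp add: Cs_def algebra_simps)
  qed
  moreover have "0 < Cs" unfolding Cs_def using Amin nsd by (auto intro!: add_pos_pos divide_pos_pos mult_pos_pos)
  ultimately show ?thesis by blast
qed

lemma sn_le_min: "\<exists>Cs>0. \<forall>k. norm (sn (R k)) \<le> Cs * min (rad (R k)) (theta k)"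
proof -
  obtain Cs where Cs: "0 < Cs" "\<And>k. norm (sn (R k)) \<le> Cs * theta k" using sn_le by blast
  have "norm (sn (R k)) \<le> max 1 Cs * min (rad (R k)) (theta k)" for k
  proof -
    have "norm (sn (R k)) \<le> p_an P * rad (R k)" using iter[of k] by blast
    also have "\<dots> \<le> max 1 Cs * rad (R k)" using par rad_pos[of k] by (intro mult_right_mono) auto
    finally have 1: "norm (sn (R k)) \<le> max 1 Cs * rad (R k)" .
    have 2: "norm (sn (R k)) \<le> max 1 Cs * theta k"
      by (rule order_trans[OF Cs(2)], rule mult_right_mono) (auto simp: theta_nonneg)
    from 1 2 show ?thesis by (simp add: min_def)
  qed
  then show ?thesis by (intro exI[of _ "max 1 Cs"]) auto
qed

lemma tangent_red_nonneg: "0 \<le> tangent_red k"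
proof -
  have "0 \<le> \<kappa>tcr * normN (R k) (GN (R k)) * min (p_at P * rad (R k)) (normN (R k) (GN (R k)) / \<kappa>uH)"
    using tcr par rad_pos[of k] normN_nonneg[of k "GN (R k)"] \<kappa>uH_ge by (intro mult_nonneg_nonneg) auto
  with tangent_decrease[of k] show ?thesis unfolding tangent_red_def by linarith
qed

text \<open>Estimation and Taylor errors are both of order \<open>rad^2\<close>, and the central
  difference divides them by the radius. The dimension comes from bounding the norm by the sum of
  the components.\<close>

lemma G_close: "good k \<Longrightarrow> norm (Gk (R k) - gf (Xk (R k))) \<le> real CARD('d) * (1 + \<kappa>Lg) * rad (R k)"
proof -
  assume g: "good k"
  let ?D = "rad (R k)" and ?x = "Xk (R k)"
  have comp: "\<bar>(Gk (R k) - gf ?x) $ j\<bar> \<le> (1 + \<kappa>Lg) * ?D" for j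
  proof -
    let ?e = "axis j 1 :: real^'d"
    have ne: "norm (?D *\<^sub>R ?e) = ?D" "norm (- (?D *\<^sub>R ?e)) = ?D" using rad_pos[of k] by auto
    have F: "\<bar>f (?x + ?D *\<^sub>R ?e) - f ?x - ?D * gf ?x $ j\<bar> \<le> \<kappa>Lg * ?D\<^sup>2"
      using gderiv_taylor[OF gderiv gf_lipschitz, of ?x "?D *\<^sub>R ?e"] unfolding ne by (simp add: inner_axis)
    have B: "\<bar>f (?x - ?D *\<^sub>R ?e) - f ?x + ?D * gf ?x $ j\<bar> \<le> \<kappa>Lg * ?D\<^sup>2"
      using gderiv_taylor[OF gderiv gf_lipschitz, of ?x "- (?D *\<^sub>R ?e)"] unfolding ne by (simp add: inner_axis)
    have eF: "\<bar>est (R k) (Design (Fwd j)) - f (?x + ?D *\<^sub>R ?e)\<bar> \<le> ?D\<^sup>2"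
      using g[unfolded good_def, rule_format, of "Design (Fwd j)"] by simp
    have eB: "\<bar>est (R k) (Design (Bwd j)) - f (?x - ?D *\<^sub>R ?e)\<bar> \<le> ?D\<^sup>2"
      using g[unfolded good_def, rule_format, of "Design (Bwd j)"] by simp
    have "Gk (R k) $ j = (est (R k) (Design (Fwd j)) - est (R k) (Design (Bwd j))) / (2 * ?D)"
      unfolding Gk_def model_coeffs_def using rad_pos[of k] by (subst interp_linear_coeff) auto
    then have "2 * ?D * (Gk (R k) $ j - gf ?x $ j) = est (R k) (Design (Fwd j)) - est (R k) (Design (Bwd j)) - 2 * ?D * gf ?x $ j"
      using rad_pos[of k] by (simp add: field_simps)
    also have "\<bar>\<dots>\<bar> \<le> 2 * ?D\<^sup>2 + 2 * (\<kappa>Lg * ?D\<^sup>2)" using F B eF eB by linarith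
    also have "\<dots> = (2 * ?D) * ((1 + \<kappa>Lg) * ?D)" by (simp add: power2_eq_square algebra_simps)
    finally have "(2 * ?D) * \<bar>Gk (R k) $ j - gf ?x $ j\<bar> \<le> (2 * ?D) * ((1 + \<kappa>Lg) * ?D)"
      unfolding abs_mult using rad_pos[of k] by simp
    then show ?thesis using rad_pos[of k] by simp
  qed
  have "norm (Gk (R k) - gf ?x) \<le> (\<Sum>j\<in>UNIV. \<bar>(Gk (R k) - gf ?x) $ j\<bar>)" by (rule norm_le_l1_cart)
  also have "\<dots> \<le> (\<Sum>j\<in>(UNIV::'d set). (1 + \<kappa>Lg) * ?D)" by (intro sum_mono comp)
  finally show ?thesis by simp
qed

text \<open>The normal step ignores the objective and may increase the model, but only in proportion
  to its own length; \<open>CG\<close> bounds the slope. The scale is that of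
  \<open>normal_red_ge\<close>, so a bounded penalty can pay for it.\<close>

lemma model_red_ge: "\<exists>Cq>0. \<forall>k. good k \<longrightarrow> - model_red k \<le> Cq * min (rad (R k)) (theta k)"
proof -
  obtain Cs where Cs: "0 < Cs" "\<And>k. norm (sn (R k)) \<le> Cs * min (rad (R k)) (theta k)" using sn_le_min by blast
  define CG where "CG = \<kappa>ug + real CARD('d) * (1 + \<kappa>Lg) * p_radmax P + \<kappa>uH * p_radmax P"
  have CG: "0 < CG" unfolding CG_def
    using \<kappa>ug_nonneg \<kappa>Lg_nonneg \<kappa>uH_ge radmax_pos by (intro add_nonneg_pos add_nonneg_nonneg mult_pos_pos) auto
  have "- model_red k \<le> CG * Cs * min (rad (R k)) (theta k)" if g: "good k" for k
  proof -
    let ?n = "sn (R k)"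
    have "norm (Gk (R k)) \<le> norm (gf (Xk (R k))) + norm (Gk (R k) - gf (Xk (R k)))"
      by (rule norm_triangle_sub)
    also have "norm (Gk (R k) - gf (Xk (R k))) \<le> real CARD('d) * (1 + \<kappa>Lg) * p_radmax P"
      by (rule order_trans[OF G_close[OF g]], rule mult_left_mono[OF rad_le]) (use \<kappa>Lg_nonneg in auto)
    finally have G: "norm (Gk (R k)) \<le> \<kappa>ug + real CARD('d) * (1 + \<kappa>Lg) * p_radmax P"
      using gf_le[of "Xk (R k)"] by linarith
    have nr: "norm ?n \<le> p_radmax P"
    proof -
      have "norm ?n \<le> p_an P * rad (R k)" using iter[of k] by blast
      also have "\<dots> \<le> 1 * rad (R k)" using par rad_pos[of k] by (intro mult_right_mono) auto
      finally show ?thesis using rad_le[of k] by simp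
    qed
    have "- model_red k = Gk (R k) \<bullet> ?n + 1/2 * (?n \<bullet> (Hk (R k) *v ?n))" by (simp add: model_red_def Qk_def)
    also have "\<dots> \<le> norm (Gk (R k)) * norm ?n + \<kappa>uH * (norm ?n)\<^sup>2"
      using norm_cauchy_schwarz[of "Gk (R k)" ?n] quad_Hk_le[of ?n k] by (auto simp: abs_le_iff)
    also have "\<kappa>uH * (norm ?n)\<^sup>2 \<le> \<kappa>uH * p_radmax P * norm ?n"
      using mult_right_mono[OF nr norm_ge_zero, of ?n] \<kappa>uH_ge by (simp add: power2_eq_square mult.assoc)
    also have "norm (Gk (R k)) * norm ?n + \<kappa>uH * p_radmax P * norm ?n = (norm (Gk (R k)) + \<kappa>uH * p_radmax P) * norm ?n"
      by (simp add: algebra_simps)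
    also have "\<dots> \<le> CG * norm ?n" using G by (intro mult_right_mono) (auto simp: CG_def)
    also have "\<dots> \<le> CG * (Cs * min (rad (R k)) (theta k))" using CG by (intro mult_left_mono Cs) auto
    finally show ?thesis by simp
  qed
  moreover have "0 < CG * Cs" using CG Cs by simp
  ultimately show ?thesis by blast
qed

section \<open>The penalty and the predicted reduction\<close>

lemma penC_eq: "penC (p_nu P) c A (R k) = (if normal_red k = 0 then penB (R k)
    else max (penB (R k)) (- (model_red k + tangent_red k) / ((1 - p_nu P) * normal_red k)))"
  unfolding penC_def normal_red_def model_red_def tangent_red_def by simp

lemma pen_eq: "pen (R k) = (if pen_old (R k) < penC (p_nu P) c A (R k)
        then max (penC (p_nu P) c A (R k)) (max (p_tau1 P * pen_old (R k)) (pen_old (R k) + p_tau2 P))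
        else pen_old (R k))"
  using iter[of k] by blast

lemma pen_old_ge: "p_penmin P \<le> pen_old (R k)" and pen_ge: "p_penmin P \<le> pen (R k)"
proof -
  have s: "pen_old (R k) \<le> pen (R k)" for k using pen_eq[of k] par by auto
  show 1: "p_penmin P \<le> pen_old (R k)" for k
  proof (induction k)
    case (Suc k) then show ?case using s[of k] by (simp add: pen_old_Suc)
  qed (simp add: start)
  show "p_penmin P \<le> pen (R k)" using 1[of k] s[of k] by linarith
qed

lemma penC_le_pen: "penC (p_nu P) c A (R k) \<le> pen (R k)"
  using pen_eq[of k] by auto

text \<open>In the quotient defining \<open>penC\<close>, numerator and denominator are compared
  through \<open>min (rad (R k)) (theta k)\<close>, which cancels; the trial penalty is thus
  eventually bounded by \<open>B\<close>. Every update starts below \<open>B\<close> and adds at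
  least \<open>p_tau2 P\<close>.\<close>

lemma pen_eventually_constant: "\<exists>q>0. \<forall>\<^sub>F k in sequentially. pen (R k) = q"
proof -
  obtain \<kappa>n where \<kappa>n: "0 < \<kappa>n" "\<And>k. \<kappa>n * min (rad (R k)) (theta k) \<le> normal_red k" using normal_red_ge by blast
  obtain Cq where Cq: "0 < Cq" "\<And>k. good k \<Longrightarrow> - model_red k \<le> Cq * min (rad (R k)) (theta k)" using model_red_ge by blast
  define B where "B = max (p_penBmax P) (Cq / \<kappa>n / (1 - p_nu P))"
  have pc: "penC (p_nu P) c A (R k) \<le> B" if g: "good k" for k
  proof -
    have pB: "penB (R k) \<le> p_penBmax P" using iter[of k] by blast
    have "- (model_red k + tangent_red k) / ((1 - p_nu P) * normal_red k) \<le> Cq / \<kappa>n / (1 - p_nu P)" if "normal_red k \<noteq> 0"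
    proof -
      have n: "0 < normal_red k" using that normal_red_nonneg[of k] by simp
      have "- (model_red k + tangent_red k) \<le> Cq * min (rad (R k)) (theta k)" using Cq(2)[OF g] tangent_red_nonneg[of k] by linarith
      also have "\<dots> = Cq / \<kappa>n * (\<kappa>n * min (rad (R k)) (theta k))" using \<kappa>n by simp
      also have "\<dots> \<le> Cq / \<kappa>n * normal_red k" using Cq \<kappa>n by (intro mult_left_mono \<kappa>n) auto
      finally have "- (model_red k + tangent_red k) / ((1 - p_nu P) * normal_red k) \<le> (Cq / \<kappa>n * normal_red k) / ((1 - p_nu P) * normal_red k)"
        using n par by (intro divide_right_mono) auto
      also have "\<dots> = Cq / \<kappa>n / (1 - p_nu P)" using n by simp
      finally show ?thesis .
    qed
    then show ?thesis unfolding penC_eq B_def using pB by auto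
  qed
  obtain K where K: "\<And>k. K \<le> k \<Longrightarrow> good k" using eventually_good unfolding eventually_sequentially by blast
  have "pen_old (R (Suc k)) = pen_old (R k) \<or> (pen_old (R k) \<le> B \<and> pen_old (R k) + p_tau2 P \<le> pen_old (R (Suc k)))"
    if "K \<le> k" for k
    using pc[OF K[OF that]] unfolding pen_old_Suc pen_eq[of k] by auto
  then obtain q N where qN: "\<And>k. N \<le> k \<Longrightarrow> pen_old (R k) = q"
    using eventually_constant_of_bounded_jumps[of "p_tau2 P" K "\<lambda>k. pen_old (R k)" B] par by metis
  have "pen (R k) = q" if "N \<le> k" for k using qN[of "Suc k"] that by (simp add: pen_old_Suc)
  moreover have "0 < q" using qN[of N] pen_old_ge[of N] par by simp
  ultimately show ?thesis unfolding eventually_sequentially by blast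
qed

text \<open>The inequality \<open>penC \<le> pen\<close> rearranged: the share
  \<open>1 - p_nu P\<close> of the penalized normal reduction covers any loss in the model, and the
  share \<open>p_nu P\<close> remains.\<close>

lemma pred_ge_normal_red: "p_nu P * p_penmin P * normal_red k \<le> pred k"
proof (cases "normal_red k = 0")
  \<comment> \<open>Here \<open>penC\<close> gives no information on the model reductions; instead
    vanishing normal reduction forces \<open>theta k = 0\<close>, hence a zero normal step and no
    loss in the model.\<close>
  case True
  obtain \<kappa>n where "0 < \<kappa>n" "\<kappa>n * min (rad (R k)) (theta k) \<le> normal_red k" using normal_red_ge by blast
  then have "min (rad (R k)) (theta k) \<le> 0" using True by (simp add: mult_le_0_iff)
  then have th: "theta k = 0" using rad_pos[of k] theta_nonneg[of k] by (auto simp: min_def split: if_splits)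
  obtain Cs where "norm (sn (R k)) \<le> Cs * theta k" using sn_le by blast
  then have "sn (R k) = 0" using th by simp
  then have "model_red k = 0" by (simp add: model_red_def)
  then show ?thesis using True tangent_red_nonneg[of k] by (simp add: pred_eq)
next
  case False
  then have n: "0 < normal_red k" using normal_red_nonneg[of k] by simp
  have "- (model_red k + tangent_red k) / ((1 - p_nu P) * normal_red k) \<le> pen (R k)"
    using penC_le_pen[of k] False by (simp add: penC_eq)
  then have "- (model_red k + tangent_red k) \<le> pen (R k) * ((1 - p_nu P) * normal_red k)"
    using n par by (simp add: pos_divide_le_eq)
  then have "p_nu P * (pen (R k) * normal_red k) \<le> pred k" by (simp add: pred_eq algebra_simps)
  moreover have "p_nu P * (p_penmin P * normal_red k) \<le> p_nu P * (pen (R k) * normal_red k)"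
    using par n pen_ge[of k] by (intro mult_left_mono mult_right_mono) auto
  ultimately show ?thesis by simp
qed

lemma pred_nonneg: "0 \<le> pred k"
proof -
  have "0 \<le> p_nu P * p_penmin P * normal_red k" using par normal_red_nonneg[of k] by simp
  then show ?thesis using pred_ge_normal_red[of k] by linarith
qed

lemma crit_eq: "crit c (R k) = theta k + normN (R k) (ANtr (R k) (Gk (R k)))"
  by (simp add: crit_def theta_def)

lemma crit_nonneg: "0 \<le> crit c (R k)"
  unfolding crit_eq using theta_nonneg normN_nonneg by simp

text \<open>The penalty rule may let the tangent reduction be consumed by a model increase along the
  normal step. That increase is a multiple of the normal reduction, which \<open>pred\<close>
  dominates, so \<open>pred\<close> also dominates the tangent reduction.\<close>

lemma tangent_red_le_pred: "\<exists>C>0. \<forall>k. good k \<longrightarrow> tangent_red k \<le> C * pred k"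
proof -
  obtain \<kappa>n where \<kappa>n: "0 < \<kappa>n" "\<And>k. \<kappa>n * min (rad (R k)) (theta k) \<le> normal_red k" using normal_red_ge by blast
  obtain Cq where Cq: "0 < Cq" "\<And>k. good k \<Longrightarrow> - model_red k \<le> Cq * min (rad (R k)) (theta k)" using model_red_ge by blast
  define Cp where "Cp = p_nu P * p_penmin P"
  have Cp: "0 < Cp" using par by (simp add: Cp_def)
  define C where "C = 1 + Cq / (\<kappa>n * Cp)"
  have "tangent_red k \<le> C * pred k" if "good k" for k
  proof -
    have "0 \<le> pen (R k) * normal_red k" using normal_red_nonneg[of k] pen_ge[of k] par by (intro mult_nonneg_nonneg) auto
    then have "tangent_red k \<le> pred k + - model_red k" by (simp add: pred_eq)
    also have "- model_red k \<le> Cq / (\<kappa>n * Cp) * (Cp * (\<kappa>n * min (rad (R k)) (theta k)))"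
      using Cq(2)[OF that] \<kappa>n Cp by simp
    also have "\<dots> \<le> Cq / (\<kappa>n * Cp) * (Cp * normal_red k)"
      using Cq \<kappa>n Cp by (intro mult_left_mono) auto
    also have "\<dots> \<le> Cq / (\<kappa>n * Cp) * pred k"
      using pred_ge_normal_red[of k] Cq \<kappa>n(1) Cp by (intro mult_left_mono) (auto simp: Cp_def)
    finally show ?thesis by (simp add: C_def algebra_simps)
  qed
  moreover have "0 < C" using Cq \<kappa>n(1) Cp unfolding C_def by (intro add_pos_pos) auto
  ultimately show ?thesis by blast
qed

text \<open>If the constraint violation dominates \<open>crit\<close>, the normal step yields the decrease;
  otherwise \<open>GN\<close> is comparable with \<open>crit\<close> and the tangent step does.\<close>

lemma pred_ge: "\<exists>\<kappa>p>0. \<forall>k. good k \<longrightarrow>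
   \<kappa>p * (min 1 (crit c (R k)) * min (rad (R k)) (crit c (R k))) \<le> pred k"
proof -
  obtain \<kappa>n where \<kappa>n: "0 < \<kappa>n" "\<And>k. \<kappa>n * min (rad (R k)) (theta k) \<le> normal_red k" using normal_red_ge by blast
  obtain Cs where Cs: "0 < Cs" "\<And>k. norm (sn (R k)) \<le> Cs * theta k" using sn_le by blast
  obtain Ct where Ct: "0 < Ct" "\<And>k. good k \<Longrightarrow> tangent_red k \<le> Ct * pred k" using tangent_red_le_pred by blast
  \<comment> \<open>Replacing \<open>Gk\<close> by \<open>Gk + Hk *v sn\<close> costs at most
    \<open>\<kappa>uH * Cs * theta k\<close>. If \<open>?N\<close> exceeds
    \<open>K * theta k\<close>, this is at most half of \<open>?N\<close>; and \<open>1 < K\<close>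
    gives \<open>?cr \<le> 2 * ?N\<close>, whence the quarter in \<open>cg\<close> and the 4 in
    \<open>\<alpha>\<close>.\<close>
  define K where "K = 2 * \<kappa>uH * Cs + 1"
  have K: "1 < K" using \<kappa>uH_ge Cs by (simp add: K_def)
  define Cp where "Cp = p_nu P * p_penmin P * \<kappa>n"
  have Cp: "0 < Cp" using par \<kappa>n by (simp add: Cp_def)
  define \<alpha> where "\<alpha> = min (p_at P) (1 / (4 * \<kappa>uH))"
  have \<alpha>: "0 < \<alpha>" using par \<kappa>uH_ge by (simp add: \<alpha>_def)
  define \<kappa>1 where "\<kappa>1 = Cp / (1 + K)"
  define \<kappa>2 where "\<kappa>2 = \<kappa>tcr / 4 * \<alpha> / Ct"
  have \<kappa>12: "0 < \<kappa>1" "0 < \<kappa>2" using Cp K tcr \<alpha> Ct by (simp_all add: \<kappa>1_def \<kappa>2_def)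
  have "min \<kappa>1 \<kappa>2 * (min 1 (crit c (R k)) * min (rad (R k)) (crit c (R k))) \<le> pred k" if g: "good k" for k
  proof -
    let ?cr = "crit c (R k)" and ?D = "rad (R k)"
    let ?N = "normN (R k) (ANtr (R k) (Gk (R k)))"
    have m0: "0 \<le> min 1 ?cr * min ?D ?cr" "0 \<le> min ?D ?cr"
      using crit_nonneg[of k] rad_pos[of k] by simp_all
    show ?thesis
    proof (cases "?N \<le> K * theta k")
      case True
      then have cr: "?cr \<le> (1 + K) * theta k" unfolding crit_eq by (simp add: algebra_simps)
      have "min 1 ?cr * min ?D ?cr \<le> 1 * min ?D ?cr" using m0 by (intro mult_right_mono) auto
      also have "\<dots> \<le> (1 + K) * min ?D (theta k)"
      proof -
        have "1 * ?D \<le> (1 + K) * ?D" using K rad_pos[of k] by (intro mult_right_mono) auto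
        then show ?thesis using cr by (auto simp: min_def)
      qed
      finally have "\<kappa>1 * (min 1 ?cr * min ?D ?cr) \<le> \<kappa>1 * ((1 + K) * min ?D (theta k))"
        using \<kappa>12 by (intro mult_left_mono) auto
      also have "\<dots> = p_nu P * p_penmin P * (\<kappa>n * min ?D (theta k))" using K by (simp add: \<kappa>1_def Cp_def)
      also have "\<dots> \<le> p_nu P * p_penmin P * normal_red k" using par by (intro mult_left_mono \<kappa>n) auto
      also have "\<dots> \<le> pred k" by (rule pred_ge_normal_red)
      finally have "\<kappa>1 * (min 1 ?cr * min ?D ?cr) \<le> pred k" .
      moreover have "min \<kappa>1 \<kappa>2 * (min 1 ?cr * min ?D ?cr) \<le> \<kappa>1 * (min 1 ?cr * min ?D ?cr)"
        by (rule mult_right_mono[OF _ m0(1)]) simp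
      ultimately show ?thesis by linarith
    next
      case False
      let ?g = "normN (R k) (GN (R k))"
      have "?N - ?g \<le> norm (Gk (R k) - (Gk (R k) + Hk (R k) *v sn (R k)))"
        unfolding GN_def by (rule normN_ANtr_diff)
      also have "\<dots> \<le> \<kappa>uH * norm (sn (R k))" using norm_Hk_le by simp
      also have "\<dots> \<le> \<kappa>uH * (Cs * theta k)" using \<kappa>uH_ge by (intro mult_left_mono Cs) auto
      also have "\<dots> \<le> K * theta k / 2"
        using theta_nonneg[of k] by (simp add: K_def algebra_simps)
      also have "\<dots> \<le> ?N / 2" using False by simp
      finally have gN: "?N \<le> 2 * ?g" by simp
      have "theta k \<le> K * theta k" using K theta_nonneg[of k] mult_right_mono[of 1 K "theta k"] by simp
      then have "?cr \<le> 2 * ?N" using False unfolding crit_eq by linarith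
      then have cg: "?cr / 4 \<le> ?g" using gN by linarith
      have a1: "\<alpha> * min ?D ?cr \<le> p_at P * ?D"
        using m0 par rad_pos[of k] \<alpha> by (intro mult_mono) (auto simp: \<alpha>_def)
      have a2: "\<alpha> * min ?D ?cr \<le> ?g / \<kappa>uH"
      proof -
        have "\<alpha> * min ?D ?cr \<le> 1 / (4 * \<kappa>uH) * ?cr"
          using m0 \<kappa>uH_ge by (intro mult_mono) (auto simp: \<alpha>_def)
        also have "\<dots> = (?cr / 4) / \<kappa>uH" by simp
        also have "\<dots> \<le> ?g / \<kappa>uH" using cg \<kappa>uH_ge by (intro divide_right_mono) auto
        finally show ?thesis .
      qed
      have "\<kappa>tcr * (?cr / 4) * (\<alpha> * min ?D ?cr) \<le> \<kappa>tcr * ?g * min (p_at P * ?D) (?g / \<kappa>uH)"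
        using tcr cg a1 a2 crit_nonneg[of k] \<alpha> m0 normN_nonneg[of k "GN (R k)"]
        by (intro mult_mono mult_left_mono) auto
      also have "\<dots> \<le> tangent_red k" unfolding tangent_red_def by (rule tangent_decrease)
      also have "\<dots> \<le> Ct * pred k" by (rule Ct(2)[OF g])
      finally have 1: "\<kappa>2 * (?cr * min ?D ?cr) \<le> pred k"
        using Ct(1) by (simp add: \<kappa>2_def field_simps)
      \<comment> \<open>The normal case yields \<open>min ?D ?cr\<close> alone, the tangent case
        carries another factor \<open>?cr\<close>; \<open>min 1 ?cr\<close> lies below both
        factors.\<close>
      have "min \<kappa>1 \<kappa>2 * (min 1 ?cr * min ?D ?cr) \<le> \<kappa>2 * (?cr * min ?D ?cr)"
        using m0 \<kappa>12 crit_nonneg[of k] by (intro mult_mono mult_right_mono) auto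
      with 1 show ?thesis by linarith
    qed
  qed
  moreover have "0 < min \<kappa>1 \<kappa>2" using \<kappa>12 by simp
  ultimately show ?thesis by blast
qed

section \<open>Achieved versus predicted reduction\<close>

definition ared :: "nat \<Rightarrow> real" where
  "ared k = merit_est c (R k) (Design Center) - merit_est c (R k) Cand"

lemma rho_eq: "rho c A (R k) = ared k / pred k"
  by (simp add: rho_def ared_def pred_def)

lemma step_le: "norm (sn (R k) + St (R k)) \<le> 2 * rad (R k)"
proof -
  have "norm (sn (R k)) \<le> p_an P * rad (R k)" "norm (St (R k)) \<le> p_at P * rad (R k)" using iter[of k] by blast+
  moreover have "p_an P * rad (R k) \<le> 1 * rad (R k)" "p_at P * rad (R k) \<le> 1 * rad (R k)"
    using par rad_pos[of k] by (auto intro!: mult_right_mono)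
  ultimately show ?thesis using norm_triangle_ineq[of "sn (R k)" "St (R k)"] by linarith
qed

text \<open>The step has length at most \<open>2 * rad (R k)\<close>. Curvature, Taylor and
  linearization errors are quadratic in it, and the gradient error is of first order times the step.
  The penalty stays explicit because it is constant only eventually.\<close>

lemma ared_pred_close: "\<exists>C>0. \<forall>k. good k \<longrightarrow> \<bar>ared k - pred k\<bar> \<le> (C + 2 * \<kappa>Lc * pen (R k)) * (rad (R k))\<^sup>2"
proof -
  define Cg where "Cg = real CARD('d) * (1 + \<kappa>Lg)"
  define C where "C = 2 + 2 * Cg + 2 * \<kappa>uH + 4 * \<kappa>Lg"
  have Cg: "0 \<le> Cg" using \<kappa>Lg_nonneg by (simp add: Cg_def)
  have "\<bar>ared k - pred k\<bar> \<le> (C + 2 * \<kappa>Lc * pen (R k)) * (rad (R k))\<^sup>2" if g: "good k" for k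
  proof -
    let ?D = "rad (R k)" and ?x = "Xk (R k)" and ?S = "sn (R k) + St (R k)" and ?G = "Gk (R k)"
    let ?q = "?S \<bullet> (Hk (R k) *v ?S)"
    have S2: "(norm ?S)\<^sup>2 \<le> 4 * ?D\<^sup>2" using power_mono[OF step_le[of k], of 2] by (simp add: power_mult_distrib)
    have eC: "\<bar>est (R k) (Design Center) - f ?x\<bar> \<le> ?D\<^sup>2"
      using g[unfolded good_def, rule_format, of "Design Center"] by simp
    have eS: "\<bar>est (R k) Cand - f (?x + ?S)\<bar> \<le> ?D\<^sup>2"
      using g[unfolded good_def, rule_format, of "Cand"] by (simp add: Xs_def)
    have tf: "\<bar>f (?x + ?S) - f ?x - gf ?x \<bullet> ?S\<bar> \<le> 4 * \<kappa>Lg * ?D\<^sup>2"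
      using gderiv_taylor[OF gderiv gf_lipschitz, of ?x ?S] mult_left_mono[OF S2 \<kappa>Lg_nonneg] by linarith
    have tG: "\<bar>?G \<bullet> ?S - gf ?x \<bullet> ?S\<bar> \<le> 2 * Cg * ?D\<^sup>2"
    proof -
      have "\<bar>(?G - gf ?x) \<bullet> ?S\<bar> \<le> norm (?G - gf ?x) * norm ?S" by (rule Cauchy_Schwarz_ineq2)
      also have "\<dots> \<le> (Cg * ?D) * (2 * ?D)"
        using G_close[OF g] step_le[of k] Cg rad_pos[of k] by (intro mult_mono) (auto simp: Cg_def)
      finally show ?thesis by (simp add: inner_diff_left power2_eq_square mult_ac)
    qed
    have tH: "\<bar>1/2 * ?q\<bar> \<le> 2 * \<kappa>uH * ?D\<^sup>2"
    proof -
      have "\<kappa>uH * (norm ?S)\<^sup>2 \<le> \<kappa>uH * (4 * ?D\<^sup>2)" using S2 \<kappa>uH_ge by (intro mult_left_mono) auto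
      with quad_Hk_le[of ?S k] have "\<bar>?q\<bar> \<le> \<kappa>uH * (4 * ?D\<^sup>2)" by linarith
      then show ?thesis by (simp add: abs_mult)
    qed
    let ?a = "norm (c ?x + A ?x *v ?S)" and ?b = "norm (c (?x + ?S))"
    have "\<bar>?b - ?a\<bar> \<le> norm (c (?x + ?S) - (c ?x + A ?x *v ?S))" by (rule norm_triangle_ineq3)
    also have "c (?x + ?S) - (c ?x + A ?x *v ?S) = c (?x + ?S) - c ?x - A ?x *v ?S" by (simp add: algebra_simps)
    also have "norm \<dots> \<le> 1/2 * \<kappa>Lc * (norm ?S)\<^sup>2" by (rule c_quadratic)
    also have "\<dots> \<le> 2 * \<kappa>Lc * ?D\<^sup>2" using mult_left_mono[OF S2, of "1/2 * \<kappa>Lc"] \<kappa>Lc_pos by simp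
    finally have tc: "\<bar>?b - ?a\<bar> \<le> 2 * \<kappa>Lc * ?D\<^sup>2" .
    have p0: "0 \<le> pen (R k)" using pen_ge[of k] par by linarith
    have tp: "\<bar>pen (R k) * ?a - pen (R k) * ?b\<bar> \<le> pen (R k) * (2 * \<kappa>Lc * ?D\<^sup>2)"
    proof -
      have "\<bar>pen (R k) * ?a - pen (R k) * ?b\<bar> = pen (R k) * \<bar>?b - ?a\<bar>"
        using p0 by (simp add: abs_mult right_diff_distrib[symmetric] abs_minus_commute)
      also have "\<dots> \<le> pen (R k) * (2 * \<kappa>Lc * ?D\<^sup>2)" by (rule mult_left_mono[OF tc p0])
      finally show ?thesis .
    qed
    have "ared k - pred k = (est (R k) (Design Center) - f ?x) - (est (R k) Cand - f (?x + ?S))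
      - (f (?x + ?S) - f ?x - gf ?x \<bullet> ?S) + (?G \<bullet> ?S - gf ?x \<bullet> ?S) + 1/2 * ?q + (pen (R k) * ?a - pen (R k) * ?b)"
      by (simp add: ared_def pred_def merit_est_def merit_model_def Qk_def Xs_def algebra_simps)
    then have "\<bar>ared k - pred k\<bar> \<le> ?D\<^sup>2 + ?D\<^sup>2 + 4 * \<kappa>Lg * ?D\<^sup>2 + 2 * Cg * ?D\<^sup>2 + 2 * \<kappa>uH * ?D\<^sup>2 + pen (R k) * (2 * \<kappa>Lc * ?D\<^sup>2)"
      using eC eS tf tG tH tp by linarith
    also have "\<dots> = (C + 2 * \<kappa>Lc * pen (R k)) * ?D\<^sup>2" by (simp add: C_def algebra_simps)
    finally show ?thesis .
  qed
  moreover have "0 < C" unfolding C_def using Cg \<kappa>uH_ge \<kappa>Lg_nonneg by linarith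
  ultimately show ?thesis by blast
qed

lemma success_of_small_rad:
  assumes \<epsilon>: "0 < \<epsilon>"
  shows "\<exists>\<delta>>0. \<forall>\<^sub>F k in sequentially. \<epsilon> \<le> crit c (R k) \<longrightarrow> rad (R k) \<le> \<delta> \<longrightarrow> successful c A P (R k)"
proof -
  obtain \<kappa>p where \<kappa>p: "0 < \<kappa>p" "\<And>k. good k \<Longrightarrow> \<kappa>p * (min 1 (crit c (R k)) * min (rad (R k)) (crit c (R k))) \<le> pred k"
    using pred_ge by blast
  obtain C where C: "0 < C" "\<And>k. good k \<Longrightarrow> \<bar>ared k - pred k\<bar> \<le> (C + 2 * \<kappa>Lc * pen (R k)) * (rad (R k))\<^sup>2"
    using ared_pred_close by blast
  obtain q where q: "0 < q" "\<forall>\<^sub>F k in sequentially. pen (R k) = q" using pen_eventually_constant by blast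
  define C' where "C' = C + 2 * \<kappa>Lc * q"
  have C': "0 < C'" unfolding C'_def using C q \<kappa>Lc_pos by (simp add: add_pos_pos)
  define s where "s = \<kappa>p * min 1 \<epsilon>"
  have s: "0 < s" using \<kappa>p \<epsilon> by (simp add: s_def)
  \<comment> \<open>The first bound makes \<open>min rad crit\<close> equal to the radius, the
    second passes the test against \<open>p_mu P\<close>, and the third brings
    \<open>\<bar>ared - pred\<bar>\<close> below \<open>(1 - p_eta P) * pred\<close>.\<close>
  define \<delta> where "\<delta> = min (min \<epsilon> (\<epsilon> / p_mu P)) ((1 - p_eta P) * s / C')"
  have \<delta>: "0 < \<delta>" using \<epsilon> par s C' by (simp add: \<delta>_def)
  have "\<forall>\<^sub>F k in sequentially. \<epsilon> \<le> crit c (R k) \<longrightarrow> rad (R k) \<le> \<delta> \<longrightarrow> successful c A P (R k)"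
    using q(2) eventually_good
  proof eventually_elim
    case (elim k)
    show ?case
    proof (intro impI)
      assume cr: "\<epsilon> \<le> crit c (R k)" and D: "rad (R k) \<le> \<delta>"
      note D0 = rad_pos[of k]
      have "s * rad (R k) \<le> \<kappa>p * (min 1 (crit c (R k)) * min (rad (R k)) (crit c (R k)))"
      proof -
        have "min (rad (R k)) (crit c (R k)) = rad (R k)" using cr D by (simp add: \<delta>_def)
        moreover have "min 1 \<epsilon> * rad (R k) \<le> min 1 (crit c (R k)) * rad (R k)"
          using cr D0 by (intro mult_right_mono) auto
        ultimately show ?thesis using \<kappa>p(1) by (simp add: s_def)
      qed
      with \<kappa>p(2)[OF elim(2)] have p: "s * rad (R k) \<le> pred k" by linarith
      have p0: "0 < pred k" using p s D0 by (smt (verit) mult_pos_pos)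
      have "\<bar>ared k - pred k\<bar> \<le> C' * (rad (R k))\<^sup>2" using C(2)[OF elim(2)] elim(1) by (simp add: C'_def)
      also have "\<dots> = (C' * rad (R k)) * rad (R k)" by (simp add: power2_eq_square)
      also have "\<dots> \<le> ((1 - p_eta P) * s) * rad (R k)"
      proof (rule mult_right_mono)
        have "rad (R k) \<le> (1 - p_eta P) * s / C'" using D by (simp add: \<delta>_def)
        then show "C' * rad (R k) \<le> (1 - p_eta P) * s" using C' by (simp add: pos_le_divide_eq mult.commute)
      qed (use D0 in simp)
      also have "\<dots> = (1 - p_eta P) * (s * rad (R k))" by simp
      also have "\<dots> \<le> (1 - p_eta P) * pred k" using p par by (intro mult_left_mono) auto
      finally have "p_eta P * pred k \<le> ared k" by (simp add: algebra_simps abs_le_iff)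
      then have "p_eta P \<le> rho c A (R k)" using p0 by (simp add: rho_eq pos_le_divide_eq)
      moreover have "p_mu P * rad (R k) \<le> crit c (R k)"
      proof -
        have "rad (R k) \<le> \<epsilon> / p_mu P" using D by (simp add: \<delta>_def)
        then have "p_mu P * rad (R k) \<le> \<epsilon>" using par by (simp add: pos_le_divide_eq mult.commute)
        then show ?thesis using cr by simp
      qed
      ultimately show "successful c A P (R k)" by (simp add: successful_def)
    qed
  qed
  with \<delta> show ?thesis by blast
qed

section \<open>The exact merit function and the vanishing radius\<close>

lemma success_ared: "successful c A P (R k) \<Longrightarrow> p_eta P * pred k \<le> ared k"
proof -
  assume "successful c A P (R k)"
  then have r: "p_eta P \<le> ared k / pred k" by (simp add: successful_def rho_eq)
  \<comment> \<open>A zero prediction would give the ratio 0, below the positive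
    \<open>p_eta P\<close>.\<close>
  then have "pred k \<noteq> 0" using par by auto
  then have "0 < pred k" using pred_nonneg[of k] by simp
  with r show ?thesis by (simp add: pos_le_divide_eq)
qed

text \<open>Exact function values and the final penalty \<open>q\<close>, unlike the noisy values
  compared by the algorithm: only so do the decreases of different iterations telescope.\<close>

definition merit :: "real \<Rightarrow> nat \<Rightarrow> real" where
  "merit q k = f (Xk (R k)) + q * theta k"

lemma merit_decrease:
  assumes "\<forall>\<^sub>F k in sequentially. pen (R k) = q" "0 < e"
  shows "\<forall>\<^sub>F k in sequentially. successful c A P (R k) \<longrightarrow>
     merit q (Suc k) \<le> merit q k - p_eta P * pred k + 2 * e * (rad (R k))\<^sup>2"
  using assms(1) accurate[OF assms(2)]
proof eventually_elim
  case (elim k)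
  show ?case
  proof
    assume s: "successful c A P (R k)"
    have C: "\<bar>est (R k) (Design Center) - f (Xk (R k))\<bar> \<le> e * (rad (R k))\<^sup>2"
      using elim(2)[rule_format, of "Design Center"] by simp
    have S: "\<bar>est (R k) Cand - f (Xs (R k))\<bar> \<le> e * (rad (R k))\<^sup>2"
      using elim(2)[rule_format, of "Cand"] by simp
    have "merit q k - merit q (Suc k) = ared k - (est (R k) (Design Center) - f (Xk (R k))) + (est (R k) Cand - f (Xs (R k)))"
      using success_step(1)[OF s] elim(1) by (simp add: merit_def ared_def merit_est_def theta_def)
    with C S success_ared[OF s] show "merit q (Suc k) \<le> merit q k - p_eta P * pred k + 2 * e * (rad (R k))\<^sup>2"
      by linarith
  qed
qed

lemma merit_failure: "\<not> successful c A P (R k) \<Longrightarrow> merit q (Suc k) = merit q k"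
  by (simp add: merit_def theta_def failure_step)

text \<open>On success the test \<open>crit \<ge> p_mu P * rad\<close> turns \<open>pred_ge\<close>
  into a decrease proportional to \<open>rad^2\<close>. On failure the merit stands still, and the
  shrinking radius must supply the decrease of the potential.\<close>

lemma rad_tendsto_0_and_merit_convergent:
  assumes q: "\<forall>\<^sub>F k in sequentially. pen (R k) = q" "0 < q"
  shows "(\<lambda>k. rad (R k)) \<longlonglongrightarrow> 0" "convergent (merit q)"
proof -
  obtain \<kappa>p where \<kappa>p: "0 < \<kappa>p" "\<And>k. good k \<Longrightarrow> \<kappa>p * (min 1 (crit c (R k)) * min (rad (R k)) (crit c (R k))) \<le> pred k"
    using pred_ge by blast
  \<comment> \<open>Chosen so that \<open>m1 * rad\<close> lies below both 1 and
    \<open>crit\<close>, and \<open>m2 * rad\<close> below both \<open>rad\<close> and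
    \<open>crit\<close>.\<close>
  define m1 where "m1 = min (1 / p_radmax P) (p_mu P)"
  define m2 where "m2 = min 1 (p_mu P)"
  have m: "0 < m1" "0 < m2" using par radmax_pos by (simp_all add: m1_def m2_def)
  define s where "s = p_eta P * \<kappa>p * m1 * m2"
  have s: "0 < s" using par \<kappa>p m by (simp add: s_def)
  have pred: "s * (rad (R k))\<^sup>2 \<le> p_eta P * pred k" if g: "good k" and su: "successful c A P (R k)" for k
  proof -
    let ?D = "rad (R k)" and ?cr = "crit c (R k)"
    have D: "0 < ?D" "?D \<le> p_radmax P" using rad_pos[of k] rad_le[of k] by auto
    have cr: "p_mu P * ?D \<le> ?cr" using su by (simp add: successful_def)
    have "m1 * ?D \<le> 1 / p_radmax P * ?D" using D by (intro mult_right_mono) (auto simp: m1_def)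
    also have "\<dots> \<le> 1" using D by simp
    finally have 1: "m1 * ?D \<le> 1" .
    have "m1 * ?D \<le> p_mu P * ?D" "m2 * ?D \<le> p_mu P * ?D" "m2 * ?D \<le> 1 * ?D"
      using D by (auto intro!: mult_right_mono simp: m1_def m2_def)
    then have 2: "m1 * ?D \<le> ?cr" "m2 * ?D \<le> ?cr" "m2 * ?D \<le> ?D" using cr by linarith+
    have "(m1 * ?D) * (m2 * ?D) \<le> min 1 ?cr * min ?D ?cr"
    proof (rule mult_mono)
      show "m1 * ?D \<le> min 1 ?cr" "m2 * ?D \<le> min ?D ?cr" using 1 2 by (simp_all only: min.bounded_iff)
      show "0 \<le> min 1 ?cr" "0 \<le> m2 * ?D" using m D crit_nonneg[of k] by simp_all
    qed
    then have "\<kappa>p * ((m1 * ?D) * (m2 * ?D)) \<le> \<kappa>p * (min 1 ?cr * min ?D ?cr)" using \<kappa>p by (intro mult_left_mono) auto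
    then have "\<kappa>p * ((m1 * ?D) * (m2 * ?D)) \<le> pred k" using \<kappa>p(2)[OF g] by linarith
    then have "p_eta P * (\<kappa>p * ((m1 * ?D) * (m2 * ?D))) \<le> p_eta P * pred k" using par by (intro mult_left_mono) auto
    then show ?thesis by (simp add: s_def power2_eq_square mult_ac)
  qed
  \<comment> \<open>Budget of a success, in units of \<open>rad^2\<close>: gain \<open>s\<close>,
    estimation errors \<open>s / 2\<close> (tolerance \<open>s / 4\<close>, two estimates), growth
    of the radius term at most \<open>a * p_ginc^2 = s / 4\<close>. This leaves
    \<open>s / 4\<close>, the first entry of \<open>b\<close>; the second is the gain of a
    failure.\<close>
  define a where "a = s / (4 * (p_ginc P)\<^sup>2)"
  have g1: "1 \<le> (p_ginc P)\<^sup>2" using par by (simp add: one_le_power)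
  have g0: "0 < (p_ginc P)\<^sup>2" using g1 by linarith
  have a: "0 < a" unfolding a_def using s g0 by (intro divide_pos_pos) auto
  define b where "b = min (s / 4) (a * (1 - (p_gdec P)\<^sup>2))"
  have gd: "(p_gdec P)\<^sup>2 < 1" using par by (simp add: power_less_one_iff)
  have b: "0 < b" using s a gd by (simp add: b_def)
  define \<psi> where "\<psi> k = merit q k + a * (rad (R k))\<^sup>2" for k
  have s4: "0 < s / 4" using s by simp
  have "\<forall>\<^sub>F k in sequentially. \<psi> (Suc k) \<le> \<psi> k - b * (rad (R k))\<^sup>2"
    using merit_decrease[OF q(1) s4] eventually_good
  proof eventually_elim
    case (elim k)
    let ?D = "rad (R k)"
    show ?case
    proof (cases "successful c A P (R k)")
      case True
      then have m: "merit q (Suc k) \<le> merit q k - s * ?D\<^sup>2 + 2 * (s / 4) * ?D\<^sup>2"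
        using elim pred[of k] by auto
      have "rad (R (Suc k)) \<le> p_ginc P * ?D" using success_step(2)[OF True] by simp
      then have "(rad (R (Suc k)))\<^sup>2 \<le> (p_ginc P * ?D)\<^sup>2" using rad_pos[of "Suc k"] by (intro power_mono) auto
      then have "a * (rad (R (Suc k)))\<^sup>2 \<le> a * ((p_ginc P)\<^sup>2 * ?D\<^sup>2)"
        using a by (intro mult_left_mono) (auto simp: power_mult_distrib)
      also have "\<dots> = s / 4 * ?D\<^sup>2" using g0 by (simp add: a_def)
      finally have "\<psi> (Suc k) \<le> merit q k - s / 4 * ?D\<^sup>2" using m unfolding \<psi>_def by linarith
      moreover have "b * ?D\<^sup>2 \<le> s / 4 * ?D\<^sup>2" by (rule mult_right_mono) (auto simp: b_def)
      moreover have "0 \<le> a * ?D\<^sup>2" using a by simp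
      ultimately show ?thesis unfolding \<psi>_def by linarith
    next
      case False
      then have "\<psi> (Suc k) = \<psi> k - (a * (1 - (p_gdec P)\<^sup>2)) * ?D\<^sup>2"
        by (simp add: \<psi>_def merit_failure failure_step power_mult_distrib algebra_simps)
      moreover have "b * ?D\<^sup>2 \<le> (a * (1 - (p_gdec P)\<^sup>2)) * ?D\<^sup>2" by (rule mult_right_mono) (auto simp: b_def)
      ultimately show ?thesis by linarith
    qed
  qed
  then obtain K where K: "\<And>k. K \<le> k \<Longrightarrow> \<psi> (Suc k) \<le> \<psi> k - b * (rad (R k))\<^sup>2"
    unfolding eventually_sequentially by blast
  have lb: "fmin \<le> \<psi> k" for k
    using f_ge[of "Xk (R k)"] q(2) theta_nonneg[of k] a unfolding \<psi>_def merit_def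
    by (smt (verit) mult_nonneg_nonneg zero_le_power2)
  show D0: "(\<lambda>k. rad (R k)) \<longlonglongrightarrow> 0"
    by (rule square_summable_of_potential_decrease(1)[where \<psi>=\<psi>, OF b K lb])
  have "convergent \<psi>" by (rule square_summable_of_potential_decrease(2)[where \<Delta>="\<lambda>k. rad (R k)", OF b K lb])
  then obtain L where "\<psi> \<longlonglongrightarrow> L" unfolding convergent_def by blast
  then have "(\<lambda>k. \<psi> k - a * (rad (R k))\<^sup>2) \<longlonglongrightarrow> L - a * 0\<^sup>2" by (intro tendsto_intros D0)
  then have "merit q \<longlonglongrightarrow> L" by (simp add: \<psi>_def)
  then show "convergent (merit q)" unfolding convergent_def by blast
qed

section \<open>Stationarity along the iterates\<close>

definition stat :: "nat \<Rightarrow> real" where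
  "stat k = theta k + normN (R k) (ANtr (R k) (gf (Xk (R k))))"

lemma stat_nonneg: "0 \<le> stat k"
  unfolding stat_def using theta_nonneg normN_nonneg by simp

text \<open>\<open>crit\<close> follows an estimated gradient and need not vary continuously with
  the iterate; \<open>stat\<close> does, and the vanishing radius lets bounds pass from it to
  \<open>crit\<close>.\<close>

lemma stat_crit: "good k \<Longrightarrow> stat k - crit c (R k) \<le> real CARD('d) * (1 + \<kappa>Lg) * rad (R k)"
  unfolding stat_def crit_eq
  using normN_ANtr_diff[of k "gf (Xk (R k))" "Gk (R k)"] G_close[of k]
  by (simp add: norm_minus_commute)

text \<open>The first part of the constant is the change of the gradient, the second the motion of
  the row space under the Lipschitz Jacobian.\<close>

lemma null_coords_lipschitz:
  "normN (R j) (ANtr (R j) (gf (Xk (R j)))) - normN (R k) (ANtr (R k) (gf (Xk (R k))))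
   \<le> (\<kappa>Lg + 3 * \<kappa>Lc * (2 * \<kappa>ug / \<kappa>Amin)) * norm (Xk (R j) - Xk (R k))"
proof -
  let ?d = "norm (Xk (R j) - Xk (R k))"
  have nc: "ncols (R j) = ncols (R k)" by (simp add: ncols_def)
  have "normN (R j) (ANtr (R j) (gf (Xk (R j)))) - normN (R k) (ANtr (R k) (gf (Xk (R k))))
      \<le> norm (gf (Xk (R j)) - gf (Xk (R k))) + (3 * \<kappa>Lc * ?d) * (2 * norm (gf (Xk (R k))) / \<kappa>Amin)"
    unfolding normN_def ANtr_def nc
  proof (rule null_space_coords_diff_le[where ?B1.0="A (Xk (R k))" and ?B2.0="A (Xk (R j))"])
    show "norm ((A (Xk (R k)) - A (Xk (R j))) *v s) \<le> (3 * \<kappa>Lc * ?d) * norm s" for s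
      using jacobian_lipschitz[OF c_quadratic, of "Xk (R k)" "Xk (R j)" s] by (simp add: norm_minus_commute)
  qed (use AN_orthonormal[of _ k] AN_orthonormal[of _ j] AN_span[of k] AN_span[of j] Amin norm_AT_ge \<kappa>Lc_pos nc in auto)
  also have "norm (gf (Xk (R j)) - gf (Xk (R k))) \<le> \<kappa>Lg * ?d"
    using lipschitz_onD[OF gf_lipschitz, of "Xk (R j)" "Xk (R k)"] by (simp add: dist_norm)
  also have "(3 * \<kappa>Lc * ?d) * (2 * norm (gf (Xk (R k))) / \<kappa>Amin) \<le> (3 * \<kappa>Lc * ?d) * (2 * \<kappa>ug / \<kappa>Amin)"
    using gf_le \<kappa>Lc_pos Amin by (intro mult_left_mono divide_right_mono) auto
  finally show ?thesis by (simp add: algebra_simps)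
qed

text \<open>The restriction to bounded displacements lets the quadratic remainder be absorbed into a
  linear bound.\<close>

lemma theta_lipschitz: "theta j - theta k \<le> (2 * \<kappa>uc + \<kappa>Lc + \<kappa>Lc * p_radmax P) * norm (Xk (R j) - Xk (R k))"
  if "norm (Xk (R j) - Xk (R k)) \<le> 2 * p_radmax P"
proof -
  let ?s = "Xk (R j) - Xk (R k)"
  have "theta j - theta k \<le> norm (c (Xk (R j)) - c (Xk (R k)))" unfolding theta_def by (rule norm_triangle_ineq2)
  also have "\<dots> = norm ((c (Xk (R k) + ?s) - c (Xk (R k)) - A (Xk (R k)) *v ?s) + A (Xk (R k)) *v ?s)" by simp
  also have "\<dots> \<le> norm (c (Xk (R k) + ?s) - c (Xk (R k)) - A (Xk (R k)) *v ?s) + norm (A (Xk (R k)) *v ?s)"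
    by (rule norm_triangle_ineq)
  also have "\<dots> \<le> 1/2 * \<kappa>Lc * (norm ?s)\<^sup>2 + (2 * \<kappa>uc + \<kappa>Lc) * norm ?s"
    by (intro add_mono c_quadratic norm_A_le)
  also have "1/2 * \<kappa>Lc * (norm ?s)\<^sup>2 \<le> \<kappa>Lc * p_radmax P * norm ?s"
    using mult_right_mono[OF that norm_ge_zero[of ?s]] \<kappa>Lc_pos by (simp add: power2_eq_square mult.assoc)
  finally show ?thesis by (simp add: algebra_simps)
qed

lemma step_norm: "norm (Xk (R (Suc k)) - Xk (R k)) \<le> 2 * rad (R k)"
proof (cases "successful c A P (R k)")
  case True
  then show ?thesis using step_le[of k] by (simp add: success_step Xs_def)
next
  case False
  then show ?thesis using rad_pos[of k] by (simp add: failure_step)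
qed

lemma stat_variation: "\<exists>L\<ge>0. \<forall>k. \<bar>stat (Suc k) - stat k\<bar> \<le> L * norm (Xk (R (Suc k)) - Xk (R k))"
proof -
  define L1 where "L1 = 2 * \<kappa>uc + \<kappa>Lc + \<kappa>Lc * p_radmax P"
  define L2 where "L2 = \<kappa>Lg + 3 * \<kappa>Lc * (2 * \<kappa>ug / \<kappa>Amin)"
  have L: "0 \<le> L1" "0 \<le> L2" unfolding L1_def L2_def
    using \<kappa>uc_nonneg \<kappa>Lc_pos radmax_pos \<kappa>Lg_nonneg \<kappa>ug_nonneg Amin by auto
  have "\<bar>stat (Suc k) - stat k\<bar> \<le> (L1 + L2) * norm (Xk (R (Suc k)) - Xk (R k))" for k
  proof -
    have s: "norm (Xk (R (Suc k)) - Xk (R k)) \<le> 2 * p_radmax P" using step_norm[of k] rad_le[of k] by linarith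
    then have s': "norm (Xk (R k) - Xk (R (Suc k))) \<le> 2 * p_radmax P" by (simp add: norm_minus_commute)
    show ?thesis
      using theta_lipschitz[OF s] theta_lipschitz[OF s'] null_coords_lipschitz[of "Suc k" k] null_coords_lipschitz[of k "Suc k"]
      unfolding stat_def L1_def[symmetric] L2_def[symmetric] norm_minus_commute[of "Xk (R k)"] distrib_right abs_le_iff
      by linarith
  qed
  with L show ?thesis by (intro exI[of _ "L1 + L2"]) auto
qed

lemma stat_tendsto_0: "stat \<longlonglongrightarrow> 0"
proof -
  obtain q where q: "0 < q" "\<forall>\<^sub>F k in sequentially. pen (R k) = q" using pen_eventually_constant by blast
  note D0 = rad_tendsto_0_and_merit_convergent(1)[OF q(2,1)] and mc = rad_tendsto_0_and_merit_convergent(2)[OF q(2,1)]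
  obtain \<kappa>p where \<kappa>p: "0 < \<kappa>p" "\<And>k. good k \<Longrightarrow> \<kappa>p * (min 1 (crit c (R k)) * min (rad (R k)) (crit c (R k))) \<le> pred k"
    using pred_ge by blast
  obtain L where L: "0 \<le> L" "\<And>k. \<bar>stat (Suc k) - stat k\<bar> \<le> L * norm (Xk (R (Suc k)) - Xk (R k))"
    using stat_variation by blast
  define Cg where "Cg = real CARD('d) * (1 + \<kappa>Lg)"
  have rad_lt: "\<forall>\<^sub>F k in sequentially. rad (R k) < \<delta>" if "0 < \<delta>" for \<delta>
    using D0 that by (rule order_tendstoD)
  have crit_large: "\<forall>\<^sub>F k in sequentially. \<epsilon> \<le> stat k \<longrightarrow> \<epsilon> / 2 \<le> crit c (R k)" if "0 < \<epsilon>" for \<epsilon>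
  proof -
    have "(\<lambda>k. Cg * rad (R k)) \<longlonglongrightarrow> Cg * 0" by (intro tendsto_intros D0)
    then have "\<forall>\<^sub>F k in sequentially. Cg * rad (R k) < \<epsilon> / 2" by (rule order_tendstoD) (use that in simp)
    then show ?thesis using eventually_good
    proof eventually_elim
      case (elim k)
      then show ?case using stat_crit[of k] unfolding Cg_def by linarith
    qed
  qed
  show ?thesis
  proof (rule tendsto_0_of_controlled_variation[OF stat_nonneg mc])
    fix \<epsilon> :: real assume \<epsilon>: "0 < \<epsilon>"
    show "\<exists>\<^sub>F k in sequentially. stat k < \<epsilon>"
    \<comment> \<open>Otherwise \<open>crit\<close> is eventually bounded below, so every late
      iteration with its small radius succeeds; then the radius no longer decreases and cannot tend
      to 0.\<close>
    proof (rule ccontr)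
      assume "\<not> ?thesis"
      then have ge: "\<forall>\<^sub>F k in sequentially. \<epsilon> \<le> stat k" by (simp add: frequently_def not_less)
      obtain \<delta> where \<delta>: "0 < \<delta>" "\<forall>\<^sub>F k in sequentially. \<epsilon> / 2 \<le> crit c (R k) \<longrightarrow> rad (R k) \<le> \<delta> \<longrightarrow> successful c A P (R k)"
        using success_of_small_rad[of "\<epsilon> / 2"] \<epsilon> by auto
      have "\<forall>\<^sub>F k in sequentially. rad (R k) \<le> rad (R (Suc k))"
        using ge crit_large[OF \<epsilon>] \<delta>(2) rad_lt[OF \<delta>(1)]
      proof eventually_elim
        case (elim k)
        then have su: "successful c A P (R k)" by auto
        have "1 * rad (R k) \<le> p_ginc P * rad (R k)" using par rad_pos[of k] by (intro mult_right_mono) auto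
        then show ?case using success_step(2)[OF su] rad_le[of k] by simp
      qed
      then obtain K where K: "\<And>k. K \<le> k \<Longrightarrow> rad (R k) \<le> rad (R (Suc k))" unfolding eventually_sequentially by blast
      have "rad (R K) \<le> rad (R k)" if "K \<le> k" for k
        using that
      proof (induction rule: dec_induct)
        case (step n) then show ?case using K[of n] by linarith
      qed simp
      then have "\<forall>\<^sub>F k in sequentially. rad (R K) \<le> rad (R k)" unfolding eventually_sequentially by blast
      then have "rad (R K) \<le> 0" using D0 by (intro tendsto_lowerbound) auto
      then show False using rad_pos[of K] by simp
    qed
    define s where "s = p_eta P * \<kappa>p * min 1 (\<epsilon> / 2)"
    have s: "0 < s" using par \<kappa>p \<epsilon> by (simp add: s_def)
    \<comment> \<open>A radius below \<open>\<epsilon> / 2\<close> makes \<open>min rad crit\<close>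
      the radius. One below \<open>s / 4\<close> keeps the two errors at tolerance 1 under
      \<open>s / 2 * rad\<close>, leaving a decrease of \<open>s / 2 * rad\<close> for a move of at
      most \<open>2 * rad\<close>; hence the factor \<open>4 * L / s\<close>.\<close>
    have small: "0 < min (\<epsilon> / 2) (s / 4)" using \<epsilon> s by simp
    have "\<forall>\<^sub>F k in sequentially. \<epsilon> \<le> stat k \<longrightarrow>
        \<bar>stat (Suc k) - stat k\<bar> \<le> (4 * L / s) * (merit q k - merit q (Suc k))"
      using crit_large[OF \<epsilon>] merit_decrease[OF q(2) zero_less_one] eventually_good rad_lt[OF small]
    proof eventually_elim
      case (elim k)
      let ?D = "rad (R k)" and ?cr = "crit c (R k)"
      show ?case
      proof
        assume st: "\<epsilon> \<le> stat k"
        show "\<bar>stat (Suc k) - stat k\<bar> \<le> (4 * L / s) * (merit q k - merit q (Suc k))"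
        proof (cases "successful c A P (R k)")
          case False
          then show ?thesis using L(2)[of k] by (simp add: failure_step merit_failure)
        next
          case True
          have cr: "\<epsilon> / 2 \<le> ?cr" using elim st by simp
          have D: "0 < ?D" "?D < \<epsilon> / 2" "?D < s / 4" using elim rad_pos[of k] by auto
          have "min ?D ?cr = ?D" using cr D by simp
          moreover have "min 1 (\<epsilon> / 2) * ?D \<le> min 1 ?cr * ?D" using cr D by (intro mult_right_mono) auto
          ultimately have "\<kappa>p * (min 1 (\<epsilon> / 2) * ?D) \<le> pred k"
            using \<kappa>p(2)[of k] elim(3) \<kappa>p(1) by (smt (verit) mult_left_mono)
          then have "p_eta P * (\<kappa>p * (min 1 (\<epsilon> / 2) * ?D)) \<le> p_eta P * pred k" using par by (intro mult_left_mono) auto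
          then have 1: "s * ?D \<le> p_eta P * pred k" by (simp add: s_def mult_ac)
          have "?D * ?D \<le> s / 4 * ?D" using D by (intro mult_right_mono) auto
          then have "2 * 1 * ?D\<^sup>2 \<le> s / 2 * ?D" by (simp add: power2_eq_square)
          then have dec: "s / 2 * ?D \<le> merit q k - merit q (Suc k)" using elim(2) True 1 by (simp add: field_simps)
          have "\<bar>stat (Suc k) - stat k\<bar> \<le> L * (2 * ?D)"
            by (rule order_trans[OF L(2) mult_left_mono[OF step_norm L(1)]])
          also have "\<dots> = (4 * L / s) * (s / 2 * ?D)" using s by simp
          also have "\<dots> \<le> (4 * L / s) * (merit q k - merit q (Suc k))" using dec L s by (intro mult_left_mono) auto
          finally show ?thesis .
        qed
      qed
    qed
    moreover have "0 \<le> 4 * L / s" using L s by simp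
    ultimately show "\<exists>C\<ge>0. \<forall>\<^sub>F k in sequentially. \<epsilon> \<le> stat k \<longrightarrow>
        \<bar>stat (Suc k) - stat k\<bar> \<le> C * (merit q k - merit q (Suc k))" by blast
  qed
qed

lemma feasible_and_stationary:
  "(\<lambda>k. norm (c (Xk (R k)))) \<longlonglongrightarrow> 0"
  "(\<lambda>k. normN (R k) (ANtr (R k) (gf (Xk (R k))))) \<longlonglongrightarrow> 0"
proof -
  show "(\<lambda>k. norm (c (Xk (R k)))) \<longlonglongrightarrow> 0"
    by (rule tendsto_sandwich[OF _ _ tendsto_const stat_tendsto_0])
       (auto simp: stat_def theta_def normN_nonneg)
  show "(\<lambda>k. normN (R k) (ANtr (R k) (gf (Xk (R k))))) \<longlonglongrightarrow> 0"
    by (rule tendsto_sandwich[OF _ _ tendsto_const stat_tendsto_0])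
       (auto simp: stat_def theta_nonneg normN_nonneg)
qed

end

section \<open>Almost sure convergence\<close>

lemma finite_nodes: "finite (UNIV :: 'd::finite node set)"
proof -
  have "(UNIV :: 'd design set) \<subseteq> {Center} \<union> range Fwd \<union> range Bwd"
  proof
    fix x :: "'d design"
    show "x \<in> {Center} \<union> range Fwd \<union> range Bwd" by (cases x) simp_all
  qed
  then have "finite (UNIV :: 'd design set)" by (rule finite_subset) simp
  then have "finite (insert Cand (range Design) :: 'd node set)" by simp
  moreover have "(UNIV :: 'd node set) \<subseteq> insert Cand (range Design)"
  proof
    fix x :: "'d node"
    show "x \<in> insert Cand (range Design)" by (cases x) simp_all
  qed
  ultimately show ?thesis by (rule finite_subset[rotated])
qed

text \<open>An almost sure statement becomes a probability equal to 1 only for a measurable event;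
  countably many tolerances exhibit the limit event as one.\<close>

lemma sets_Collect_LIMSEQ_0:
  fixes g :: "nat \<Rightarrow> 'a \<Rightarrow> real"
  assumes [measurable]: "\<And>k. g k \<in> borel_measurable M"
  shows "{\<omega> \<in> space M. (\<lambda>k. g k \<omega>) \<longlonglongrightarrow> 0} \<in> sets M"
proof -
  have "(X \<longlonglongrightarrow> 0) \<longleftrightarrow> (\<forall>m. \<exists>K. \<forall>k\<ge>K. \<bar>X k\<bar> < 1 / real (Suc m))" for X :: "nat \<Rightarrow> real"
  proof
    assume "X \<longlonglongrightarrow> 0"
    then have "\<forall>r>0. \<exists>K. \<forall>k\<ge>K. \<bar>X k\<bar> < r" by (simp add: LIMSEQ_iff)
    then show "\<forall>m. \<exists>K. \<forall>k\<ge>K. \<bar>X k\<bar> < 1 / real (Suc m)" by simp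
  next
    assume *: "\<forall>m. \<exists>K. \<forall>k\<ge>K. \<bar>X k\<bar> < 1 / real (Suc m)"
    show "X \<longlonglongrightarrow> 0"
    proof (rule LIMSEQ_I)
      fix r :: real assume "0 < r"
      then obtain m where m: "1 / real (Suc m) < r" using nat_approx_posE by blast
      from * obtain K where "\<forall>k\<ge>K. \<bar>X k\<bar> < 1 / real (Suc m)" by blast
      then have "\<forall>k\<ge>K. norm (X k - 0) < r" using less_trans[OF _ m] by simp
      then show "\<exists>no. \<forall>k\<ge>no. norm (X k - 0) < r" by blast
    qed
  qed
  then have "{\<omega> \<in> space M. (\<lambda>k. g k \<omega>) \<longlonglongrightarrow> 0}
      = {\<omega> \<in> space M. \<forall>m. \<exists>K. \<forall>k\<ge>K. \<bar>g k \<omega>\<bar> < 1 / real (Suc m)}" by simp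
  also have "\<dots> \<in> sets M" by measurable
  finally show ?thesis .
qed

text \<open>Design points are fixed by the history at the start of the iteration. The candidate
  depends on choices made after the design draws, so it is known only to the larger history
  \<open>\<F>s k\<close>, of which its own draws are independent.\<close>

lemma node_pt_measurable:
  fixes R :: "nat \<Rightarrow> 'w \<Rightarrow> ('d::finite, 'p::finite) iterate"
  assumes alg: "sqp_astro_df M \<Xi> F c A P \<F> \<F>s \<xi> R"
  shows "(\<lambda>\<omega>. node_pt (R k \<omega>) (Design i)) \<in> borel_measurable (\<F> k)"
    and "(\<lambda>\<omega>. node_pt (R k \<omega>) Cand) \<in> borel_measurable (\<F>s k)"
proof -
  have X: "(\<lambda>\<omega>. Xk (R k \<omega>)) \<in> borel_measurable (\<F> k)" and D: "(\<lambda>\<omega>. rad (R k \<omega>)) \<in> borel_measurable (\<F> k)"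
    and s: "(\<lambda>\<omega>. sn (R k \<omega>)) \<in> borel_measurable (\<F>s k)"
    and N: "(\<lambda>\<omega>. AN (R k \<omega>) j) \<in> borel_measurable (\<F>s k)"
    and w: "(\<lambda>\<omega>. StN (R k \<omega>) j) \<in> borel_measurable (\<F>s k)"
    and sub: "subalgebra (\<F>s k) (\<F> k)" for j
    using alg unfolding sqp_astro_df_def by blast+
  show "(\<lambda>\<omega>. node_pt (R k \<omega>) (Design i)) \<in> borel_measurable (\<F> k)"
    using X D by (cases i) simp_all
  have "(\<lambda>\<omega>. Xk (R k \<omega>)) \<in> borel_measurable (\<F>s k)"
    by (rule measurable_from_subalg[OF sub X])
  then show "(\<lambda>\<omega>. node_pt (R k \<omega>) Cand) \<in> borel_measurable (\<F>s k)"
    using s N w unfolding node_pt.simps Xs_def St_def ANmul_def ncols_def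
    by (intro borel_measurable_add borel_measurable_sum borel_measurable_scaleR)
qed

text \<open>Each node is handled with the history preceding its draws; finiteness of the node set
  allows the quantifier over nodes to move inside \<open>eventually\<close>.\<close>

lemma node_estimates_accurate:
  fixes R :: "nat \<Rightarrow> 'w \<Rightarrow> ('d::finite, 'p::finite) iterate"
  assumes noisy: "noisy_oracle \<Xi> F f \<sigma>f2 bf"
    and alg: "sqp_astro_df M \<Xi> F c A P \<F> \<F>s \<xi> R"
  shows "AE \<omega> in M. \<forall>e>0. \<forall>\<^sub>F k in sequentially. \<forall>i.
     \<bar>est (R k \<omega>) i - f (node_pt (R k \<omega>) i)\<bar> \<le> e * (rad (R k \<omega>))\<^sup>2"
proof -
  have M: "prob_space M" and par: "valid_params P"
    and path: "\<And>\<omega>. \<omega> \<in> space M \<Longrightarrow> sqp_path F c A P (\<lambda>k i j. \<xi> k i j \<omega>) (\<lambda>k. R k \<omega>)"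
    and sub: "\<And>k. subalgebra M (\<F> k)" "\<And>k. subalgebra M (\<F>s k)" "\<And>k. subalgebra (\<F>s k) (\<F> k)"
    and fr: "\<And>k i. fresh_draws M \<Xi> (\<F> k) (\<xi> k (Design i))" "\<And>k. fresh_draws M \<Xi> (\<F>s k) (\<xi> k Cand)"
    and D: "\<And>k. (\<lambda>\<omega>. rad (R k \<omega>)) \<in> borel_measurable (\<F> k)"
    using alg unfolding sqp_astro_df_def by blast+
  obtain \<epsilon> where \<epsilon>: "0 < \<epsilon>" "p_lam P \<in> \<Theta>(\<lambda>k. ln (real k) powr (1 + \<epsilon>))"
    and pos: "0 < p_sdmin P" "0 < p_kapd P" "\<And>k. 0 < p_lam P k"
    using par unfolding valid_params_def by blast
  have bounds: "0 < rad (R k \<omega>) \<and> rad (R k \<omega>) \<le> p_radmax P" if "\<omega> \<in> space M" for k \<omega>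
    using rad_bounds[OF par path[OF that], of k] .
  interpret noisy_oracle \<Xi> F f \<sigma>f2 bf by fact
  have "AE \<omega> in M. \<forall>e>0. \<forall>\<^sub>F k in sequentially.
     (let u = (\<lambda>j. F (node_pt (R k \<omega>) i) (\<xi> k i j \<omega>))
      in \<bar>smean (sample_size (p_sdmin P) (p_kapd P) (p_lam P k) (rad (R k \<omega>)) u) u - f (node_pt (R k \<omega>) i)\<bar>
         < e * (rad (R k \<omega>))\<^sup>2)" for i
  proof (cases i)
    case (Design d)
    show ?thesis unfolding Design
      by (rule estimates_accurate[OF M sub(1) fr(1) node_pt_measurable(1)[OF alg] D bounds pos(1,2) pos(3) \<epsilon>])
  next
    case Cand
    show ?thesis unfolding Cand
      by (rule estimates_accurate[OF M sub(2) fr(2) node_pt_measurable(2)[OF alg]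
            measurable_from_subalg[OF sub(3) D] bounds pos(1,2) pos(3) \<epsilon>])
  qed
  then have "AE \<omega> in M. \<forall>i\<in>UNIV. \<forall>e>0. \<forall>\<^sub>F k in sequentially.
     (let u = (\<lambda>j. F (node_pt (R k \<omega>) i) (\<xi> k i j \<omega>))
      in \<bar>smean (sample_size (p_sdmin P) (p_kapd P) (p_lam P k) (rad (R k \<omega>)) u) u - f (node_pt (R k \<omega>) i)\<bar>
         < e * (rad (R k \<omega>))\<^sup>2)"
    by (intro AE_finite_allI finite_nodes)
  then show ?thesis
    using AE_space
  proof eventually_elim
    case (elim \<omega>)
    have est: "est (R k \<omega>) i = (let u = (\<lambda>j. F (node_pt (R k \<omega>) i) (\<xi> k i j \<omega>))
         in smean (sample_size (p_sdmin P) (p_kapd P) (p_lam P k) (rad (R k \<omega>)) u) u)" for k i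
      using path[OF elim(2)] unfolding sqp_path_def sqp_iteration_def by blast
    show ?case
    proof (intro allI impI)
      fix e :: real assume e: "0 < e"
      have "\<forall>\<^sub>F k in sequentially. \<forall>i\<in>UNIV. \<bar>est (R k \<omega>) i - f (node_pt (R k \<omega>) i)\<bar> \<le> e * (rad (R k \<omega>))\<^sup>2"
      proof (rule eventually_ball_finite[OF finite_nodes], rule ballI)
        fix i
        from elim(1) e have "\<forall>\<^sub>F k in sequentially.
           (let u = (\<lambda>j. F (node_pt (R k \<omega>) i) (\<xi> k i j \<omega>))
            in \<bar>smean (sample_size (p_sdmin P) (p_kapd P) (p_lam P k) (rad (R k \<omega>)) u) u - f (node_pt (R k \<omega>) i)\<bar>
              < e * (rad (R k \<omega>))\<^sup>2)" by blast
        then show "\<forall>\<^sub>F k in sequentially. \<bar>est (R k \<omega>) i - f (node_pt (R k \<omega>) i)\<bar> \<le> e * (rad (R k \<omega>))\<^sup>2"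
          by eventually_elim (simp add: est Let_def)
      qed
      then show "\<forall>\<^sub>F k in sequentially. \<forall>i. \<bar>est (R k \<omega>) i - f (node_pt (R k \<omega>) i)\<bar> \<le> e * (rad (R k \<omega>))\<^sup>2"
        by simp
    qed
  qed
qed

theorem theorem5p9:
  fixes M :: "'w measure" and \<Xi> :: "'x measure"
    and F :: "real^'d \<Rightarrow> 'x \<Rightarrow> real" and f :: "real^'d \<Rightarrow> real" and gf :: "real^'d \<Rightarrow> real^'d"
    and c :: "real^'d \<Rightarrow> real^'p" and A :: "real^'d \<Rightarrow> real^'d^'p"
    and P :: "'d sqp_params" and \<F> \<F>s :: "nat \<Rightarrow> 'w measure"
    and \<xi> :: "nat \<Rightarrow> 'd node \<Rightarrow> nat \<Rightarrow> 'w \<Rightarrow> 'x"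
    and R :: "nat \<Rightarrow> 'w \<Rightarrow> ('d::finite, 'p::finite) iterate"
    and \<kappa>Lg fmin \<kappa>Lc \<kappa>ug \<kappa>uc \<sigma>f2 bf :: real
    and \<kappa>uB \<Lambda>max \<kappa>uH \<kappa>nsd \<kappa>ncr \<kappa>tcr \<kappa>Amin \<kappa>Amax :: real
  assumes problem: "nlp_problem \<Xi> F f gf c A"
    and standing_a: "smooth_bounded f gf c A \<kappa>Lg fmin \<kappa>Lc \<kappa>ug \<kappa>uc"
    and standing_b: "bernstein_noise \<Xi> F f \<sigma>f2 bf"
    and algorithm: "sqp_astro_df M \<Xi> F c A P \<F> \<F>s \<xi> R"
    and A3: "0 < \<kappa>uB" "AE \<omega> in M. \<forall>k. spectral_norm (Bk f (R k \<omega>)) \<le> \<kappa>uB"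
    and A4: "0 < \<Lambda>max"
      "AE \<omega> in M. \<forall>k i. \<forall>x\<in>cball (Xk (R k \<omega>)) (rad (R k \<omega>)).
         \<bar>lagrange_poly (Xk (R k \<omega>)) (rad (R k \<omega>)) i x\<bar> \<le> \<Lambda>max"
    and A5: "AE \<omega> in M. \<forall>k. spectral_norm (Hk (R k \<omega>)) \<le> \<kappa>uH - 1"
    and A6:
      "AE \<omega> in M. \<forall>k. \<forall>i<ncols (R k \<omega>). \<forall>j<ncols (R k \<omega>).
         AN (R k \<omega>) i \<bullet> AN (R k \<omega>) j = (if i = j then 1 else 0)"
      "AE \<omega> in M. \<forall>k v. norm (AR (R k \<omega>) *v v) = norm (transpose (A (Xk (R k \<omega>))) *v v)"
    and A7: "0 < \<kappa>nsd"
      "AE \<omega> in M. \<forall>k. \<exists>snR snN.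
         sn (R k \<omega>) = AR (R k \<omega>) *v snR + ANmul (R k \<omega>) snN \<and>
         normN (R k \<omega>) snN \<le> \<kappa>nsd * norm snR \<and>
         (transpose (A (Xk (R k \<omega>))) *v c (Xk (R k \<omega>)) = 0 \<longrightarrow> snR = 0)"
    and A8: "0 < \<kappa>ncr" "\<kappa>ncr < 1"
      "AE \<omega> in M. \<forall>k.
         let it = R k \<omega>; ck = c (Xk it); Ak = A (Xk it) in
         mn c A it 0 - mn c A it (sn it) \<ge>
           \<kappa>ncr * (norm (transpose Ak *v ck) / norm ck) *
             min (p_an P * rad it)
                 (\<kappa>Amin * norm ck / (1 + spectral_norm (transpose Ak ** Ak)))"
    and A9: "0 < \<kappa>tcr" "\<kappa>tcr < 1"
      "AE \<omega> in M. \<forall>k.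
         let it = R k \<omega> in
         norm (St it) \<le> p_at P * rad it \<and>
         Mt it 0 - Mt it (St it) \<ge>
           \<kappa>tcr * normN it (GN it) * min (p_at P * rad it) (normN it (GN it) / \<kappa>uH)"
    and A10: "0 < \<kappa>Amin" "0 < \<kappa>Amax"
      "AE \<omega> in M. \<forall>k. \<forall>\<sigma>\<in>singular_values (A (Xk (R k \<omega>))). \<kappa>Amin \<le> \<sigma> \<and> \<sigma> \<le> \<kappa>Amax"
  shows "\<P>(\<omega> in M. (\<lambda>k. norm (c (Xk (R k \<omega>)))) \<longlonglongrightarrow> 0) = 1 \<and>
         \<P>(\<omega> in M. (\<lambda>k. normN (R k \<omega>) (ANtr (R k \<omega>) (gf (Xk (R k \<omega>))))) \<longlonglongrightarrow> 0) = 1"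
proof -
  have \<Xi>: "prob_space \<Xi>" and Fm: "case_prod F \<in> borel_measurable (borel \<Otimes>\<^sub>M \<Xi>)"
    and gd: "\<And>x. GDERIV f x :> gf x" and cd: "\<And>x. (c has_derivative (\<lambda>s. A x *v s)) (at x)"
    using problem unfolding nlp_problem_def by auto
  have "continuous_on UNIV f"
    using gd unfolding gderiv_def by (intro continuous_at_imp_continuous_on ballI has_derivative_continuous)
  then have fm: "f \<in> borel_measurable borel" by (rule borel_measurable_continuous_onI)
  have "continuous_on UNIV c"
    using cd by (intro continuous_at_imp_continuous_on ballI has_derivative_continuous)
  then have cm [measurable]: "c \<in> borel_measurable borel" by (rule borel_measurable_continuous_onI)
  have gm [measurable]: "gf \<in> borel_measurable borel"
    using standing_a unfolding smooth_bounded_def by (intro borel_measurable_continuous_onI) simp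
  have noisy: "noisy_oracle \<Xi> F f \<sigma>f2 bf"
    by (rule noisy_oracle.intro[OF \<Xi> Fm fm standing_b])
  have M: "prob_space M" and par: "valid_params P"
    and path: "\<And>\<omega>. \<omega> \<in> space M \<Longrightarrow> sqp_path F c A P (\<lambda>k i j. \<xi> k i j \<omega>) (\<lambda>k. R k \<omega>)"
    and sub: "\<And>k. subalgebra M (\<F> k)" "\<And>k. subalgebra M (\<F>s k)"
    and X: "\<And>k. (\<lambda>\<omega>. Xk (R k \<omega>)) \<in> borel_measurable (\<F> k)"
    and N: "\<And>k j. (\<lambda>\<omega>. AN (R k \<omega>) j) \<in> borel_measurable (\<F>s k)"
    using algorithm unfolding sqp_astro_df_def by blast+
  interpret prob_space M by (rule M)
  have "AE \<omega> in M. (\<lambda>k. norm (c (Xk (R k \<omega>)))) \<longlonglongrightarrow> 0 \<and>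
      (\<lambda>k. normN (R k \<omega>) (ANtr (R k \<omega>) (gf (Xk (R k \<omega>))))) \<longlonglongrightarrow> 0"
    using AE_space A5 A6 A7(2) A8(3) A9(3) A10(3) node_estimates_accurate[OF noisy algorithm]
  proof eventually_elim
    case (elim \<omega>)
    interpret sqp_run F f gf c A P "\<lambda>k i j. \<xi> k i j \<omega>" "\<lambda>k. R k \<omega>"
      \<kappa>Lg fmin \<kappa>Lc \<kappa>ug \<kappa>uc \<kappa>uH \<kappa>nsd \<kappa>ncr \<kappa>tcr \<kappa>Amin
    proof
      show "GDERIV f x :> gf x" for x by (rule gd)
      show "smooth_bounded f gf c A \<kappa>Lg fmin \<kappa>Lc \<kappa>ug \<kappa>uc" by (rule standing_a)
      show "valid_params P" by (rule par)
      show "sqp_path F c A P (\<lambda>k i j. \<xi> k i j \<omega>) (\<lambda>k. R k \<omega>)" by (rule path[OF elim(1)])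
      show "spectral_norm (Hk (R k \<omega>)) \<le> \<kappa>uH - 1" for k using elim(2) by blast
      show "AN (R k \<omega>) i \<bullet> AN (R k \<omega>) j = (if i = j then 1 else 0)"
        if "i < ncols (R k \<omega>)" "j < ncols (R k \<omega>)" for k i j using elim(3) that by blast
      show "norm (AR (R k \<omega>) *v v) = norm (transpose (A (Xk (R k \<omega>))) *v v)" for k v
        using elim(4) by blast
      show "0 < \<kappa>nsd" "0 < \<kappa>ncr" "0 < \<kappa>tcr" "0 < \<kappa>Amin" by fact+
      show "\<exists>snR snN. sn (R k \<omega>) = AR (R k \<omega>) *v snR + ANmul (R k \<omega>) snN \<and>
          normN (R k \<omega>) snN \<le> \<kappa>nsd * norm snR" for k using elim(5) by blast
      show "mn c A (R k \<omega>) 0 - mn c A (R k \<omega>) (sn (R k \<omega>)) \<ge>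
           \<kappa>ncr * (norm (transpose (A (Xk (R k \<omega>))) *v c (Xk (R k \<omega>))) / norm (c (Xk (R k \<omega>)))) *
             min (p_an P * rad (R k \<omega>))
                 (\<kappa>Amin * norm (c (Xk (R k \<omega>))) / (1 + spectral_norm (transpose (A (Xk (R k \<omega>))) ** A (Xk (R k \<omega>)))))" for k
        using elim(6)[rule_format, of k] unfolding Let_def .
      show "Mt (R k \<omega>) 0 - Mt (R k \<omega>) (St (R k \<omega>)) \<ge>
           \<kappa>tcr * normN (R k \<omega>) (GN (R k \<omega>)) * min (p_at P * rad (R k \<omega>)) (normN (R k \<omega>) (GN (R k \<omega>)) / \<kappa>uH)" for k
        using elim(7)[rule_format, of k] unfolding Let_def by (rule conjunct2)
      show "\<forall>\<sigma>\<in>singular_values (A (Xk (R k \<omega>))). \<kappa>Amin \<le> \<sigma>" for k using elim(8) by blast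
      show "\<forall>\<^sub>F k in sequentially. \<forall>i. \<bar>est (R k \<omega>) i - f (node_pt (R k \<omega>) i)\<bar> \<le> e * (rad (R k \<omega>))\<^sup>2"
        if "0 < e" for e using elim(9) that by blast
    qed
    from feasible_and_stationary show ?case by blast
  qed
  then have ae: "AE \<omega> in M. (\<lambda>k. norm (c (Xk (R k \<omega>)))) \<longlonglongrightarrow> 0"
    "AE \<omega> in M. (\<lambda>k. normN (R k \<omega>) (ANtr (R k \<omega>) (gf (Xk (R k \<omega>))))) \<longlonglongrightarrow> 0"
    by (auto elim: eventually_mono)
  have [measurable]: "(\<lambda>\<omega>. Xk (R k \<omega>)) \<in> borel_measurable M" for k
    by (rule measurable_from_subalg[OF sub(1) X])
  have [measurable]: "(\<lambda>\<omega>. AN (R k \<omega>) j) \<in> borel_measurable M" for k j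
    by (rule measurable_from_subalg[OF sub(2) N])
  have "(\<lambda>\<omega>. norm (c (Xk (R k \<omega>)))) \<in> borel_measurable M" for k
    by measurable
  moreover have "(\<lambda>\<omega>. normN (R k \<omega>) (ANtr (R k \<omega>) (gf (Xk (R k \<omega>))))) \<in> borel_measurable M" for k
    unfolding normN_def ANtr_def L2_set_def ncols_def by measurable
  ultimately show ?thesis
    using ae by (simp add: prob_Collect_eq_1 sets_Collect_LIMSEQ_0)
qed

end
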